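(* Let $\Phi=\{f_i(x)=A_ix+t_i\}_{i\in\mathcal{A}}$ be a dominated planar IFS of affinities with affinity dimension $s_0\in(1,2]$. Let $X$ be the attractor of $\Phi$, let $X_F\subset\mathbb{RP}^1$ be the set of Furstenberg directions, let $\mu_K$ be the Käenmäki measure and let $\pi\colon\Sigma\to X$ be the natural projection. Then the following are equivalent: (a) $\mathcal{H}^{s_0}(X)>0$; (b) there exists $V\in X_F$ such that $\int \mathcal{H}_\infty^{s_0-1}(X\cap\mathrm{proj}_V^{-1}(t))\,d\lambda_V(t)>0$; (c) $\inf_{V\in X_F}\int \mathcal{H}_\infty^{s_0-1}(X\cap\mathrm{proj}_V^{-1}(t))\,d\lambda_V(t)>0$; (d) there exists a constant $C>0$ such that $\pi_*\mu_K(B(x,r))\leq C\cdot r^{s_0}$ for every $x\in X$ and $r>0$, where $B(x,r)$ denotes the ball with radius $r$ centred at $x$.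
   Context: Planar IFS of affinities: $\mathcal{A}$ is a finite index set and $f_i(x)=A_ix+t_i$ on $\mathbb{R}^2$ with $A_i$ a real $2\times2$ matrix, $\|A_i\|<1$, $\det A_i\neq0$, $t_i\in\mathbb{R}^2$. The attractor $X$ is the unique non-empty compact set with $X=\bigcup_{i\in\mathcal{A}}f_i(X)$. Words: $\Sigma=\mathcal{A}^{\mathbb{N}}$ (product topology), $\Sigma_*=\bigcup_{n\ge0}\mathcal{A}^n$; $|\mathbf{i}|$ is the length of $\mathbf{i}$; $\mathbf{i}|_n$ is the prefix of length $n$; $[\mathbf{i}]\subset\Sigma$ is the cylinder of infinite words with prefix $\mathbf{i}\in\Sigma_*$; the left shift is $\sigma$. For $\mathbf{i}=(i_1,\dots,i_n)$: $f_{\mathbf{i}}=f_{i_1}\circ\cdots\circ f_{i_n}$, $A_{\mathbf{i}}=A_{i_1}\cdots A_{i_n}$, and $A^*_{\mathbf{i}}:=A_{i_1}^*\cdots A_{i_n}^*$ (product of transposes in this order). The natural projection is $\pi(\mathbf{i})=\lim_{n}f_{\mathbf{i}|_n}(0)$. Affinity dimension: with $\alpha_1(A)\ge\alpha_2(A)$ the singular values, $\varphi^s(A)=\alpha_1(A)^s$ for $0\le s\le1$, $\varphi^s(A)=\alpha_1(A)\alpha_2(A)^{s-1}$ for $1< s\le2$, $\varphi^s(A)=|\det A|^{s/2}$ for $s>2$; $s_0=\inf\{s>0:\sum_{n\ge1}\sum_{\mathbf{i}\in\mathcal{A}^n}\varphi^s(A_{\mathbf{i}})<\infty\}$. Dominated: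 there are $C>0$, $0<\tau<1$ with $\alpha_2(A_{\mathbf{i}})\le C\tau^{|\mathbf{i}|}\alpha_1(A_{\mathbf{i}})$ for all $\mathbf{i}\in\Sigma_*$. Equivalently (Bochi–Gourmelon), there is a strongly invariant multicone: a non-empty proper subset $\mathcal{C}\subset\mathbb{RP}^1$ that is a finite union of closed projective intervals, with $\bigcup_{i}A_i^*\mathcal{C}\subseteq\mathcal{C}^o$ (interior). Fix such $\mathcal{C}$; the Furstenberg directions are $X_F=\bigcap_{n\ge0}\bigcup_{|\mathbf{i}|=n}A^*_{\mathbf{i}}\mathcal{C}$. Käenmäki measure: under domination, $\mu_K$ is the unique left-shift invariant ergodic Borel probability measure on $\Sigma$ for which there is $c>0$ with $c^{-1}\varphi^{s_0}(A_{\mathbf{i}})\le\mu_K([\mathbf{i}])\le c\,\varphi^{s_0}(A_{\mathbf{i}})$ for all $\mathbf{i}\in\Sigma_*$. $\mathcal{H}^s$ is Hausdorff measure, normalized as $\lim_{\delta\to0}\mathcal{H}^s_\delta$ with $\mathcal{H}^s_\delta(A)=\inf\{\sum_i|U_i|^s:A\subseteq\bigcup_iU_i,\ |U_i|<\delta\}$ ($|U|$ = diameter), and $\mathcal{H}^s_\infty(A)=\inf\{\sum_i|U_i|^s:A\subseteq\bigcup_iU_i\}$ is Hausdorff content. For $V\in\mathbb{RP}^1$ (a line through the origin), $\mathrm{proj}_V\colon\mathbb{R}^2\to V$ is orthogonal projection and $\lambda_V$ is Lebesgue measure on $V$. *)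

theory Defs
  imports "HOL-Analysis.Analysis"
begin

section \<open>Affine iterated function systems\<close>

text \<open>The index set is a finite type \<open>'a\<close>; finite words are lists and infinite words are
  functions \<open>nat \<Rightarrow> 'a\<close> (so the first letter has index 0).\<close>

definition affine_ifs :: "('a \<Rightarrow> real^2^2) \<Rightarrow> ('a \<Rightarrow> real^2) \<Rightarrow> 'a \<Rightarrow> real^2 \<Rightarrow> real^2" where
  "affine_ifs A t i x = A i *v x + t i"

definition is_attractor :: "('a \<Rightarrow> real^2 \<Rightarrow> real^2) \<Rightarrow> (real^2) set \<Rightarrow> bool" where
  "is_attractor f X \<longleftrightarrow> X \<noteq> {} \<and> compact X \<and> X = (\<Union>i. f i ` X)"

definition map_word :: "('a \<Rightarrow> 'b \<Rightarrow> 'b) \<Rightarrow> 'a list \<Rightarrow> 'b \<Rightarrow> 'b" where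
  "map_word f w = foldr (\<lambda>i g. f i \<circ> g) w id"

definition mat_word :: "('a \<Rightarrow> real^2^2) \<Rightarrow> 'a list \<Rightarrow> real^2^2" where
  "mat_word A w = foldr (\<lambda>i M. A i ** M) w (mat 1)"

text \<open>The transposes are multiplied in the order of the word, so this is not the
  transpose of \<open>mat_word A w\<close>.\<close>

definition adj_word :: "('a \<Rightarrow> real^2^2) \<Rightarrow> 'a list \<Rightarrow> real^2^2" where
  "adj_word A w = mat_word (\<lambda>i. transpose (A i)) w"

definition prefix_word :: "(nat \<Rightarrow> 'a) \<Rightarrow> nat \<Rightarrow> 'a list" where
  "prefix_word \<omega> n = map \<omega> [0..<n]"

definition cylinder :: "'a list \<Rightarrow> (nat \<Rightarrow> 'a) set" where
  "cylinder w = {\<omega>. prefix_word \<omega> (length w) = w}"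

definition shift :: "(nat \<Rightarrow> 'a) \<Rightarrow> nat \<Rightarrow> 'a" where
  "shift \<omega> n = \<omega> (Suc n)"

definition natural_proj :: "('a \<Rightarrow> real^2 \<Rightarrow> real^2) \<Rightarrow> (nat \<Rightarrow> 'a) \<Rightarrow> real^2" where
  "natural_proj f \<omega> = lim (\<lambda>n. map_word f (prefix_word \<omega> n) 0)"


section \<open>Singular values, affinity dimension, domination\<close>

text \<open>Singular values are the square roots of the eigenvalues of the Gram matrix. As the matrix
  is \<open>2 \<times> 2\<close>, the larger and the smaller one are the maximum and the minimum of this set
  (which is a singleton precisely if the two singular values coincide).\<close>

definition singular_values :: "real^2^2 \<Rightarrow> real set" where
  "singular_values M = {sqrt l |l. \<exists>v. v \<noteq> 0 \<and> (transpose M ** M) *v v = l *\<^sub>R v}"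

definition sv1 :: "real^2^2 \<Rightarrow> real" where
  "sv1 M = Max (singular_values M)"

definition sv2 :: "real^2^2 \<Rightarrow> real" where
  "sv2 M = Min (singular_values M)"

definition sv_function :: "real \<Rightarrow> real^2^2 \<Rightarrow> real" where
  "sv_function s M =
     (if s \<le> 1 then sv1 M powr s
      else if s \<le> 2 then sv1 M * sv2 M powr (s - 1)
      else \<bar>det M\<bar> powr (s / 2))"

definition affinity_dim :: "('a::finite \<Rightarrow> real^2^2) \<Rightarrow> real" where
  "affinity_dim A =
     Inf {s. s > 0 \<and> summable (\<lambda>n. \<Sum>w | length w = Suc n. sv_function s (mat_word A w))}"

definition dominated :: "('a \<Rightarrow> real^2^2) \<Rightarrow> bool" where
  "dominated A \<longleftrightarrow> (\<exists>C \<tau>. C > 0 \<and> 0 < \<tau> \<and> \<tau> < 1 \<and>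
     (\<forall>w. sv2 (mat_word A w) \<le> C * \<tau> ^ length w * sv1 (mat_word A w)))"


section \<open>The projective line, multicones and Furstenberg directions\<close>

definition RP1 :: "(real^2) set set" where
  "RP1 = {V. subspace V \<and> dim V = 1}"

text \<open>The quotient topology with respect to the map \<open>x \<mapsto> span {x}\<close> on nonzero vectors.\<close>

definition RP1_topology :: "(real^2) set topology" where
  "RP1_topology = topology (\<lambda>U. U \<subseteq> RP1 \<and> open {x. x \<noteq> 0 \<and> span {x} \<in> U})"

lemma openin_RP1_topology:
  "openin RP1_topology U \<longleftrightarrow> U \<subseteq> RP1 \<and> open {x. x \<noteq> 0 \<and> span {x} \<in> U}"
proof -
  have "istopology (\<lambda>U. U \<subseteq> RP1 \<and> open {x::real^2. x \<noteq> 0 \<and> span {x} \<in> U})"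
    unfolding istopology_def
  proof (intro conjI allI impI)
    fix S T :: "(real^2) set set"
    assume S: "S \<subseteq> RP1 \<and> open {x. x \<noteq> 0 \<and> span {x} \<in> S}"
      and T: "T \<subseteq> RP1 \<and> open {x. x \<noteq> 0 \<and> span {x} \<in> T}"
    show "S \<inter> T \<subseteq> RP1" using S by blast
    have "{x. x \<noteq> 0 \<and> span {x} \<in> S \<inter> T} =
        {x. x \<noteq> 0 \<and> span {x} \<in> S} \<inter> {x. x \<noteq> 0 \<and> span {x} \<in> T}" by blast
    then show "open {x. x \<noteq> 0 \<and> span {x} \<in> S \<inter> T}" using S T by (simp add: open_Int)
  next
    fix K :: "(real^2) set set set"
    assume K: "\<forall>S\<in>K. S \<subseteq> RP1 \<and> open {x. x \<noteq> 0 \<and> span {x} \<in> S}"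
    show "\<Union>K \<subseteq> RP1" using K by blast
    have "{x. x \<noteq> 0 \<and> span {x} \<in> \<Union>K} = (\<Union>S\<in>K. {x. x \<noteq> 0 \<and> span {x} \<in> S})" by blast
    then show "open {x. x \<noteq> 0 \<and> span {x} \<in> \<Union>K}" using K by auto
  qed
  then show ?thesis unfolding RP1_topology_def by (simp add: topology_inverse')
qed

definition proj_act :: "real^2^2 \<Rightarrow> (real^2) set set \<Rightarrow> (real^2) set set" where
  "proj_act M C = (\<lambda>V. (*v) M ` V) ` C"

definition closed_proj_interval :: "(real^2) set set \<Rightarrow> bool" where
  "closed_proj_interval I \<longleftrightarrow> (\<exists>a b. a \<le> b \<and> b < a + pi \<and>
     I = (\<lambda>\<theta>. span {vector [cos \<theta>, sin \<theta>]}) ` {a..b})"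

definition strongly_invariant_multicone ::
    "('a \<Rightarrow> real^2^2) \<Rightarrow> (real^2) set set \<Rightarrow> bool" where
  "strongly_invariant_multicone A C \<longleftrightarrow>
     C \<noteq> {} \<and> C \<subset> RP1 \<and>
     (\<exists>\<I>. finite \<I> \<and> (\<forall>I\<in>\<I>. closed_proj_interval I) \<and> C = \<Union>\<I>) \<and>
     (\<Union>i. proj_act (transpose (A i)) C) \<subseteq> RP1_topology interior_of C"

definition furstenberg_directions ::
    "('a \<Rightarrow> real^2^2) \<Rightarrow> (real^2) set set \<Rightarrow> (real^2) set set" where
  "furstenberg_directions A C = (\<Inter>n. \<Union>w\<in>{w. length w = n}. proj_act (adj_word A w) C)"


section \<open>The Kaenmaki measure\<close>

definition word_borel :: "(nat \<Rightarrow> 'a) measure" where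
  "word_borel = sigma UNIV {U. openin (product_topology (\<lambda>_. discrete_topology UNIV) UNIV) U}"

definition kaenmaki_measure :: "('a::finite \<Rightarrow> real^2^2) \<Rightarrow> (nat \<Rightarrow> 'a) measure \<Rightarrow> bool" where
  "kaenmaki_measure A \<mu> \<longleftrightarrow>
     sets \<mu> = sets word_borel \<and> emeasure \<mu> UNIV = 1 \<and>
     (\<forall>E\<in>sets \<mu>. emeasure \<mu> (shift -` E) = emeasure \<mu> E) \<and>
     (\<forall>E\<in>sets \<mu>. shift -` E = E \<longrightarrow> emeasure \<mu> E = 0 \<or> emeasure \<mu> E = 1) \<and>
     (\<exists>c>0. \<forall>w. inverse c * sv_function (affinity_dim A) (mat_word A w) \<le> measure \<mu> (cylinder w) \<and>
        measure \<mu> (cylinder w) \<le> c * sv_function (affinity_dim A) (mat_word A w))"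


section \<open>Hausdorff measure and content\<close>

text \<open>Finite covers are included by taking \<open>U i = {}\<close> from some point on. All exponents used are
  positive, so the requirement that the covering sets be bounded does not affect the infima; it is
  there because \<open>diameter\<close> is real-valued and meaningless on unbounded sets.\<close>

definition hausdorff_pre :: "real \<Rightarrow> real \<Rightarrow> 'a::metric_space set \<Rightarrow> ennreal" where
  "hausdorff_pre s \<delta> S =
     (INF U\<in>{U :: nat \<Rightarrow> 'a set. S \<subseteq> (\<Union>i. U i) \<and> (\<forall>i. bounded (U i) \<and> diameter (U i) < \<delta>)}.
        \<Sum>i. ennreal (diameter (U i) powr s))"

definition hausdorff_measure :: "real \<Rightarrow> 'a::metric_space set \<Rightarrow> ennreal" where
  "hausdorff_measure s S = Lim (at_right 0) (\<lambda>\<delta>. hausdorff_pre s \<delta> S)"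

definition hausdorff_content :: "real \<Rightarrow> 'a::metric_space set \<Rightarrow> ennreal" where
  "hausdorff_content s S =
     (INF U\<in>{U :: nat \<Rightarrow> 'a set. S \<subseteq> (\<Union>i. U i) \<and> (\<forall>i. bounded (U i))}.
        \<Sum>i. ennreal (diameter (U i) powr s))"

lemma hausdorff_pre_antimono:
  assumes "\<delta> \<le> \<epsilon>"
  shows "hausdorff_pre s \<epsilon> S \<le> hausdorff_pre s \<delta> S"
  unfolding hausdorff_pre_def
  using assms by (intro INF_superset_mono) (auto intro: less_le_trans)

lemma hausdorff_measure_eq_SUP:
  "hausdorff_measure s S = (SUP \<delta>\<in>{0<..}. hausdorff_pre s \<delta> S)"
proof -
  have "((\<lambda>\<delta>. hausdorff_pre s \<delta> S) \<longlongrightarrow> (SUP \<delta>\<in>{0<..}. hausdorff_pre s \<delta> S)) (at_right 0)"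
  proof (rule order_tendstoI)
    fix a assume "a < (SUP \<delta>\<in>{0<..}. hausdorff_pre s \<delta> S)"
    then obtain e where e: "e > 0" "a < hausdorff_pre s e S"
      by (auto simp: less_SUP_iff)
    have "\<forall>\<^sub>F d in at_right 0. d \<in> {0<..<e}"
      using e by (intro eventually_at_rightI[of 0 e]) auto
    then show "\<forall>\<^sub>F d in at_right 0. a < hausdorff_pre s d S"
      proof eventually_elim
      case (elim d)
      then have "hausdorff_pre s e S \<le> hausdorff_pre s d S"
        by (intro hausdorff_pre_antimono) simp
      then show ?case using e(2) by simp
    qed
  next
    fix a assume a: "(SUP \<delta>\<in>{0<..}. hausdorff_pre s \<delta> S) < a"
    have "\<forall>\<^sub>F d in at_right (0::real). d \<in> {0<..<1}"
      by (intro eventually_at_rightI[of 0 1]) auto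
    then show "\<forall>\<^sub>F d in at_right 0. hausdorff_pre s d S < a"
      proof eventually_elim
      case (elim d)
      then have "hausdorff_pre s d S \<le> (SUP \<delta>\<in>{0<..}. hausdorff_pre s \<delta> S)"
        by (intro SUP_upper) simp
      then show ?case using a by simp
    qed
  qed
  then show ?thesis
    unfolding hausdorff_measure_def by (intro tendsto_Lim) auto
qed


section \<open>Projections onto lines and Lebesgue measure on lines\<close>

definition orth_proj :: "(real^2) set \<Rightarrow> real^2 \<Rightarrow> real^2" where
  "orth_proj V x = (THE y. y \<in> V \<and> (\<forall>v\<in>V. orthogonal (x - y) v))"

text \<open>Lebesgue measure on a line through the origin is transported from the real line by a linear
  isometry; the choice of the unit vector is irrelevant by lemma \<open>line_lebesgue_unit\<close> below.\<close>

definition line_lebesgue :: "(real^2) set \<Rightarrow> (real^2) measure" where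
  "line_lebesgue V = distr lborel (restrict_space borel V)
     (\<lambda>r. r *\<^sub>R (SOME e. e \<in> V \<and> norm e = 1))"

definition slice_integral :: "real \<Rightarrow> (real^2) set \<Rightarrow> (real^2) set \<Rightarrow> ennreal" where
  "slice_integral u X V =
     (\<integral>\<^sup>+v. hausdorff_content u (X \<inter> orth_proj V -` {v}) \<partial>line_lebesgue V)"

lemma RP1_span_eq:
  assumes "V \<in> RP1" "e \<in> V" "e \<noteq> 0"
  shows "V = span {e}"
proof -
  have V: "subspace V" "dim V = 1" using assms(1) by (auto simp: RP1_def)
  have "dim (span {e}) = 1" using assms(3) by (simp add: dim_insert)
  moreover have "span {e} \<subseteq> V" using assms(2) V(1) by (simp add: span_minimal)
  ultimately have "span {e} = V"
    using V by (intro subspace_dim_equal) auto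
  then show ?thesis by simp
qed

lemma RP1_unit:
  assumes "V \<in> RP1"
  obtains e where "e \<in> V" "norm e = 1" "V = span {e}"
proof -
  have V: "subspace V" "dim V = 1" using assms by (auto simp: RP1_def)
  have "\<not> V \<subseteq> {0}" using V(2) dim_eq_0[of V] by linarith
  then obtain x where x: "x \<in> V" "x \<noteq> 0" by blast
  define e where "e = (1 / norm x) *\<^sub>R x"
  have e: "e \<in> V" "norm e = 1"
    unfolding e_def using x(2) by (auto intro: subspace_scale[OF V(1) x(1)])
  then have "e \<noteq> 0" by force
  then show thesis using that[OF e] RP1_span_eq[OF assms e(1)] by blast
qed

lemma orth_proj_unit:
  assumes "V \<in> RP1" "e \<in> V" "norm e = 1"
  shows "orth_proj V x = (x \<bullet> e) *\<^sub>R e"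
  unfolding orth_proj_def
proof (rule the_equality)
  have "e \<noteq> 0" using assms(3) by force
  then have V: "V = span {e}" using RP1_span_eq[OF assms(1,2)] by simp
  have ee: "e \<bullet> e = 1" using assms by (simp add: norm_eq_1)
  show "(x \<bullet> e) *\<^sub>R e \<in> V \<and> (\<forall>v\<in>V. orthogonal (x - (x \<bullet> e) *\<^sub>R e) v)"
    by (auto simp: V span_singleton orthogonal_def inner_diff_left ee)
  fix y assume y: "y \<in> V \<and> (\<forall>v\<in>V. orthogonal (x - y) v)"
  then obtain k where k: "y = k *\<^sub>R e" by (auto simp: V span_singleton)
  have "(x - y) \<bullet> e = 0" using y assms by (auto simp: orthogonal_def)
  then show "y = (x \<bullet> e) *\<^sub>R e" using k ee by (simp add: inner_diff_left)
qed

lemma line_lebesgue_unit: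
  assumes "V \<in> RP1" "e \<in> V" "norm e = 1"
  shows "line_lebesgue V = distr lborel (restrict_space borel V) (\<lambda>r. r *\<^sub>R e)"
proof -
  define d where "d = (SOME e. e \<in> V \<and> norm e = 1)"
  have d: "d \<in> V" "norm d = 1"
    using someI[of "\<lambda>e. e \<in> V \<and> norm e = 1" e] assms by (auto simp: d_def)
  have "e \<noteq> 0" using assms(3) by force
  then have V: "V = span {e}" using RP1_span_eq[OF assms(1,2)] by simp
  have meas: "(\<lambda>r. r *\<^sub>R e) \<in> lborel \<rightarrow>\<^sub>M restrict_space borel V"
    by (rule measurable_restrict_space2) (auto simp: V span_singleton)
  obtain k where k: "d = k *\<^sub>R e" using d by (auto simp: V span_singleton)
  then have "k = 1 \<or> k = -1" using d assms by auto
  then show ?thesis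
  proof
    assume "k = -1"
    have "distr lborel (restrict_space borel V) (\<lambda>r. r *\<^sub>R d) =
        distr lborel (restrict_space borel V) ((\<lambda>r. r *\<^sub>R e) \<circ> uminus)"
      using k \<open>k = -1\<close> by (simp add: comp_def)
    also have "\<dots> = distr (distr lborel borel uminus) (restrict_space borel V) (\<lambda>r. r *\<^sub>R e)"
      by (rule distr_distr[symmetric]) (use meas in auto)
    also have "distr lborel borel uminus = (lborel :: real measure)"
      by (rule lborel_distr_uminus)
    finally show ?thesis by (simp add: line_lebesgue_def d_def)
  qed (use k in \<open>simp add: line_lebesgue_def d_def\<close>)
qed

end

theory Submission
  imports Defs
begin

text \<open>Write \<open>m(w)\<close> for the \<open>\<mu>\<close>-mass of the cylinder of \<open>w\<close>. The transposed matrix words map the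
  multicone into itself, and they expand each of its directions by a factor comparable to their norm.
  This makes \<open>m\<close> quasi-multiplicative: \<open>m(uw) \<ge> c m(u) m(w)\<close>. Hence, for a non-empty set \<open>D\<close> of words of
  length \<open>n\<close>, the words consisting of \<open>j\<close> blocks of length \<open>n\<close> outside \<open>D\<close> have total mass tending to
  \<open>0\<close> as \<open>j\<close> grows. So \<open>X\<close> is covered, up to a set of arbitrarily small cost, by pieces
  \<open>f\<^sub>u f\<^sub>w(X)\<close> with \<open>w \<in> D\<close>, where \<open>u\<close> runs over the words of such blocks, and the total mass of the
  cylinders \<open>[uw]\<close> is at most \<open>1\<close>.

  If (d) fails, some ball has far more mass than \<open>r\<^sup>s\<close>. Let \<open>D\<close> be the words of a large length whose
  pieces meet it; the images of this ball then cover \<open>X\<close> so cheaply that every slice integral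
  vanishes, contradicting (b). If (c) fails, a small slice integral in a Furstenberg direction yields
  finitely many rectangles of small total cost covering \<open>X\<close>, also after a small rotation. The images
  of the cone under the transposes of \<open>A\<^sub>u A\<^sub>w\<close>, with a fixed long \<open>w\<close>, are close to that
  direction, so with \<open>D = {w}\<close> the images of these rectangles under \<open>f\<^sub>u f\<^sub>w\<close> are thin
  parallelograms, which give covers of \<open>X\<close> of small \<open>s\<close>-cost, contradicting (a). From (d) the mass
  distribution principle gives (a), and (c) gives (b) as the set of Furstenberg directions is not
  empty.\<close>

section \<open>Plane vectors and singular values\<close>

text \<open>For 1 < s <= 2 the singular value function equals \<alpha>1^(2-s) |det|^(s-1). So a
  parallelogram of length ||M|| and width |det M| / ||M||, charged its length times its width to the
  power s-1, costs \<phi>^s(M) up to a constant, which by the Gibbs property is the mass of its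
  cylinder. This one computation serves slices and covers alike. For the bound on balls, each word u
  loses at least the fraction c m(D) of its mass to D in the next block, so the words u have total
  mass at most 1 / (c m(D)); each u is charged r^s m(u), and a slice integral is at most of order
  r^s / m(D). For Hausdorff measure the obstacle is that the rectangles have to be aligned with the
  matrix. Words ending in a fixed long w have frames near the Furstenberg direction, uniformly over
  what precedes w, but never exactly in it. Hence the covers must be finite and open in order to
  survive a small rotation, and slices must first be thickened to dyadic strips by
  compactness.\<close>

definition rot :: "real^2 \<Rightarrow> real^2" where
  "rot v = vector [- v $ 2, v $ 1]"

lemma rot_nth [simp]: "rot v $ 1 = - v $ 2" "rot v $ 2 = v $ 1"
  by (simp_all add: rot_def)

lemma inner_real2: "x \<bullet> y = x $ 1 * y $ 1 + x $ 2 * y $ 2" for x y :: "real^2"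
  by (simp add: inner_vec_def sum_2)

lemma norm_real2_sq: "(norm x)\<^sup>2 = (x $ 1)\<^sup>2 + (x $ 2)\<^sup>2" for x :: "real^2"
  unfolding power2_norm_eq_inner by (simp add: inner_real2 power2_eq_square)

lemma norm_mat2_sq:
  "(norm M)\<^sup>2 = (M$1$1)\<^sup>2 + (M$1$2)\<^sup>2 + (M$2$1)\<^sup>2 + (M$2$2)\<^sup>2" for M :: "real^2^2"
  unfolding power2_norm_eq_inner by (simp add: inner_vec_def sum_2 power2_eq_square)

lemma matvec2:
  "(M *v x) $ 1 = M$1$1 * x$1 + M$1$2 * x$2" "(M *v x) $ 2 = M$2$1 * x$1 + M$2$2 * x$2"
  for M :: "real^2^2"
  by (simp_all add: matrix_vector_mult_def sum_2)

lemma norm_rot [simp]: "norm (rot v) = norm v"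
proof -
  have "(norm (rot v))\<^sup>2 = (norm v)\<^sup>2" unfolding norm_real2_sq by simp
  then show ?thesis by simp
qed

lemma rot_simps [simp]:
  "rot (rot v) = - v" "rot (c *\<^sub>R v) = c *\<^sub>R rot v" "rot (v - w) = rot v - rot w" "v \<bullet> rot v = 0" "rot v \<bullet> v = 0"
  "rot (- v) = - rot v"
  by (simp_all add: vec_eq_iff forall_2 inner_real2)

lemma rot_inner_rot [simp]: "rot v \<bullet> rot w = v \<bullet> w"
  by (simp add: inner_real2)

lemma frame_decomp:
  assumes "norm e = 1"
  shows "x = (x \<bullet> e) *\<^sub>R e + (x \<bullet> rot e) *\<^sub>R rot e"
proof -
  have 1: "(e $ 1)\<^sup>2 + (e $ 2)\<^sup>2 = 1"
    using assms norm_real2_sq[of e] by simp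
  have "x $ 1 = x $ 1 * ((e $ 1)\<^sup>2 + (e $ 2)\<^sup>2)" "x $ 2 = x $ 2 * ((e $ 1)\<^sup>2 + (e $ 2)\<^sup>2)"
    using 1 by simp_all
  then show ?thesis
    by (simp add: vec_eq_iff forall_2 inner_real2 power2_eq_square algebra_simps)
qed

lemma frame_norm_sq:
  assumes "norm e = 1"
  shows "(norm x)\<^sup>2 = (x \<bullet> e)\<^sup>2 + (x \<bullet> rot e)\<^sup>2"
proof -
  have ee: "e \<bullet> e = 1" using assms by (simp add: norm_eq_1)
  have "(norm x)\<^sup>2 = x \<bullet> ((x \<bullet> e) *\<^sub>R e + (x \<bullet> rot e) *\<^sub>R rot e)"
    using frame_decomp[OF assms, of x] by (simp add: power2_norm_eq_inner)
  then show ?thesis by (simp add: inner_add_right power2_eq_square)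
qed

lemma frame_norm_le:
  assumes "norm e = 1"
  shows "norm x \<le> \<bar>x \<bullet> e\<bar> + \<bar>x \<bullet> rot e\<bar>"
proof -
  have "norm x \<le> norm ((x \<bullet> e) *\<^sub>R e) + norm ((x \<bullet> rot e) *\<^sub>R rot e)"
    by (subst frame_decomp[OF assms, of x]) (rule norm_triangle_ineq)
  then show ?thesis using assms by simp
qed

lemma norm_transpose_mat2 [simp]: "norm (transpose M) = norm M" for M :: "real^2^2"
proof -
  have "(norm (transpose M))\<^sup>2 = (norm M)\<^sup>2"
    by (simp add: norm_mat2_sq transpose_def)
  then show ?thesis by simp
qed

text \<open>\<open>norm\<close> on matrices is the Frobenius norm, which can be computed from the
  images of any orthonormal basis.\<close>

lemma mat2_frame_norm:
  fixes M :: "real^2^2"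
  assumes "norm e = 1"
  shows "(norm M)\<^sup>2 = (norm (M *v e))\<^sup>2 + (norm (M *v rot e))\<^sup>2"
proof -
  have 1: "(e $ 1)\<^sup>2 + (e $ 2)\<^sup>2 = 1"
    using assms norm_real2_sq[of e] by simp
  have "(norm (M *v e))\<^sup>2 + (norm (M *v rot e))\<^sup>2 = (norm M)\<^sup>2 * ((e $ 1)\<^sup>2 + (e $ 2)\<^sup>2)"
    unfolding norm_mat2_sq norm_real2_sq matvec2 rot_nth by (simp add: power2_eq_square algebra_simps)
  then show ?thesis using 1 by simp
qed

lemma norm_matvec2_le: "norm (M *v x) \<le> norm M * norm x" for M :: "real^2^2"
proof (cases "x = 0")
  case False
  define e where "e = (1 / norm x) *\<^sub>R x"
  have e: "norm e = 1" "x = norm x *\<^sub>R e" using False by (auto simp: e_def)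
  have "(norm (M *v e))\<^sup>2 \<le> (norm M)\<^sup>2" using mat2_frame_norm[OF e(1), of M] by simp
  then have "norm (M *v e) \<le> norm M" by (rule power2_le_imp_le) simp
  moreover have "norm (M *v x) = norm x * norm (M *v e)"
    by (subst e(2)) (simp add: matrix_vector_mult_scaleR)
  ultimately show ?thesis by (simp add: mult.commute mult_left_mono)
qed simp

lemma norm_matmul2_le: "norm (M ** N) \<le> norm M * norm N" for M N :: "real^2^2"
proof -
  define e :: "real^2" where "e = vector [1, 0]"
  have e: "norm e = 1"
  proof -
    have "(norm e)\<^sup>2 = 1" by (simp add: norm_real2_sq e_def)
    then show ?thesis by (simp add: power2_eq_1_iff) (smt (verit) norm_ge_zero)
  qed
  have "(norm (M ** N))\<^sup>2 = (norm (M *v (N *v e)))\<^sup>2 + (norm (M *v (N *v rot e)))\<^sup>2"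
    by (simp add: mat2_frame_norm[OF e] matrix_vector_mul_assoc)
  also have "\<dots> \<le> (norm M * norm (N *v e))\<^sup>2 + (norm M * norm (N *v rot e))\<^sup>2"
    by (intro add_mono power_mono norm_matvec2_le norm_ge_zero)
  also have "\<dots> = (norm M * norm N)\<^sup>2"
    by (simp add: power_mult_distrib mat2_frame_norm[OF e, of N] distrib_left)
  finally show ?thesis by (rule power2_le_imp_le) simp
qed

lemma inner_matvec_left: "(M *v x) \<bullet> y = x \<bullet> (transpose M *v y)" for M :: "real^2^2"
  by (simp add: inner_real2 matvec2 transpose_def algebra_simps)

text \<open>The identity M J M^T = det(M) J for the quarter turn J, a form of the adjugate formula.
  It says what M does to the line orthogonal to \<open>transpose M *v v\<close>.\<close>

lemma matvec_rot_transpose: "M *v rot (transpose M *v v) = det M *\<^sub>R rot v" for M :: "real^2^2"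
  by (simp add: vec_eq_iff forall_2 matvec2 transpose_def det_2 algebra_simps)

text \<open>\<open>x \<bullet> rot y\<close> is the oriented area spanned by y and x, which a matrix
  multiplies by its determinant.\<close>

lemma matvec_cross: "(M *v x) \<bullet> rot (M *v y) = det M * (x \<bullet> rot y)" for M :: "real^2^2"
  by (simp add: inner_real2 matvec2 det_2 algebra_simps)

lemma eigenvalue_2x2_iff:
  fixes G :: "real^2^2"
  shows "(\<exists>v. v \<noteq> 0 \<and> G *v v = l *\<^sub>R v) \<longleftrightarrow> (G$1$1 - l) * (G$2$2 - l) = G$1$2 * G$2$1"
proof -
  have "(\<exists>v. v \<noteq> 0 \<and> G *v v = l *\<^sub>R v) \<longleftrightarrow> (\<exists>v. v \<noteq> 0 \<and> (G - mat l) *v v = 0)"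
    by (simp add: matrix_vector_mult_diff_rdistrib vec_eq_iff forall_2 matvec2 mat_def algebra_simps)
  also have "\<dots> \<longleftrightarrow> \<not> invertible (G - mat l)"
    unfolding invertible_left_inverse matrix_left_invertible_ker by blast
  also have "\<dots> \<longleftrightarrow> det (G - mat l) = 0"
    by (simp add: invertible_det_nz)
  also have "\<dots> \<longleftrightarrow> (G$1$1 - l) * (G$2$2 - l) = G$1$2 * G$2$1"
    by (simp add: det_2 mat_def)
  finally show ?thesis .
qed

text \<open>The eigenvalues of the Gram matrix have product det^2 and sum equal to the squared
  Frobenius norm. The Frobenius norm can therefore stand in for the larger singular value, up to a
  factor sqrt 2.\<close>

lemma singular_values_2x2:
  fixes M :: "real^2^2"
  shows "0 \<le> sv2 M" "sv1 M * sv2 M = \<bar>det M\<bar>"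
    "(sv1 M)\<^sup>2 \<le> (norm M)\<^sup>2" "(norm M)\<^sup>2 \<le> 2 * (sv1 M)\<^sup>2" "0 \<le> sv1 M"
proof -
  define G where "G = transpose M ** M"
  define a b d where "a = G$1$1" and "b = G$1$2" and "d = G$2$2"
  \<comment> \<open>The square root of the discriminant of the characteristic polynomial of the Gram
    matrix; \<open>lp\<close> and \<open>lm\<close> are its two roots.\<close>
  define q where "q = sqrt ((a - d)\<^sup>2 + 4 * b\<^sup>2)"
  define lp lm where "lp = (a + d + q) / 2" and "lm = (a + d - q) / 2"
  have G: "a = (M$1$1)\<^sup>2 + (M$2$1)\<^sup>2" "d = (M$1$2)\<^sup>2 + (M$2$2)\<^sup>2" "G$2$1 = b"
     "b = M$1$1 * M$1$2 + M$2$1 * M$2$2"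
    by (simp_all add: a_def b_def d_def G_def matrix_matrix_mult_def transpose_def sum_2 power2_eq_square algebra_simps)
  have q: "q\<^sup>2 = (a - d)\<^sup>2 + 4 * b\<^sup>2" "0 \<le> q" by (simp_all add: q_def)
  have fact: "(a - l) * (d - l) - b * b = (l - lp) * (l - lm)" for l
  proof -
    have "(l - lp) * (l - lm) = ((2 * l - (a + d))\<^sup>2 - q\<^sup>2) / 4"
      by (simp add: lp_def lm_def power2_eq_square field_simps)
    also have "\<dots> = (a - l) * (d - l) - b * b"
      unfolding q by (simp add: power2_eq_square field_simps)
    finally show ?thesis by simp
  qed
  have "(\<exists>v. v \<noteq> 0 \<and> G *v v = l *\<^sub>R v) \<longleftrightarrow> l = lp \<or> l = lm" for l
    unfolding eigenvalue_2x2_iff G(3) a_def[symmetric] b_def[symmetric] d_def[symmetric]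
    using fact[of l] by auto
  then have S: "singular_values M = {sqrt lp, sqrt lm}"
    unfolding singular_values_def G_def by auto
  have le: "lm \<le> lp" using q by (simp add: lp_def lm_def)
  have prod: "lp * lm = (det M)\<^sup>2"
  proof -
    have "lp * lm = a * d - b * b" using fact[of 0] by simp
    then show ?thesis unfolding G det_2 by (simp add: power2_eq_square algebra_simps)
  qed
  have sum: "lp + lm = (norm M)\<^sup>2" by (simp add: lp_def lm_def norm_mat2_sq G field_simps)
  have lp0: "0 \<le> lp" using sum le by (smt (verit) zero_le_power2)
  have lm0: "0 \<le> lm"
  proof (rule ccontr)
    assume "\<not> 0 \<le> lm"
    moreover then have "0 < lp" using sum by (smt (verit) zero_le_power2)
    ultimately have "lp * lm < 0" by (simp add: mult_pos_neg)
    then show False using prod by (smt (verit) zero_le_power2)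
  qed
  have s1: "sv1 M = sqrt lp" and s2: "sv2 M = sqrt lm"
    unfolding sv1_def sv2_def S using le by simp_all
  show "0 \<le> sv2 M" "0 \<le> sv1 M" using s1 s2 lp0 lm0 by simp_all
  show "sv1 M * sv2 M = \<bar>det M\<bar>"
    by (simp add: s1 s2 real_sqrt_mult[symmetric] prod)
  show "(sv1 M)\<^sup>2 \<le> (norm M)\<^sup>2" "(norm M)\<^sup>2 \<le> 2 * (sv1 M)\<^sup>2"
    using lp0 lm0 le sum by (simp_all add: s1)
qed

text \<open>The singular value function for exponents in (1, 2], with the Frobenius norm in place of
  \<alpha>1. Determinants multiply exactly, so in this form only the norm has to be controlled along
  products.\<close>

definition phi :: "real \<Rightarrow> real^2^2 \<Rightarrow> real" where
  "phi s M = norm M powr (2 - s) * \<bar>det M\<bar> powr (s - 1)"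

lemma norm_pos_of_det: "det M \<noteq> 0 \<Longrightarrow> 0 < norm M" for M :: "real^2^2"
  by (auto simp: det_2)

lemma phi_pos: "det M \<noteq> 0 \<Longrightarrow> 0 < phi s M"
  using norm_pos_of_det[of M] by (simp add: phi_def)

text \<open>Substitute \<alpha>2 = |det| / \<alpha>1. The exponent 2 - s lies in [0, 1), so a factor
  2 between the norms remains at most 2 after taking the power.\<close>

lemma sv_function_phi:
  assumes "1 < s" "s \<le> 2" "det M \<noteq> 0"
  shows "sv_function s M \<le> phi s M" "phi s M \<le> 2 * sv_function s M"
proof -
  note sv = singular_values_2x2[of M]
  have p: "0 < sv1 M" "0 < sv2 M"
    using sv assms(3) by (auto simp: less_le)
  have "sv_function s M = sv1 M * sv2 M powr (s - 1)"
    using assms by (simp add: sv_function_def)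
  also have "sv2 M = \<bar>det M\<bar> / sv1 M" using p sv(2) by (simp add: field_simps)
  also have "sv1 M * (\<bar>det M\<bar> / sv1 M) powr (s - 1) = sv1 M powr (2 - s) * \<bar>det M\<bar> powr (s - 1)"
  proof -
    have "sv1 M powr (2 - s) = sv1 M powr 1 / sv1 M powr (s - 1)"
      by (subst powr_diff[symmetric]) simp
    then show ?thesis using p by (simp add: powr_divide)
  qed
  finally have eq: "sv_function s M = sv1 M powr (2 - s) * \<bar>det M\<bar> powr (s - 1)" .
  have le: "sv1 M \<le> norm M" using sv(3) by (rule power2_le_imp_le) simp
  have ge: "norm M \<le> 2 * sv1 M"
  proof (rule power2_le_imp_le)
    have "2 * (sv1 M)\<^sup>2 \<le> (2 * sv1 M)\<^sup>2" by simp
    then show "(norm M)\<^sup>2 \<le> (2 * sv1 M)\<^sup>2" using sv(4) by linarith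
  qed (use p in simp)
  show "sv_function s M \<le> phi s M"
    unfolding eq phi_def using assms p le by (intro mult_right_mono powr_mono2) auto
  have "norm M powr (2 - s) \<le> (2 * sv1 M) powr (2 - s)"
    using assms ge by (intro powr_mono2) auto
  also have "\<dots> = 2 powr (2 - s) * sv1 M powr (2 - s)" using p by (simp add: powr_mult)
  also have "\<dots> \<le> 2 * sv1 M powr (2 - s)"
    using powr_mono[of "2 - s" 1 2] assms by (intro mult_right_mono) auto
  finally have "phi s M \<le> (2 * sv1 M powr (2 - s)) * \<bar>det M\<bar> powr (s - 1)"
    unfolding phi_def by (intro mult_right_mono) simp_all
  then show "phi s M \<le> 2 * sv_function s M" by (simp add: eq mult_ac)
qed

lemma sv_dominated_det:
  assumes "sv2 M \<le> k * sv1 M" "0 \<le> k"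
  shows "\<bar>det M\<bar> \<le> k * (norm M)\<^sup>2"
proof -
  note sv = singular_values_2x2[of M]
  have "\<bar>det M\<bar> \<le> sv1 M * (k * sv1 M)" unfolding sv(2)[symmetric]
    using assms sv by (intro mult_left_mono) auto
  also have "\<dots> = k * (sv1 M)\<^sup>2" by (simp add: power2_eq_square)
  also have "\<dots> \<le> k * (norm M)\<^sup>2" using sv assms by (intro mult_left_mono) auto
  finally show ?thesis .
qed


section \<open>Directions in the multicone\<close>

text \<open>This rule would turn \<open>transpose M *v x\<close> into \<open>x v* M\<close>.\<close>

declare transpose_matrix_vector [simp del]

text \<open>Lines are handled through their nonzero vectors, on which matrices act linearly. The set
  is closed under all nonzero scalars, of either sign.\<close>

definition dir_cone :: "(real^2) set set \<Rightarrow> (real^2) set" where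
  "dir_cone C = {v. v \<noteq> 0 \<and> span {v} \<in> C}"

lemma span_scaleR_eq: "c \<noteq> 0 \<Longrightarrow> span {c *\<^sub>R v} = span {v}" for v :: "'b::real_vector"
proof
  assume c: "c \<noteq> 0"
  show "span {c *\<^sub>R v} \<subseteq> span {v}"
    by (intro span_minimal) (auto intro: span_scale span_base)
  have "v = (1 / c) *\<^sub>R (c *\<^sub>R v)" using c by simp
  then have "v \<in> span {c *\<^sub>R v}" by (metis span_scale span_base singletonI)
  then show "span {v} \<subseteq> span {c *\<^sub>R v}" by (intro span_minimal) auto
qed

lemma cone_scaleR: "c \<noteq> 0 \<Longrightarrow> v \<in> dir_cone C \<Longrightarrow> c *\<^sub>R v \<in> dir_cone C"
  by (auto simp: dir_cone_def span_scaleR_eq)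

lemma matvec_span: "(*v) M ` span {v} = span {M *v v}" for M :: "real^2^2"
  using linear_span_image[OF matrix_vector_mul_linear[of M], of "{v}"] by simp

lemma matvec_nonzero: "det M \<noteq> 0 \<Longrightarrow> v \<noteq> 0 \<Longrightarrow> M *v v \<noteq> 0" for M :: "real^2^2"
  by (metis invertible_det_nz invertible_left_inverse matrix_left_invertible_ker)

lemma in_proj_act_span: "span {v} \<in> C \<Longrightarrow> span {M *v v} \<in> proj_act M C"
  unfolding proj_act_def using matvec_span by blast

lemma proj_actE:
  assumes "V \<in> proj_act M C" "C \<subseteq> RP1" "det M \<noteq> 0"
  obtains v where "v \<in> dir_cone C" "V = span {M *v v}"
proof -
  obtain W where W: "W \<in> C" "V = (*v) M ` W" using assms(1) by (auto simp: proj_act_def)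
  then obtain e where "e \<in> W" "norm e = 1" "W = span {e}" using RP1_unit assms(2) by blast
  then have "e \<in> dir_cone C" "V = span {M *v e}" using W matvec_span[of M e] by (auto simp: dir_cone_def)
  then show thesis using that by blast
qed

lemma span_eq_unit:
  fixes u v :: "'b::real_normed_vector"
  assumes "span {u} = span {v}" "norm u = 1" "norm v = 1"
  shows "u = v \<or> u = - v"
proof -
  have "u \<in> span {v}" using assms(1) span_base[of u "{u}"] by auto
  then obtain c where c: "u = c *\<^sub>R v" by (auto simp: span_singleton)
  then have "\<bar>c\<bar> = 1" using assms by simp
  then have "c = 1 \<or> c = -1" by auto
  then show ?thesis using c by auto
qed

text \<open>The unit vectors of the lines in an interval form two antipodal arcs, one for each
  sign.\<close>

lemma compact_interval_units:
  assumes "closed_proj_interval I"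
  shows "compact {v. norm v = 1 \<and> span {v} \<in> I}"
proof -
  obtain a b where I: "I = (\<lambda>\<theta>. span {vector [cos \<theta>, sin \<theta>]}) ` {a..b}"
    using assms by (auto simp: closed_proj_interval_def)
  define h :: "real \<Rightarrow> real^2" where "h \<theta> = vector [cos \<theta>, sin \<theta>]" for \<theta>
  have hc: "continuous_on S h" for S
  proof -
    have "h = (\<lambda>\<theta>. cos \<theta> *\<^sub>R axis 1 1 + sin \<theta> *\<^sub>R axis 2 1)"
      by (simp add: fun_eq_iff h_def vec_eq_iff forall_2 axis_def)
    then show ?thesis by (auto intro!: continuous_intros)
  qed
  have hn: "norm (h \<theta>) = 1" for \<theta>
  proof -
    have "(norm (h \<theta>))\<^sup>2 = 1" by (simp add: norm_real2_sq h_def)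
    then show ?thesis by (simp add: power2_eq_1_iff) (smt (verit) norm_ge_zero)
  qed
  have "{v. norm v = 1 \<and> span {v} \<in> I} = h ` {a..b} \<union> (\<lambda>\<theta>. - h \<theta>) ` {a..b}" (is "?L = ?R")
  proof
    show "?L \<subseteq> ?R"
    proof
      fix v assume "v \<in> ?L"
      then obtain \<theta> where "norm v = 1" "\<theta> \<in> {a..b}" "span {v} = span {h \<theta>}" by (auto simp: I h_def)
      then show "v \<in> ?R" using span_eq_unit[of v "h \<theta>"] hn by auto
    qed
    have "span {- h \<theta>} = span {h \<theta>}" for \<theta> using span_scaleR_eq[of "-1" "h \<theta>"] by simp
    then show "?R \<subseteq> ?L" using hn by (auto simp: I h_def[symmetric])
  qed
  moreover have "compact ?R"
    by (intro compact_Un compact_continuous_image continuous_on_minus hc compact_Icc)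
  ultimately show ?thesis by simp
qed

lemma compact_normalize:
  fixes f :: "real^2 \<Rightarrow> real^2"
  assumes "compact K" "continuous_on K f" "\<And>x. x \<in> K \<Longrightarrow> f x \<noteq> 0"
  shows "compact ((\<lambda>x. f x /\<^sub>R norm (f x)) ` K)"
  by (intro compact_continuous_image continuous_intros assms) (use assms in auto)

locale multicone =
  fixes A :: "'a::finite \<Rightarrow> real^2^2" and C :: "(real^2) set set"
  assumes inv: "\<And>i. det (A i) \<noteq> 0"
    and C: "strongly_invariant_multicone A C"
begin

lemma C_RP1: "C \<subseteq> RP1" "C \<noteq> {}" "C \<noteq> RP1"
  using C by (auto simp: strongly_invariant_multicone_def)

lemma compact_units: "compact {v. norm v = 1 \<and> span {v} \<in> C}"
proof -
  obtain \<I> where "finite \<I>" "\<forall>I\<in>\<I>. closed_proj_interval I" "C = \<Union>\<I>"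
    using C by (auto simp: strongly_invariant_multicone_def)
  moreover then have "{v. norm v = 1 \<and> span {v} \<in> C} = (\<Union>I\<in>\<I>. {v. norm v = 1 \<and> span {v} \<in> I})" by auto
  ultimately show ?thesis using compact_interval_units by (auto intro!: compact_UN)
qed

lemma cone_nonempty: "dir_cone C \<noteq> {}"
proof -
  obtain V where "V \<in> C" using C_RP1 by blast
  moreover then obtain e where "norm e = 1" "V = span {e}" using C_RP1 RP1_unit by blast
  ultimately have "e \<in> dir_cone C" by (auto simp: dir_cone_def)
  then show ?thesis by blast
qed

lemma cone_unit: obtains e where "e \<in> dir_cone C" "norm e = 1"
proof -
  obtain v where v: "v \<in> dir_cone C" using cone_nonempty by blast
  then have "v \<noteq> 0" by (simp add: dir_cone_def)
  then show thesis using that[of "(1 / norm v) *\<^sub>R v"] cone_scaleR[OF _ v, of "1 / norm v"] by simp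
qed

lemma det_transpose_nz: "det (transpose (A i)) \<noteq> 0"
  using inv by simp

lemma cone_image_interior:
  assumes "v \<in> dir_cone C"
  shows "transpose (A i) *v v \<noteq> 0" "span {transpose (A i) *v v} \<in> RP1_topology interior_of C"
proof -
  show "transpose (A i) *v v \<noteq> 0" using assms det_transpose_nz matvec_nonzero by (auto simp: dir_cone_def)
  have "span {transpose (A i) *v v} \<in> proj_act (transpose (A i)) C"
    using assms by (intro in_proj_act_span) (auto simp: dir_cone_def)
  then show "span {transpose (A i) *v v} \<in> RP1_topology interior_of C"
    using C by (auto simp: strongly_invariant_multicone_def)
qed

lemma cone_invariant: "v \<in> dir_cone C \<Longrightarrow> transpose (A i) *v v \<in> dir_cone C"
  using cone_image_interior[of v i] interior_of_subset[of RP1_topology C] by (auto simp: dir_cone_def)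

lemma det_mat_word: "det (mat_word A w) \<noteq> 0"
  by (induction w) (auto simp: mat_word_def det_mul inv)

lemma mat_word_Cons: "mat_word A (i # w) = A i ** mat_word A w"
  by (simp add: mat_word_def)

lemma mat_word_append: "mat_word A (u @ w) = mat_word A u ** mat_word A w"
  by (induction u) (simp_all add: mat_word_def matrix_mul_assoc)

lemma cone_invariant_word: "v \<in> dir_cone C \<Longrightarrow> transpose (mat_word A w) *v v \<in> dir_cone C"
proof (induction w arbitrary: v)
  case (Cons i w)
  then show ?case
    using cone_invariant by (simp add: mat_word_Cons matrix_transpose_mul matrix_vector_mul_assoc[symmetric])
qed (simp add: mat_word_def)

text \<open>The normalised images of the cone under single letters form a compact set inside an open
  one, so they have a uniform margin. By homogeneity the margin becomes a tilt \<delta> relative to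
  the length of the image vector.\<close>

lemma cone_room:
  obtains \<delta> where "\<delta> > 0" "\<And>i v t. v \<in> dir_cone C \<Longrightarrow> \<bar>t\<bar> \<le> \<delta> \<Longrightarrow>
    transpose (A i) *v v + t *\<^sub>R rot (transpose (A i) *v v) \<in> dir_cone C"
proof -
  define K where "K = {v. norm v = 1 \<and> span {v} \<in> C}"
  define K' where "K' = (\<Union>i. (\<lambda>v. (transpose (A i) *v v) /\<^sub>R norm (transpose (A i) *v v)) ` K)"
  define O' where "O' = {x::real^2. x \<noteq> 0 \<and> span {x} \<in> RP1_topology interior_of C}"
  have Kcone: "v \<in> dir_cone C" if "v \<in> K" for v using that by (auto simp: K_def dir_cone_def)
  have cK': "compact K'" unfolding K'_def
    by (intro compact_UN finite compact_normalize)
       (use compact_units cone_image_interior(1) Kcone in \<open>auto simp: K_def intro!: continuous_intros\<close>)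
  have oO: "open O'" using openin_interior_of[of RP1_topology C]
    unfolding openin_RP1_topology O'_def by auto
  have sub: "K' \<subseteq> O'"
    unfolding K'_def O'_def using cone_image_interior Kcone
    by (auto simp: span_scaleR_eq)
  have OC: "O' \<subseteq> dir_cone C" using interior_of_subset[of RP1_topology C] by (auto simp: O'_def dir_cone_def)
  obtain e where e: "e > 0" "\<And>x. x \<in> K' \<Longrightarrow> cball x e \<subseteq> O'"
    using compact_subset_open_imp_cball_epsilon_subset[OF cK' oO sub] by (metis UN_subset_iff)
  show thesis
  proof (rule that[OF e(1)])
    fix i and v :: "real^2" and t :: real assume v: "v \<in> dir_cone C" and t: "\<bar>t\<bar> \<le> e"
    define y where "y = transpose (A i) *v v"
    define u where "u = (1 / norm v) *\<^sub>R v"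
    have v0: "v \<noteq> 0" using v by (simp add: dir_cone_def)
    have "u \<in> K" using v v0 by (auto simp: u_def K_def dir_cone_def span_scaleR_eq)
    have yu: "transpose (A i) *v u = (1 / norm v) *\<^sub>R y"
      by (simp add: u_def y_def matrix_vector_mult_scaleR)
    have y0: "y \<noteq> 0" using cone_image_interior[OF v] by (simp add: y_def)
    define z where "z = (1 / norm y) *\<^sub>R y"
    have "(transpose (A i) *v u) /\<^sub>R norm (transpose (A i) *v u) = z"
      unfolding yu z_def using v0 by simp
    then have "z \<in> K'" using \<open>u \<in> K\<close> unfolding K'_def by blast
    moreover have "norm z = 1" using y0 by (simp add: z_def)
    ultimately have "z + t *\<^sub>R rot z \<in> O'" using e(2)[of z] t by (auto simp: dist_norm)
    then have "z + t *\<^sub>R rot z \<in> dir_cone C" using OC by blast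
    then have "norm y *\<^sub>R (z + t *\<^sub>R rot z) \<in> dir_cone C" using y0 cone_scaleR by simp
    then show "transpose (A i) *v v + t *\<^sub>R rot (transpose (A i) *v v) \<in> dir_cone C"
      using y0 by (simp add: z_def y_def[symmetric] scaleR_add_right)
  qed
qed

text \<open>C is proper, so some line lies outside it. The functional given by its normal
  \<open>n\<close> vanishes at no vector of the cone, and compactness of the unit vectors makes this
  quantitative.\<close>

lemma cone_functional:
  obtains n :: "real^2" and c :: real where "norm n = 1" "c > 0" "\<And>x. x \<in> dir_cone C \<Longrightarrow> c * norm x \<le> \<bar>x \<bullet> n\<bar>"
proof -
  define K where "K = {v. norm v = 1 \<and> span {v} \<in> C}"
  obtain V where V: "V \<in> RP1" "V \<notin> C" using C_RP1 by blast
  obtain d where d: "norm d = 1" "V = span {d}" using RP1_unit[OF V(1)] by blast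
  define n where "n = rot d"
  have n1: "norm n = 1" using d by (simp add: n_def)
  have pos: "\<bar>x \<bullet> n\<bar> > 0" if "x \<in> K" for x
  proof (rule ccontr)
    assume "\<not> \<bar>x \<bullet> n\<bar> > 0"
    then have "x = (x \<bullet> d) *\<^sub>R d" using frame_decomp[OF d(1), of x] by (simp add: n_def)
    moreover have "x \<bullet> d \<noteq> 0" using that calculation by (auto simp: K_def)
    ultimately have "span {x} = V" using d(2) span_scaleR_eq by metis
    then show False using V(2) that by (auto simp: K_def)
  qed
  have Kne: "K \<noteq> {}" using cone_unit by (auto simp: K_def dir_cone_def)
  have "compact K" using compact_units by (simp add: K_def)
  moreover have "continuous_on K (\<lambda>x. \<bar>x \<bullet> n\<bar>)" by (intro continuous_intros)
  ultimately obtain x0 where x0: "x0 \<in> K" "\<And>x. x \<in> K \<Longrightarrow> \<bar>x0 \<bullet> n\<bar> \<le> \<bar>x \<bullet> n\<bar>"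
    using continuous_attains_inf[of K "\<lambda>x. \<bar>x \<bullet> n\<bar>"] Kne by blast
  show thesis
  proof (rule that[OF n1 pos[OF x0(1)]])
    fix x :: "real^2" assume x: "x \<in> dir_cone C"
    then have nz: "x \<noteq> 0" by (simp add: dir_cone_def)
    have "(1 / norm x) *\<^sub>R x \<in> K" using x nz by (auto simp: K_def dir_cone_def span_scaleR_eq)
    from x0(2)[OF this] show "\<bar>x0 \<bullet> n\<bar> * norm x \<le> \<bar>x \<bullet> n\<bar>"
      using nz by (simp add: field_simps abs_mult)
  qed
qed

text \<open>A vector y that is the image of a cone vector under one letter can be tilted both ways
  within the cone. Word matrices keep the tilted vectors in the cone, where the functional
  \<open>n\<close> has no zero. This bounds the image of \<open>rot y\<close> by the image of y, and
  with it the norm of the whole matrix.\<close>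

lemma cone_norm_lower:
  obtains c where "c > 0" "\<And>w v. v \<in> dir_cone C \<Longrightarrow>
    c * norm (mat_word A w) * norm v \<le> norm (transpose (mat_word A w) *v v)"
proof -
  obtain \<delta> where \<delta>: "\<delta> > 0" "\<And>i v t. v \<in> dir_cone C \<Longrightarrow> \<bar>t\<bar> \<le> \<delta> \<Longrightarrow>
    transpose (A i) *v v + t *\<^sub>R rot (transpose (A i) *v v) \<in> dir_cone C" by (rule cone_room) metis
  obtain n c where n: "norm n = 1" and c: "c > 0" "\<And>x. x \<in> dir_cone C \<Longrightarrow> c * norm x \<le> \<bar>x \<bullet> n\<bar>"
    by (rule cone_functional) metis
  define k where "k = 1 + (2 / c + 1) / \<delta>"
  have k: "k > 1" using c \<delta> by (auto simp: k_def add_pos_pos)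
  have main: "norm (mat_word A w) * norm y \<le> k * norm (transpose (mat_word A w) *v y)"
    if v: "v \<in> dir_cone C" and y: "y = transpose (A i) *v v" for w i v y
  proof -
    define M where "M = transpose (mat_word A w)"
    have inC: "M *v y + t *\<^sub>R (M *v rot y) \<in> dir_cone C" if "\<bar>t\<bar> \<le> \<delta>" for t
      using cone_invariant_word[OF \<delta>(2)[OF v that], of w i]
      by (simp add: M_def y matrix_vector_right_distrib matrix_vector_mult_scaleR)
    let ?p = "(M *v y) \<bullet> n" and ?q = "(M *v rot y) \<bullet> n"
    have nz: "?p + t * ?q \<noteq> 0" if "\<bar>t\<bar> \<le> \<delta>" for t
    proof -
      have "norm (M *v y + t *\<^sub>R (M *v rot y)) > 0" using inC[OF that] by (simp add: dir_cone_def)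
      then have "0 < \<bar>(M *v y + t *\<^sub>R (M *v rot y)) \<bullet> n\<bar>"
        using c(2)[OF inC[OF that]] c(1) by (smt (verit) mult_pos_pos)
      then show ?thesis by (auto simp: inner_add_left)
    qed
    \<comment> \<open>Otherwise the affine function p + t q would have a zero at an admissible tilt
      t.\<close>
    have pq: "\<delta> * \<bar>?q\<bar> \<le> \<bar>?p\<bar>"
    proof (rule ccontr)
      assume a: "\<not> \<delta> * \<bar>?q\<bar> \<le> \<bar>?p\<bar>"
      then have q0: "?q \<noteq> 0" by auto
      have "\<bar>- ?p / ?q\<bar> \<le> \<delta>" using a q0 by (simp add: field_simps)
      from nz[OF this] show False using q0 by simp
    qed
    have "c * norm (M *v y + \<delta> *\<^sub>R (M *v rot y)) \<le> \<bar>?p + \<delta> * ?q\<bar>"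
      using c(2)[OF inC[of \<delta>]] \<delta>(1) by (simp add: inner_add_left)
    also have "\<dots> \<le> 2 * \<bar>?p\<bar>"
      using pq \<delta>(1) abs_triangle_ineq[of ?p "\<delta> * ?q"] by (simp add: abs_mult)
    also have "\<bar>?p\<bar> \<le> norm (M *v y)" using Cauchy_Schwarz_ineq2[of "M *v y" n] n by simp
    finally have 1: "norm (M *v y + \<delta> *\<^sub>R (M *v rot y)) \<le> 2 / c * norm (M *v y)"
      using c(1) by (simp add: field_simps)
    have "\<delta> * norm (M *v rot y) \<le> norm (M *v y + \<delta> *\<^sub>R (M *v rot y)) + norm (M *v y)"
      using norm_triangle_ineq4[of "M *v y + \<delta> *\<^sub>R (M *v rot y)" "M *v y"] \<delta>(1) by simp
    also have "\<dots> \<le> (2 / c + 1) * norm (M *v y)" using 1 by (simp add: algebra_simps)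
    finally have 2: "norm (M *v rot y) \<le> (2 / c + 1) / \<delta> * norm (M *v y)"
      using \<delta>(1) by (simp add: field_simps)
    have y0: "y \<noteq> 0" using cone_image_interior[OF v] y by simp
    define e where "e = (1 / norm y) *\<^sub>R y"
    have e: "norm e = 1" "y = norm y *\<^sub>R e" using y0 by (simp_all add: e_def)
    have "(norm M)\<^sup>2 = (norm (M *v e))\<^sup>2 + (norm (M *v rot e))\<^sup>2" by (rule mat2_frame_norm[OF e(1)])
    also have "\<dots> \<le> (norm (M *v e) + norm (M *v rot e))\<^sup>2" by (simp add: power2_sum)
    finally have "norm M \<le> norm (M *v e) + norm (M *v rot e)" by (rule power2_le_imp_le) simp
    then have "norm M * norm y \<le> (norm (M *v e) + norm (M *v rot e)) * norm y" by (rule mult_right_mono) simp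
    also have "\<dots> = norm (M *v y) + norm (M *v rot y)"
      using y0 by (simp add: e_def matrix_vector_mult_scaleR field_simps)
    also have "\<dots> \<le> k * norm (M *v y)" using 2 by (simp add: k_def algebra_simps)
    finally show ?thesis by (simp add: M_def)
  qed
  \<comment> \<open>The first letter of a word acts first on v and is spent on bringing it into the
    interior. Its own loss is bounded by invertibility and finiteness of the alphabet.\<close>
  have "\<exists>c>0. \<forall>i v. v \<in> dir_cone C \<longrightarrow> c * norm (A i) * norm v \<le> norm (transpose (A i) *v v)"
  proof -
    define g where "g i = \<bar>det (A i)\<bar> / (norm (A i))\<^sup>2" for i
    define c1 where "c1 = Min (range g)"
    have pos: "norm (A i) > 0" for i using inv norm_pos_of_det by blast
    have "c1 > 0" unfolding c1_def using inv pos by (subst Min_gr_iff) (auto simp: g_def)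
    moreover have "c1 * norm (A i) * norm v \<le> norm (transpose (A i) *v v)" for i v
    proof -
      have "c1 \<le> g i" by (simp add: c1_def)
      then have "c1 * norm (A i) * norm v \<le> g i * norm (A i) * norm v" by (intro mult_right_mono) auto
      also have "\<dots> = norm (det (A i) *\<^sub>R rot v) / norm (A i)" using pos[of i] by (simp add: g_def power2_eq_square)
      also have "\<dots> \<le> norm (transpose (A i) *v v)"
        using norm_matvec2_le[of "A i" "rot (transpose (A i) *v v)"] pos[of i]
        unfolding matvec_rot_transpose by (simp add: field_simps)
      finally show ?thesis .
    qed
    ultimately show ?thesis by blast
  qed
  then obtain c1 where c1: "c1 > 0" "\<And>i v. v \<in> dir_cone C \<Longrightarrow> c1 * norm (A i) * norm v \<le> norm (transpose (A i) *v v)"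
    by blast
  have id: "norm (mat 1 :: real^2^2) \<le> 2"
  proof (rule power2_le_imp_le)
    show "(norm (mat 1 :: real^2^2))\<^sup>2 \<le> 2\<^sup>2" unfolding norm_mat2_sq by (simp add: mat_def)
  qed simp
  \<comment> \<open>1/2 serves the empty word, since the identity has norm at most 2;
    \<open>c1 / k\<close> combines the first letter with the remaining ones.\<close>
  define c2 where "c2 = min (1/2) (c1 / k)"
  have "c2 > 0" using c1 k by (simp add: c2_def)
  moreover have "c2 * norm (mat_word A w) * norm v \<le> norm (transpose (mat_word A w) *v v)"
    if v: "v \<in> dir_cone C" for w v
  proof (cases w)
    case Nil
    have "c2 \<le> 1/2" unfolding c2_def by (rule min.cobounded1)
    then have "c2 * norm (mat_word A w) * norm v \<le> (1/2) * 2 * norm v"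
      using id \<open>c2 > 0\<close> by (intro mult_right_mono mult_mono) (auto simp: Nil mat_word_def)
    then show ?thesis by (simp add: Nil mat_word_def)
  next
    case (Cons i w')
    define y where "y = transpose (A i) *v v"
    have "c2 * norm (mat_word A w) * norm v \<le> (c1 / k) * (norm (A i) * norm (mat_word A w')) * norm v"
      using norm_matmul2_le c1 k by (intro mult_right_mono mult_mono) (auto simp: c2_def Cons mat_word_Cons)
    also have "\<dots> = (norm (mat_word A w') * (c1 * norm (A i) * norm v)) / k" by simp
    also have "\<dots> \<le> (norm (mat_word A w') * norm y) / k"
      using c1(2)[OF v, of i] k by (intro divide_right_mono mult_left_mono) (auto simp: y_def)
    also have "\<dots> \<le> norm (transpose (mat_word A w') *v y)"
      using main[OF v y_def, of w'] k by (simp add: field_simps)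
    also have "transpose (mat_word A w') *v y = transpose (mat_word A w) *v v"
      by (simp add: Cons mat_word_Cons y_def matrix_transpose_mul matrix_vector_mul_assoc)
    finally show ?thesis .
  qed
  ultimately show thesis using that by blast
qed

end


section \<open>The iterated function system and its coding\<close>

lemma finite_words [simp]: "finite {w :: 'a::finite list. length w = n}"
  using finite_lists_length_eq[of "UNIV :: 'a set" n] by simp

lemma map_word_simps [simp]:
  "map_word f [] = id" "map_word f (i # w) = f i \<circ> map_word f w"
  by (simp_all add: map_word_def)

lemma map_word_append: "map_word f (u @ w) = map_word f u \<circ> map_word f w"
  by (induction u) auto

lemma mat_word_simps [simp]:
  "mat_word A [] = mat 1" "mat_word A (i # w) = A i ** mat_word A w"
  by (simp_all add: mat_word_def)

text \<open>Furstenberg directions use the transposes in the order of the word; reversing the word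
  gives the transpose of an ordinary word matrix. All words of a given length occur together there,
  so the reversal is harmless.\<close>

lemma adj_word_rev: "adj_word A w = transpose (mat_word A (rev w))"
proof -
  have app: "mat_word A (u @ [i]) = mat_word A u ** A i" for u i
    by (induction u) (simp_all add: matrix_mul_assoc)
  show ?thesis
    unfolding adj_word_def by (induction w) (simp_all add: app matrix_transpose_mul)
qed

lemma length_prefix_word [simp]: "length (prefix_word \<omega> n) = n"
  by (simp add: prefix_word_def)

lemma prefix_word_add: "prefix_word \<omega> (n + m) = prefix_word \<omega> n @ prefix_word (\<lambda>k. \<omega> (n + k)) m"
  by (intro nth_equalityI) (auto simp: prefix_word_def nth_append)

context multicone
begin

lemma furstenberg_directionsE:
  assumes "V \<in> furstenberg_directions A C"
  obtains w v where "length w = n" "v \<in> dir_cone C" "V = span {transpose (mat_word A w) *v v}"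
proof -
  from assms obtain w where w: "length w = n" "V \<in> proj_act (adj_word A w) C"
    unfolding furstenberg_directions_def by blast
  then obtain v where v: "v \<in> dir_cone C" "V = span {adj_word A w *v v}"
    using proj_actE[OF w(2) C_RP1(1)] det_mat_word by (auto simp: adj_word_rev)
  show thesis using that[of "rev w" v] v w by (simp add: adj_word_rev)
qed

lemma furstenberg_subset: "furstenberg_directions A C \<subseteq> C"
proof
  fix V assume "V \<in> furstenberg_directions A C"
  then obtain w v where "length w = 0" "v \<in> dir_cone C" "V = span {transpose (mat_word A w) *v v}"
    by (rule furstenberg_directionsE)
  then show "V \<in> C" by (simp add: dir_cone_def)
qed

text \<open>Cantor intersection on the unit circle: the last letter of w acts first in
  \<open>adj_word A w\<close> and preserves the cone, so the sets of normalised image vectors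
  decrease with the length.\<close>

lemma furstenberg_nonempty: "furstenberg_directions A C \<noteq> {}"
proof -
  define K where "K = {v. norm v = 1 \<and> span {v} \<in> C}"
  define N where "N w v = (adj_word A w *v v) /\<^sub>R norm (adj_word A w *v v)" for w and v :: "real^2"
  define L where "L n = (\<Union>w\<in>{w. length w = n}. N w ` K)" for n
  have Kcone: "v \<in> dir_cone C" if "v \<in> K" for v using that by (auto simp: K_def dir_cone_def)
  have nz: "adj_word A w *v v \<noteq> 0" if "v \<noteq> 0" for w v
    using that by (intro matvec_nonzero) (simp_all add: adj_word_rev det_mat_word)
  have cont: "continuous_on K ((*v) (adj_word A w))" for w
    by (intro linear_continuous_on matrix_vector_mul_bounded_linear)
  have comp: "compact (L n)" for n
    unfolding L_def N_def
  proof (intro compact_UN finite_words compact_normalize cont)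
    show "compact K" using compact_units by (simp add: K_def)
    show "adj_word A w *v x \<noteq> 0" if "x \<in> K" for w x
      using Kcone[OF that] nz by (simp add: dir_cone_def)
  qed
  obtain e where "e \<in> dir_cone C" "norm e = 1" by (rule cone_unit)
  then have e: "e \<in> K" by (simp add: K_def dir_cone_def)
  have ne: "L n \<noteq> {}" for n
    using e Ex_list_of_length[of n] unfolding L_def by blast
  have step: "L (Suc n) \<subseteq> L n" for n
  proof
    fix x assume "x \<in> L (Suc n)"
    then obtain w v where w: "length w = Suc n" and v: "v \<in> K" and x: "x = N w v" by (auto simp: L_def)
    then obtain u i where ui: "w = u @ [i]" by (metis length_Suc_conv_rev)
    define y where "y = transpose (A i) *v v"
    have yc: "y \<in> dir_cone C" using cone_invariant Kcone[OF v] by (simp add: y_def)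
    then have y0: "y \<noteq> 0" by (simp add: dir_cone_def)
    have "y /\<^sub>R norm y \<in> K" using cone_scaleR[OF _ yc, of "inverse (norm y)"] y0
      by (auto simp: K_def dir_cone_def)
    moreover have "x = N u (y /\<^sub>R norm y)"
    proof -
      have "adj_word A w *v v = adj_word A u *v y"
        by (simp add: ui adj_word_rev y_def matrix_transpose_mul matrix_vector_mul_assoc)
      then show ?thesis using y0 by (simp add: x N_def matrix_vector_mult_scaleR)
    qed
    moreover have "length u = n" using w ui by simp
    ultimately show "x \<in> L n" by (auto simp: L_def)
  qed
  have "m \<le> n \<Longrightarrow> L n \<subseteq> L m" for m n using lift_Suc_antimono_le[of L] step by blast
  then have "\<Inter> (range L) \<noteq> {}" using comp ne by (intro compact_nest) auto
  then obtain x where x: "\<And>n. x \<in> L n" by blast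
  have "span {x} \<in> furstenberg_directions A C"
    unfolding furstenberg_directions_def
  proof (intro INT_I)
    fix n
    obtain w v where w: "length w = n" and v: "v \<in> K" and xx: "x = N w v" using x[of n] by (auto simp: L_def)
    have "v \<noteq> 0" using v by (auto simp: K_def)
    then have "span {x} = span {adj_word A w *v v}" using nz[of v w] by (simp add: xx N_def span_scaleR_eq)
    then have "span {x} \<in> proj_act (adj_word A w) C" using v by (auto simp: K_def intro: in_proj_act_span)
    then show "span {x} \<in> (\<Union>w\<in>{w. length w = n}. proj_act (adj_word A w) C)" using w by blast
  qed
  then show ?thesis by blast
qed

end

locale self_affine = multicone A C
  for A :: "'a::finite \<Rightarrow> real^2^2" and C :: "(real^2) set set" +
  fixes t :: "'a \<Rightarrow> real^2" and X :: "(real^2) set" and s :: real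
  assumes contr: "\<And>i. onorm ((*v) (A i)) < 1"
    and X: "is_attractor (affine_ifs A t) X"
    and dom: "dominated A"
    and s: "1 < s" "s \<le> 2"
begin

abbreviation F :: "'a list \<Rightarrow> real^2 \<Rightarrow> real^2" where
  "F \<equiv> map_word (affine_ifs A t)"

abbreviation "\<pi> \<equiv> natural_proj (affine_ifs A t)"

lemma compact_X: "compact X" and X_nonempty: "X \<noteq> {}" and X_eq: "X = (\<Union>i. affine_ifs A t i ` X)"
  using X by (auto simp: is_attractor_def)

lemma F_diff: "F w x - F w y = mat_word A w *v (x - y)"
proof (induction w)
  case (Cons i w)
  have "F (i # w) x - F (i # w) y = A i *v (F w x - F w y)"
    by (simp add: affine_ifs_def matrix_vector_mult_diff_distrib)
  then show ?case by (simp add: Cons matrix_vector_mul_assoc)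
qed simp

lemma X_words: "X = (\<Union>w\<in>{w. length w = n}. F w ` X)"
proof (induction n)
  case (Suc n)
  have "{w :: 'a list. length w = Suc n} = (\<Union>i. (#) i ` {w. length w = n})"
    by (auto simp: length_Suc_conv)
  then have "(\<Union>w\<in>{w. length w = Suc n}. F w ` X) = (\<Union>i. affine_ifs A t i ` (\<Union>w\<in>{w. length w = n}. F w ` X))"
    by (auto simp: image_comp[symmetric])
  then show ?case using Suc X_eq by simp
qed simp

lemma F_image_X: "F w ` X \<subseteq> X"
  using X_words[of "length w"] by blast

text \<open>The rate is the largest operator norm, and the bound is stated for images of vectors,
  because the Frobenius norm of a contracting letter may exceed 1.\<close>

lemma contraction:
  obtains \<rho> where "0 \<le> \<rho>" "\<rho> < 1" "\<And>w v. norm (mat_word A w *v v) \<le> \<rho> ^ length w * norm v"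
proof -
  define \<rho> where "\<rho> = Max (range (\<lambda>i. onorm ((*v) (A i))))"
  have le: "onorm ((*v) (A i)) \<le> \<rho>" for i by (simp add: \<rho>_def)
  have \<rho>0: "0 \<le> \<rho>"
    using le onorm_pos_le[OF matrix_vector_mul_bounded_linear] order_trans by blast
  have 1: "\<rho> < 1" unfolding \<rho>_def using contr by simp
  have "norm (mat_word A w *v v) \<le> \<rho> ^ length w * norm v" for w v
  proof (induction w)
    case (Cons i w)
    have "norm (mat_word A (i # w) *v v) = norm (A i *v (mat_word A w *v v))"
      by (simp add: matrix_vector_mul_assoc)
    also have "\<dots> \<le> onorm ((*v) (A i)) * norm (mat_word A w *v v)"
      by (rule onorm[OF matrix_vector_mul_bounded_linear])
    also have "\<dots> \<le> \<rho> * (\<rho> ^ length w * norm v)"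
      using le Cons \<rho>0 by (intro mult_mono) auto
    finally show ?case by (simp add: mult.assoc)
  qed simp
  then show thesis using that \<rho>0 1 by blast
qed

lemma F_dist_null:
  assumes "\<epsilon> > 0" "bounded S"
  obtains n0 where "\<And>(w :: 'a list) x y. n0 \<le> length w \<Longrightarrow> x \<in> S \<Longrightarrow> y \<in> S \<Longrightarrow> dist (F w x) (F w y) < \<epsilon>"
proof -
  obtain \<rho> where \<rho>: "0 \<le> \<rho>" "\<rho> < 1" "\<And>w v. norm (mat_word A w *v v) \<le> \<rho> ^ length w * norm v"
    by (rule contraction) metis
  define D where "D = diameter S + 1"
  have D: "0 < D" using diameter_ge_0[OF assms(2)] by (simp add: D_def)
  obtain n0 where n0: "\<rho> ^ n0 < \<epsilon> / D"
    using real_arch_pow_inv[of "\<epsilon> / D" \<rho>] \<rho> assms D by auto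
  show thesis
  proof (rule that[of n0])
    fix w :: "'a list" and x y assume w: "n0 \<le> length w" and xy: "x \<in> S" "y \<in> S"
    have "dist (F w x) (F w y) \<le> \<rho> ^ length w * norm (x - y)"
      using \<rho>(3) by (simp add: dist_norm F_diff)
    also have "\<dots> \<le> \<rho> ^ n0 * D"
      using \<rho> w diameter_bounded_bound[OF assms(2) xy]
      by (intro mult_mono power_decreasing) (auto simp: D_def dist_norm)
    also have "\<dots> < \<epsilon>" using n0 D by (simp add: field_simps)
    finally show "dist (F w x) (F w y) < \<epsilon>" .
  qed
qed

lemma continuous_F: "continuous_on S (F w)"
proof (induction w arbitrary: S)
  case (Cons i w)
  have "continuous_on S' (affine_ifs A t i)" for S'
    unfolding affine_ifs_def
    by (intro continuous_intros linear_continuous_on matrix_vector_mul_bounded_linear)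
  then show ?case using Cons by (auto simp: o_def intro: continuous_on_compose2[of UNIV])
qed (simp add: continuous_on_id')

text \<open>\<open>lim\<close> has a meaning only once convergence is known. The images of X under
  the prefixes are nested compact sets with a common point, and the images of 0 approach it because
  long words shrink \<open>insert 0 X\<close> uniformly.\<close>

lemma natural_proj:
  shows "(\<lambda>n. F (prefix_word \<omega> n) 0) \<longlonglongrightarrow> \<pi> \<omega>" "\<pi> \<omega> \<in> F (prefix_word \<omega> n) ` X"
proof -
  define L where "L n = F (prefix_word \<omega> n) ` X" for n
  have "L (n + k) \<subseteq> L n" for n k
    unfolding L_def prefix_word_add map_word_append image_comp[symmetric]
    by (intro image_mono F_image_X)
  then have "m \<le> n \<Longrightarrow> L n \<subseteq> L m" for m n by (metis le_Suc_ex)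
  moreover have "compact (L n)" "L n \<noteq> {}" for n
    using compact_X X_nonempty by (auto simp: L_def intro: compact_continuous_image continuous_F)
  ultimately have "\<Inter> (range L) \<noteq> {}" by (intro compact_nest) auto
  then obtain z where z: "\<And>n. z \<in> L n" by blast
  have lim: "(\<lambda>n. F (prefix_word \<omega> n) 0) \<longlonglongrightarrow> z"
  proof (rule metric_LIMSEQ_I)
    fix \<epsilon> :: real assume \<epsilon>: "\<epsilon> > 0"
    have "bounded (insert 0 X)" using compact_X compact_imp_bounded by simp
    then obtain n0 where n0: "\<And>(w :: 'a list) x y. n0 \<le> length w \<Longrightarrow> x \<in> insert 0 X \<Longrightarrow> y \<in> insert 0 X \<Longrightarrow> dist (F w x) (F w y) < \<epsilon>"
      using F_dist_null[OF \<epsilon>] by metis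
    have "dist (F (prefix_word \<omega> n) 0) z < \<epsilon>" if "n0 \<le> n" for n
      using z[of n] n0[of "prefix_word \<omega> n"] that by (auto simp: L_def)
    then show "\<exists>no. \<forall>n\<ge>no. dist (F (prefix_word \<omega> n) 0) z < \<epsilon>" by blast
  qed
  then have "\<pi> \<omega> = z" unfolding natural_proj_def by (rule limI)
  then show "(\<lambda>n. F (prefix_word \<omega> n) 0) \<longlonglongrightarrow> \<pi> \<omega>" "\<pi> \<omega> \<in> F (prefix_word \<omega> n) ` X"
    using lim z[of n] by (auto simp: L_def)
qed

end

lemma space_word_borel: "space word_borel = UNIV"
  by (simp add: word_borel_def)

lemma in_cylinder_iff: "\<omega> \<in> cylinder w \<longleftrightarrow> (\<forall>k<length w. \<omega> k = w ! k)"
  using list_eq_iff_nth_eq[of "prefix_word \<omega> (length w)" w] by (simp add: cylinder_def prefix_word_def)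

lemma cylinder_sets: "cylinder w \<in> sets word_borel"
proof -
  have "cylinder w = PiE UNIV (\<lambda>k. if k < length w then {w ! k} else UNIV)"
    by (intro set_eqI) (simp add: in_cylinder_iff PiE_UNIV_domain Pi_iff)
  moreover have "openin (product_topology (\<lambda>_. discrete_topology UNIV) UNIV)
      (PiE UNIV (\<lambda>k. if k < length w then {w ! k} else (UNIV :: 'a set)))"
  proof (rule product_topology_basis)
    show "finite {i. (if i < length w then {w ! i} else UNIV) \<noteq> topspace (discrete_topology (UNIV :: 'a set))}"
      by (rule finite_subset[of _ "{..<length w}"]) auto
  qed simp
  ultimately show ?thesis by (auto simp: word_borel_def)
qed

context self_affine begin

text \<open>A pointwise limit of maps that depend on n letters, whose preimages are finite unions of
  cylinders.\<close>

lemma natural_proj_measurable: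
  assumes "sets \<mu> = sets word_borel"
  shows "\<pi> \<in> borel_measurable \<mu>"
proof -
  have "(\<lambda>\<omega>. F (prefix_word \<omega> n) 0) \<in> borel_measurable \<mu>" for n
  proof (rule measurableI)
    fix B :: "(real^2) set"
    have sp: "space \<mu> = UNIV" using sets_eq_imp_space_eq[OF assms] space_word_borel by simp
    have "(\<lambda>\<omega>. F (prefix_word \<omega> n) 0) -` B \<inter> space \<mu> = (\<Union>w\<in>{w. length w = n \<and> F w 0 \<in> B}. cylinder w)"
      by (auto simp: cylinder_def sp)
    moreover have "finite {w. length w = n \<and> F w 0 \<in> B}"
      by (rule finite_subset[OF _ finite_words[of n]]) auto
    ultimately show "(\<lambda>\<omega>. F (prefix_word \<omega> n) 0) -` B \<inter> space \<mu> \<in> sets \<mu>"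
      using cylinder_sets assms by (metis (no_types, lifting) sets.finite_UN)
  qed simp
  then show ?thesis by (rule borel_measurable_LIMSEQ_metric) (rule natural_proj(1))
qed

end


section \<open>Covers by finite words\<close>

lemma diameter_le_bound:
  fixes S :: "'b::metric_space set"
  assumes "\<And>x y. x \<in> S \<Longrightarrow> y \<in> S \<Longrightarrow> dist x y \<le> d" "0 \<le> d"
  shows "bounded S" "diameter S \<le> d"
proof -
  show "bounded S"
  proof (cases "S = {}")
    case False
    then obtain x where "x \<in> S" by blast
    then show ?thesis using assms(1)[of x] by (auto simp: bounded_def)
  qed simp
  show "diameter S \<le> d"
    unfolding diameter_def using assms by (auto intro!: cSUP_least)
qed

lemma hausdorff_pre_finite_cover:
  assumes "finite I" "S \<subseteq> (\<Union>i\<in>I. U i)" "\<And>i. i \<in> I \<Longrightarrow> bounded (U i) \<and> diameter (U i) < \<delta>" "0 < \<delta>"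
  shows "hausdorff_pre s \<delta> S \<le> (\<Sum>i\<in>I. ennreal (diameter (U i) powr s))"
proof -
  define n where "n = card I"
  obtain h where h: "bij_betw h {..<n} I"
    using ex_bij_betw_nat_finite[OF assms(1)] by (auto simp: n_def atLeast0LessThan)
  \<comment> \<open>The definition asks for a sequence; it is padded with empty sets, which cost
    \<open>0 powr s = 0\<close>.\<close>
  define W where "W k = (if k < n then U (h k) else {})" for k
  have hI: "h k \<in> I" if "k < n" for k using h that by (auto simp: bij_betw_def)
  have "S \<subseteq> (\<Union>k. W k)"
  proof
    fix x assume "x \<in> S"
    then obtain i where "i \<in> I" "x \<in> U i" using assms(2) by blast
    then obtain k where "k < n" "i = h k" using h by (auto simp: bij_betw_def)
    then show "x \<in> (\<Union>k. W k)" using \<open>x \<in> U i\<close> by (auto simp: W_def)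
  qed
  moreover have "\<forall>k. bounded (W k) \<and> diameter (W k) < \<delta>"
    using assms hI by (auto simp: W_def)
  ultimately have "hausdorff_pre s \<delta> S \<le> (\<Sum>k. ennreal (diameter (W k) powr s))"
    unfolding hausdorff_pre_def by (intro INF_lower) simp
  also have "\<dots> = (\<Sum>k<n. ennreal (diameter (W k) powr s))"
    by (rule suminf_finite) (auto simp: W_def)
  also have "\<dots> = (\<Sum>k<n. ennreal (diameter (U (h k)) powr s))"
    by (rule sum.cong) (auto simp: W_def)
  also have "\<dots> = (\<Sum>i\<in>I. ennreal (diameter (U i) powr s))"
    by (rule sum.reindex_bij_betw[OF h])
  finally show ?thesis .
qed

lemma hausdorff_content_le_pre: "hausdorff_content s S \<le> hausdorff_pre s \<delta> S"
  unfolding hausdorff_content_def hausdorff_pre_def by (intro INF_superset_mono) auto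

lemma hausdorff_content_finite_cover:
  assumes "finite I" "S \<subseteq> (\<Union>i\<in>I. U i)" "\<And>i. i \<in> I \<Longrightarrow> bounded (U i)"
  shows "hausdorff_content s S \<le> (\<Sum>i\<in>I. ennreal (diameter (U i) powr s))"
proof -
  \<comment> \<open>Larger than every diameter in the cover, so that the restriction on diameters
    holds automatically.\<close>
  define \<delta> where "\<delta> = 1 + (\<Sum>i\<in>I. diameter (U i))"
  have nn: "i \<in> I \<Longrightarrow> 0 \<le> diameter (U i)" for i using assms(3) diameter_ge_0 by blast
  have "i \<in> I \<Longrightarrow> diameter (U i) < \<delta>" for i
    using member_le_sum[of i I "\<lambda>i. diameter (U i)"] nn assms(1) by (simp add: \<delta>_def)
  moreover have "0 < \<delta>" using sum_nonneg[of I "\<lambda>i. diameter (U i)"] nn by (simp add: \<delta>_def)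
  ultimately show ?thesis
    using hausdorff_pre_finite_cover[OF assms(1,2)] assms(3) hausdorff_content_le_pre order_trans by metis
qed

lemma RP1_span: "norm e = 1 \<Longrightarrow> span {e} \<in> RP1" for e :: "real^2"
  by (auto simp: RP1_def dim_insert)

lemma slice_eq:
  fixes e :: "real^2"
  assumes "norm e = 1" "v \<in> span {e}"
  shows "orth_proj (span {e}) -` {v} = {y. y \<bullet> e = v \<bullet> e}"
proof -
  have e0: "e \<noteq> 0" "e \<bullet> e = 1" using assms(1) by (auto simp: norm_eq_1)
  obtain k where k: "v = k *\<^sub>R e" using assms(2) by (auto simp: span_singleton)
  show ?thesis
    using orth_proj_unit[OF RP1_span[OF assms(1)] _ assms(1)] e0
    by (auto simp: k span_base)
qed

lemma line_lebesgue_span: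
  fixes e :: "real^2"
  assumes "norm e = 1"
  shows "line_lebesgue (span {e}) = distr lborel (restrict_space borel (span {e})) (\<lambda>r. r *\<^sub>R e)"
  by (rule line_lebesgue_unit[OF RP1_span[OF assms] _ assms]) (simp add: span_base)

lemma space_line_lebesgue: "norm e = 1 \<Longrightarrow> space (line_lebesgue (span {e})) = span {e}" for e :: "real^2"
  by (simp add: line_lebesgue_span space_restrict_space)

lemma nn_integral_line_lebesgue:
  fixes e :: "real^2"
  assumes "norm e = 1" "g \<in> borel_measurable borel"
  shows "(\<integral>\<^sup>+v. g (v \<bullet> e) \<partial>line_lebesgue (span {e})) = (\<integral>\<^sup>+t. g t \<partial>lborel)"
proof -
  have ee: "e \<bullet> e = 1" using assms(1) by (simp add: norm_eq_1)
  have meas: "(\<lambda>r. r *\<^sub>R e) \<in> lborel \<rightarrow>\<^sub>M restrict_space borel (span {e})"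
    by (rule measurable_restrict_space2) (auto simp: span_singleton)
  have "(\<lambda>v. v \<bullet> e) \<in> borel_measurable (restrict_space borel (span {e}))"
    by (rule measurable_restrict_space1) simp
  then have gm: "(\<lambda>v. g (v \<bullet> e)) \<in> borel_measurable (restrict_space borel (span {e}))"
    using assms(2) by (rule measurable_compose)
  show ?thesis
    unfolding line_lebesgue_span[OF assms(1)]
    by (subst nn_integral_distr[OF meas]) (use gm in \<open>simp_all add: ee\<close>)
qed

text \<open>Piece i meets slices only over an interval of length \<open>l i\<close> and contributes
  at most \<open>h i powr u\<close> to each, so a step function with this integral dominates the
  slice contents. \<open>nn_integral\<close> is monotone for arbitrary functions, so the contents
  enter without a measurability argument.\<close>

lemma slice_integral_cover:
  fixes e :: "real^2"
  assumes e: "norm e = 1" and I: "finite I" and cov: "X \<subseteq> (\<Union>i\<in>I. P i)"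
    and strip: "\<And>i p. i \<in> I \<Longrightarrow> p \<in> P i \<Longrightarrow> a i \<le> p \<bullet> e \<and> p \<bullet> e \<le> a i + l i"
    and thin: "\<And>i p q. i \<in> I \<Longrightarrow> p \<in> P i \<Longrightarrow> q \<in> P i \<Longrightarrow> p \<bullet> e = q \<bullet> e \<Longrightarrow> dist p q \<le> h i"
    and pos: "\<And>i. i \<in> I \<Longrightarrow> 0 \<le> l i \<and> 0 \<le> h i" and u: "0 \<le> u"
  shows "slice_integral u X (span {e}) \<le> ennreal (\<Sum>i\<in>I. l i * h i powr u)"
proof -
  define g where "g \<tau> = (\<Sum>i\<in>I. ennreal (h i powr u) * indicator {a i..a i + l i} \<tau>)" for \<tau> :: real
  have gm: "g \<in> borel_measurable borel" unfolding g_def by measurable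
  have "hausdorff_content u (X \<inter> orth_proj (span {e}) -` {v}) \<le> g (v \<bullet> e)" if v: "v \<in> span {e}" for v
  proof -
    define Q where "Q i = P i \<inter> {y. y \<bullet> e = v \<bullet> e}" for i
    have Q: "bounded (Q i)" "diameter (Q i) \<le> h i" if "i \<in> I" for i
      using diameter_le_bound[of "Q i" "h i"] thin[OF that] pos[OF that] by (auto simp: Q_def)
    have "hausdorff_content u (X \<inter> orth_proj (span {e}) -` {v}) \<le> (\<Sum>i\<in>I. ennreal (diameter (Q i) powr u))"
      unfolding slice_eq[OF e v] using cov Q by (intro hausdorff_content_finite_cover I) (auto simp: Q_def)
    also have "\<dots> \<le> g (v \<bullet> e)"
      unfolding g_def
    proof (rule sum_mono)
      fix i assume i: "i \<in> I"
      show "ennreal (diameter (Q i) powr u) \<le> ennreal (h i powr u) * indicator {a i..a i + l i} (v \<bullet> e)"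
      proof (cases "v \<bullet> e \<in> {a i..a i + l i}")
        case True
        then show ?thesis using Q[OF i] diameter_ge_0[of "Q i"] u by (auto intro!: ennreal_leI powr_mono2)
      next
        case False
        then have "Q i = {}" using strip[OF i] by (fastforce simp: Q_def)
        then show ?thesis by simp
      qed
    qed
    finally show ?thesis .
  qed
  then have "slice_integral u X (span {e}) \<le> (\<integral>\<^sup>+v. g (v \<bullet> e) \<partial>line_lebesgue (span {e}))"
    unfolding slice_integral_def by (intro nn_integral_mono) (simp add: space_line_lebesgue[OF e])
  also have "\<dots> = (\<integral>\<^sup>+t. g t \<partial>lborel)" by (rule nn_integral_line_lebesgue[OF e gm])
  also have "\<dots> = (\<Sum>i\<in>I. ennreal (h i powr u) * ennreal (l i))"
    unfolding g_def using pos by (subst nn_integral_sum) (auto intro!: sum.cong simp: nn_integral_cmult_indicator)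
  also have "\<dots> = (\<Sum>i\<in>I. ennreal (l i * h i powr u))"
    using pos by (intro sum.cong) (auto simp: ennreal_mult' mult.commute)
  also have "\<dots> = ennreal (\<Sum>i\<in>I. l i * h i powr u)"
    using pos by (intro sum_ennreal) auto
  finally show ?thesis .
qed

section \<open>Words composed of blocks outside a given set, and their mass\<close>

fun avoiding :: "'a list set \<Rightarrow> nat \<Rightarrow> nat \<Rightarrow> 'a list set" where
  "avoiding D n 0 = {[]}"
| "avoiding D n (Suc j) = (\<lambda>(u, w). u @ w) ` (avoiding D n j \<times> {w. length w = n \<and> w \<notin> D})"

lemma avoiding_length: "u \<in> avoiding D n j \<Longrightarrow> length u = j * n"
  by (induction j arbitrary: u) auto

lemma finite_avoiding [simp]: "finite (avoiding (D :: 'a::finite list set) n j)"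
proof (induction j)
  case (Suc j)
  have "finite {w. length w = n \<and> w \<notin> D}" by (rule finite_subset[OF _ finite_words[of n]]) auto
  then show ?case using Suc by simp
qed simp

text \<open>The measure is represented by its cylinder masses: the covering arguments use that they
  are normalised, additive over one-letter extensions and comparable to \<open>phi\<close>.\<close>

locale gibbs = self_affine A C t X s
  for A :: "'a::finite \<Rightarrow> real^2^2" and C :: "(real^2) set set" and t X s +
  fixes m :: "'a list \<Rightarrow> real" and b :: real
  assumes m_Nil: "m [] = 1" and m_split: "m w = (\<Sum>i\<in>UNIV. m (w @ [i]))"
    and b: "b > 0" and m_lower: "phi s (mat_word A w) \<le> b * m w" and m_upper: "m w \<le> b * phi s (mat_word A w)"
begin

lemma m_pos: "0 < m w"
  using m_lower[of w] phi_pos[OF det_mat_word, of s w] b by (smt (verit) mult_nonneg_nonpos)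

lemma m_refine: "m u = (\<Sum>w | length w = n. m (u @ w))"
proof (induction n)
  case (Suc n)
  have eq: "{w :: 'a list. length w = Suc n} = (\<lambda>(w, i). w @ [i]) ` ({w. length w = n} \<times> UNIV)"
    by (auto simp: length_Suc_conv_rev)
  have "(\<Sum>w | length w = Suc n. m (u @ w)) = (\<Sum>(w, i)\<in>{w. length w = n} \<times> UNIV. m (u @ w @ [i]))"
    unfolding eq by (subst sum.reindex) (auto simp: inj_on_def intro!: sum.cong)
  also have "\<dots> = (\<Sum>w | length w = n. \<Sum>i\<in>UNIV. m ((u @ w) @ [i]))"
    by (subst sum.cartesian_product[symmetric]) simp
  also have "\<dots> = (\<Sum>w | length w = n. m (u @ w))"
    by (intro sum.cong refl m_split[symmetric])
  finally show ?case using Suc by simp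
qed simp

text \<open>For a unit vector e of the cone, ||A_uw|| is at least the length of A_w^T A_u^T e, and
  \<open>cone_norm_lower\<close> applies twice because A_u^T e is again in the cone.\<close>

lemma m_quasi_mult: obtains c where "0 < c" "\<And>u w. c * m u * m w \<le> m (u @ w)"
proof -
  obtain c0 where c0: "c0 > 0" "\<And>w v. v \<in> dir_cone C \<Longrightarrow>
    c0 * norm (mat_word A w) * norm v \<le> norm (transpose (mat_word A w) *v v)"
    by (rule cone_norm_lower) metis
  obtain e where e: "e \<in> dir_cone C" "norm e = 1" by (rule cone_unit)
  define k where "k = (c0\<^sup>2) powr (2 - s)"
  have k: "k > 0" using c0 by (simp add: k_def)
  have "k * phi s (mat_word A u) * phi s (mat_word A w) \<le> phi s (mat_word A (u @ w))" for u w
  proof -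
    let ?a = "norm (mat_word A u)" and ?b = "norm (mat_word A w)"
    have "c0\<^sup>2 * ?a * ?b = c0 * ?b * (c0 * ?a * norm e)" by (simp add: e power2_eq_square)
    also have "\<dots> \<le> c0 * ?b * norm (transpose (mat_word A u) *v e)"
      using c0(1) c0(2)[OF e(1), of u] by (intro mult_left_mono) auto
    also have "\<dots> \<le> norm (transpose (mat_word A w) *v (transpose (mat_word A u) *v e))"
      using c0(2) cone_invariant_word[OF e(1)] by blast
    also have "\<dots> = norm (transpose (mat_word A (u @ w)) *v e)"
      by (simp add: mat_word_append matrix_transpose_mul matrix_vector_mul_assoc)
    also have "\<dots> \<le> norm (mat_word A (u @ w))"
      using norm_matvec2_le[of "transpose (mat_word A (u @ w))" e] e by simp
    finally have "(c0\<^sup>2 * ?a * ?b) powr (2 - s) \<le> norm (mat_word A (u @ w)) powr (2 - s)"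
      using s by (intro powr_mono2) auto
    then have "k * ?a powr (2 - s) * ?b powr (2 - s) * \<bar>det (mat_word A u) * det (mat_word A w)\<bar> powr (s - 1)
        \<le> norm (mat_word A (u @ w)) powr (2 - s) * \<bar>det (mat_word A u) * det (mat_word A w)\<bar> powr (s - 1)"
      by (intro mult_right_mono) (simp_all add: k_def powr_mult)
    then show ?thesis
      by (simp add: phi_def mat_word_append det_mul abs_mult powr_mult mult_ac)
  qed
  \<comment> \<open>One factor b each for replacing the masses of u, of w and of
    \<open>u @ w\<close> by \<open>phi\<close>.\<close>
  moreover have "k / b ^ 3 * m u * m w \<le> k * phi s (mat_word A u) * phi s (mat_word A w) / b" for u w
  proof -
    have "m u * m w \<le> (b * phi s (mat_word A u)) * (b * phi s (mat_word A w))"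
      using m_upper m_pos b phi_pos[OF det_mat_word] by (intro mult_mono) (auto simp: less_imp_le)
    then have "k / b ^ 3 * (m u * m w) \<le> k / b ^ 3 * ((b * phi s (mat_word A u)) * (b * phi s (mat_word A w)))"
      using k b by (intro mult_left_mono) auto
    then show ?thesis using b by (simp add: field_simps power3_eq_cube)
  qed
  moreover have "phi s (mat_word A w) / b \<le> m w" for w
    using m_lower[of w] b by (simp add: field_simps)
  ultimately have "k / b ^ 3 * m u * m w \<le> m (u @ w)" for u w
    using b by (meson divide_right_mono less_imp_le order_trans)
  then show thesis using that[of "k / b ^ 3"] k b by simp
qed

context
  fixes D :: "'a list set" and n :: nat
  assumes D: "\<And>w. w \<in> D \<Longrightarrow> length w = n"
begin

lemma finite_D: "finite D"
  by (rule finite_subset[OF _ finite_words[of n]]) (use D in auto)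

text \<open>Split the mass of u over all extensions by one block and remove those in D. Since u has
  length \<open>j * n\<close>, a word determines u and its last block.\<close>

lemma avoiding_step:
  "(\<Sum>u\<in>avoiding D n (Suc j). m u) = (\<Sum>u\<in>avoiding D n j. m u - (\<Sum>w\<in>D. m (u @ w)))"
proof -
  let ?E = "{w. length w = n \<and> w \<notin> D}"
  have fin: "finite ?E" by (rule finite_subset[OF _ finite_words[of n]]) auto
  have "inj_on (\<lambda>(u, w). u @ w) (avoiding D n j \<times> ?E)"
    by (auto simp: inj_on_def dest: avoiding_length)
  then have "(\<Sum>u\<in>avoiding D n (Suc j). m u) = sum (m \<circ> (\<lambda>(u, w). u @ w)) (avoiding D n j \<times> ?E)"
    unfolding avoiding.simps by (rule sum.reindex)
  also have "\<dots> = (\<Sum>(u, w)\<in>avoiding D n j \<times> ?E. m (u @ w))"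
    by (intro sum.cong) auto
  also have "\<dots> = (\<Sum>u\<in>avoiding D n j. \<Sum>w\<in>?E. m (u @ w))"
    by (rule sum.cartesian_product[symmetric])
  also have "\<dots> = (\<Sum>u\<in>avoiding D n j. m u - (\<Sum>w\<in>D. m (u @ w)))"
  proof (rule sum.cong[OF refl])
    fix u
    have "{w. length w = n} = ?E \<union> D" using D by auto
    then have "m u = (\<Sum>w\<in>?E \<union> D. m (u @ w))" using m_refine[of u n] by simp
    also have "\<dots> = (\<Sum>w\<in>?E. m (u @ w)) + (\<Sum>w\<in>D. m (u @ w))"
      using fin finite_D by (intro sum.union_disjoint) auto
    finally show "(\<Sum>w\<in>?E. m (u @ w)) = m u - (\<Sum>w\<in>D. m (u @ w))" by simp
  qed
  finally show ?thesis .
qed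

text \<open>The left side sorts mass by the block in which D is first met; the sum subtracted on the
  right is the mass that has not met D within J blocks.\<close>

lemma avoiding_telescope:
  "(\<Sum>j<J. \<Sum>u\<in>avoiding D n j. \<Sum>w\<in>D. m (u @ w)) = 1 - (\<Sum>u\<in>avoiding D n J. m u)"
proof (induction J)
  case (Suc J)
  then show ?case using avoiding_step[of J] by (simp add: sum_subtractf del: avoiding.simps(2))
qed (simp add: m_Nil)

lemma avoiding_hit_le: "(\<Sum>j<J. \<Sum>u\<in>avoiding D n j. \<Sum>w\<in>D. m (u @ w)) \<le> 1"
  unfolding avoiding_telescope using m_pos by (simp add: sum_nonneg less_imp_le)

text \<open>By quasi-multiplicativity at least c m(D) m(u) of the mass of u meets D in the next
  block, and such first meetings have total mass at most 1. The bound is uniform in J.\<close>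

lemma avoiding_sum_le:
  assumes c: "0 < c" "\<And>u w. c * m u * m w \<le> m (u @ w)"
  shows "c * (\<Sum>w\<in>D. m w) * (\<Sum>j<J. \<Sum>u\<in>avoiding D n j. m u) \<le> 1"
proof -
  have "c * (\<Sum>w\<in>D. m w) * (\<Sum>u\<in>avoiding D n j. m u) = (\<Sum>u\<in>avoiding D n j. \<Sum>w\<in>D. c * m u * m w)" for j
  proof -
    have "c * (\<Sum>w\<in>D. m w) * (\<Sum>u\<in>avoiding D n j. m u) = c * ((\<Sum>u\<in>avoiding D n j. m u) * (\<Sum>w\<in>D. m w))"
      by simp
    then show ?thesis unfolding sum_product by (simp add: sum_distrib_left mult.assoc)
  qed
  then have "c * (\<Sum>w\<in>D. m w) * (\<Sum>j<J. \<Sum>u\<in>avoiding D n j. m u) = (\<Sum>j<J. \<Sum>u\<in>avoiding D n j. \<Sum>w\<in>D. c * m u * m w)"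
    by (simp add: sum_distrib_left)
  also have "\<dots> \<le> (\<Sum>j<J. \<Sum>u\<in>avoiding D n j. \<Sum>w\<in>D. m (u @ w))"
    using c by (intro sum_mono)
  also have "\<dots> \<le> 1" by (rule avoiding_hit_le)
  finally show ?thesis .
qed

lemma avoiding_null:
  assumes "D \<noteq> {}"
  shows "(\<lambda>J. \<Sum>u\<in>avoiding D n J. m u) \<longlonglongrightarrow> 0"
proof -
  obtain c where c: "0 < c" "\<And>u w. c * m u * m w \<le> m (u @ w)" by (rule m_quasi_mult) metis
  define p where "p = c * (\<Sum>w\<in>D. m w)"
  have p: "0 < p" unfolding p_def using assms finite_D m_pos c by (intro mult_pos_pos sum_pos) auto
  define S where "S J = (\<Sum>u\<in>avoiding D n J. m u)" for J
  have S0: "0 \<le> S J" for J using m_pos by (simp add: S_def sum_nonneg less_imp_le)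
  have "summable S"
  proof (rule summableI_nonneg_bounded[where x = "1 / p"])
    fix J show "(\<Sum>j<J. S j) \<le> 1 / p"
      using avoiding_sum_le[OF c, of J] p by (simp add: S_def p_def[symmetric] field_simps)
  qed (rule S0)
  then show ?thesis unfolding S_def by (rule summable_LIMSEQ_zero)
qed

lemma avoiding_cover:
  "X \<subseteq> (\<Union>j<J. \<Union>u\<in>avoiding D n j. \<Union>w\<in>D. F (u @ w) ` X) \<union> (\<Union>u\<in>avoiding D n J. F u ` X)"
proof (induction J)
  case (Suc J)
  define R where "R j = (\<Union>u\<in>avoiding D n j. \<Union>w\<in>D. F (u @ w) ` X)" for j
  define T where "T j = (\<Union>u\<in>avoiding D n j. F u ` X)" for j
  have step: "F u ` X \<subseteq> (\<Union>w\<in>D. F (u @ w) ` X) \<union> (\<Union>v\<in>avoiding D n (Suc J). F v ` X)"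
    if u: "u \<in> avoiding D n J" for u
  proof
    fix y assume "y \<in> F u ` X"
    then obtain x where "x \<in> X" "y = F u x" by blast
    moreover then obtain w where "length w = n" "x \<in> F w ` X" using X_words[of n] by blast
    ultimately obtain w where w: "length w = n" "y \<in> F u ` F w ` X" by blast
    then have y: "y \<in> F (u @ w) ` X" by (simp add: map_word_append image_comp)
    show "y \<in> (\<Union>w\<in>D. F (u @ w) ` X) \<union> (\<Union>v\<in>avoiding D n (Suc J). F v ` X)"
    proof (cases "w \<in> D")
      case False
      then have "u @ w \<in> avoiding D n (Suc J)" using u w(1) by force
      then show ?thesis using y by blast
    qed (use y in blast)
  qed
  have "T J \<subseteq> R J \<union> T (Suc J)"
    unfolding T_def[of J]
  proof (rule UN_least)
    fix u assume u: "u \<in> avoiding D n J"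
    have "(\<Union>w\<in>D. F (u @ w) ` X) \<subseteq> R J" unfolding R_def using u by (rule UN_upper)
    then show "F u ` X \<subseteq> R J \<union> T (Suc J)"
      unfolding T_def using step[OF u] Un_mono[OF _ order_refl] by (meson order_trans)
  qed
  moreover have "(\<Union>j<Suc J. R j) = (\<Union>j<J. R j) \<union> R J" by (auto simp: lessThan_Suc)
  moreover have "X \<subseteq> (\<Union>j<J. R j) \<union> T J" using Suc unfolding R_def T_def .
  ultimately have "X \<subseteq> (\<Union>j<Suc J. R j) \<union> T (Suc J)" by auto
  then show ?case unfolding R_def T_def .
qed simp

end
end


section \<open>Slices and measures of balls\<close>

text \<open>With N the norm and d the determinant of a matrix, the left side is width times
  thickness to the power s-1 for the image of a disc of radius \<rho>; the last bracket on the right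
  is \<open>phi\<close>.\<close>

lemma phi_split:
  fixes a c \<rho> N d s :: real
  assumes "0 < a" "0 < c" "0 < N" "0 < \<rho>"
  shows "a * (\<rho> * N) * (a * (\<rho> * (\<bar>d\<bar> / (c * N)))) powr (s - 1)
    = a powr s * c powr (1 - s) * \<rho> powr s * (N powr (2 - s) * \<bar>d\<bar> powr (s - 1))"
proof -
  have "x * x powr (s - 1) = x powr s" if "0 < x" for x :: real
    using powr_add[of x 1 "s - 1"] that by simp
  moreover have "N * inverse (N powr (s - 1)) = N powr (2 - s)"
    using assms powr_add[of N 1 "1 - s"] powr_minus[of N "s - 1"] by simp
  moreover have "inverse (c powr (s - 1)) = c powr (1 - s)"
    using powr_minus[of c "s - 1"] by simp
  moreover have "a * (\<rho> * N) * (a * (\<rho> * (\<bar>d\<bar> / (c * N)))) powr (s - 1) =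
     (a * a powr (s - 1)) * (\<rho> * \<rho> powr (s - 1)) * (N * inverse (N powr (s - 1))) * inverse (c powr (s - 1)) * \<bar>d\<bar> powr (s - 1)"
    using assms by (simp add: powr_mult powr_divide field_simps)
  ultimately show ?thesis using assms by simp
qed

context self_affine begin

lemma F_strip:
  assumes e: "norm e = 1" and p: "p \<in> cball z \<rho>"
  shows "\<bar>F u p \<bullet> e - F u z \<bullet> e\<bar> \<le> norm (mat_word A u) * \<rho>"
proof -
  have "\<bar>F u p \<bullet> e - F u z \<bullet> e\<bar> = \<bar>(mat_word A u *v (p - z)) \<bullet> e\<bar>"
    by (simp add: F_diff[symmetric] inner_diff_left)
  also have "\<dots> \<le> norm (mat_word A u *v (p - z))"
    using Cauchy_Schwarz_ineq2[of "mat_word A u *v (p - z)" e] e by simp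
  also have "\<dots> \<le> norm (mat_word A u) * norm (p - z)" by (rule norm_matvec2_le)
  also have "\<dots> \<le> norm (mat_word A u) * \<rho>"
    using p by (intro mult_left_mono) (auto simp: dist_norm norm_minus_commute)
  finally show ?thesis .
qed

text \<open>The inner product condition puts \<open>p - q\<close> on the line orthogonal to \<open>transpose M *v e\<close>,
  which \<open>M\<close> contracts by \<open>det M\<close> over the length of \<open>transpose M *v e\<close>.\<close>

lemma F_thin:
  assumes c0: "c0 > 0" "c0 * norm (mat_word A u) \<le> norm (transpose (mat_word A u) *v e)"
    and e: "norm e = 1" and eq: "F u p \<bullet> e = F u q \<bullet> e"
  shows "dist (F u p) (F u q) \<le> dist p q * (\<bar>det (mat_word A u)\<bar> / (c0 * norm (mat_word A u)))"
proof -
  define M where "M = mat_word A u"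
  have N: "0 < norm M" using norm_pos_of_det det_mat_word by (simp add: M_def)
  define y where "y = transpose M *v e"
  have y: "c0 * norm M \<le> norm y" "0 < norm y"
    using c0 mult_pos_pos[OF c0(1) N] by (simp_all only: y_def M_def less_le_trans)
  define f where "f = (1 / norm y) *\<^sub>R y"
  have f: "norm f = 1" using y by (simp add: f_def)
  have "(p - q) \<bullet> y = (M *v (p - q)) \<bullet> e" by (simp add: y_def inner_matvec_left)
  also have "\<dots> = 0" using eq by (simp add: M_def F_diff[symmetric] inner_diff_left)
  finally have "(p - q) \<bullet> f = 0" by (simp add: f_def)
  then have pq: "p - q = ((p - q) \<bullet> rot f) *\<^sub>R rot f" using frame_decomp[OF f, of "p - q"] by simp
  have "M *v rot f = (det M / norm y) *\<^sub>R rot e"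
    using matvec_rot_transpose[of M e] by (simp add: f_def y_def[symmetric] matrix_vector_mult_scaleR)
  then have nf: "norm (M *v rot f) = \<bar>det M\<bar> / norm y" using e by simp
  have "dist (F u p) (F u q) = norm (M *v (p - q))" by (simp add: dist_norm F_diff M_def)
  also have "\<dots> = \<bar>(p - q) \<bullet> rot f\<bar> * (\<bar>det M\<bar> / norm y)"
    by (subst pq) (simp add: matrix_vector_mult_scaleR nf)
  also have "\<bar>(p - q) \<bullet> rot f\<bar> = dist p q"
    using arg_cong[OF pq, of norm] f by (simp add: dist_norm)
  also have "dist p q * (\<bar>det M\<bar> / norm y) \<le> dist p q * (\<bar>det M\<bar> / (c0 * norm M))"
    using y c0 N by (intro mult_left_mono divide_left_mono) auto
  finally show ?thesis by (simp add: M_def)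
qed

end

context gibbs begin

text \<open>For every w in D the piece of \<open>u @ w\<close> lies in the image of one and the same
  ball under \<open>F u\<close>, so the sum runs over u alone with weight \<open>m u\<close>. The
  image projects to an interval of length about the norm of the matrix, and its slices have length
  about |det| / norm because e is in the cone.\<close>

lemma slice_integral_hit:
  obtains k where "0 < k" "\<And>e D n x \<rho> J. e \<in> dir_cone C \<Longrightarrow> norm e = 1 \<Longrightarrow>
    (\<And>w. w \<in> D \<Longrightarrow> length w = n) \<Longrightarrow> (\<And>w. w \<in> D \<Longrightarrow> F w ` X \<subseteq> cball x \<rho>) \<Longrightarrow> 0 < \<rho> \<Longrightarrow>
    slice_integral (s - 1) X (span {e}) \<le>
      ennreal (k * \<rho> powr s * (\<Sum>j<J. \<Sum>u\<in>avoiding D n j. m u) + k * (\<Sum>u\<in>avoiding D n J. m u))"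
proof -
  obtain c0 where c0: "c0 > 0" "\<And>w v. v \<in> dir_cone C \<Longrightarrow>
    c0 * norm (mat_word A w) * norm v \<le> norm (transpose (mat_word A w) *v v)"
    by (rule cone_norm_lower) metis
  obtain R where R: "0 < R" "X \<subseteq> cball 0 R"
    using compact_imp_bounded[OF compact_X] by (auto simp: bounded_pos subset_iff)
  define k1 where "k1 = 2 powr s * c0 powr (1 - s) * b"
  have k1: "0 < k1" using c0 b by (simp add: k1_def)
  \<comment> \<open>Dominates both \<open>k1\<close>, the factor for the given ball, and
    \<open>k1 * R powr s\<close>, the factor for the remainder.\<close>
  define k where "k = k1 * (1 + R powr s)"
  have k: "0 < k" "k1 \<le> k" "k1 * R powr s \<le> k" using k1 R by (simp_all add: k_def add_pos_pos distrib_left)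
  show thesis
  proof (rule that[OF k(1)])
    fix e :: "real^2" and D and n J :: nat and x :: "real^2" and \<rho> :: real
    assume e: "e \<in> dir_cone C" "norm e = 1" and D: "\<And>w. w \<in> D \<Longrightarrow> length w = n"
      and Dx: "\<And>w. w \<in> D \<Longrightarrow> F w ` X \<subseteq> cball x \<rho>" and \<rho>: "0 < \<rho>"
    define I where "I = (SIGMA j:{..J}. avoiding D n j)"
    \<comment> \<open>Level J is the remainder; there the disc of radius R about 0, which contains
      X, replaces the given ball.\<close>
    define z where "z j = (if j < J then x else 0)" for j
    define r where "r j = (if j < J then \<rho> else R)" for j
    have r0: "0 < r j" for j using \<rho> R by (simp add: r_def)
    define P where "P = (\<lambda>(j, u). F u ` cball (z j) (r j))"
    define N where "N u = norm (mat_word A u)" for u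
    define d where "d u = det (mat_word A u)" for u
    define l where "l = (\<lambda>(j, u). 2 * (r j * N u))"
    define h where "h = (\<lambda>(j, u). 2 * (r j * (\<bar>d u\<bar> / (c0 * N u))))"
    define a where "a = (\<lambda>(j, u). F u (z j) \<bullet> e - r j * N u)"
    have N0: "0 < N u" for u using norm_pos_of_det det_mat_word by (simp add: N_def)
    have cov: "X \<subseteq> (\<Union>i\<in>I. P i)"
    proof
      fix y assume "y \<in> X"
      then consider j u w where "j < J" "u \<in> avoiding D n j" "w \<in> D" "y \<in> F (u @ w) ` X"
        | u where "u \<in> avoiding D n J" "y \<in> F u ` X"
        using subsetD[OF avoiding_cover[OF D, where J = J] \<open>y \<in> X\<close>] by blast
      then show "y \<in> (\<Union>i\<in>I. P i)"
      proof cases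
        case 1
        then have "y \<in> F u ` cball x \<rho>" using Dx[OF 1(3)] by (auto simp: map_word_append)
        then have "y \<in> P (j, u)" "(j, u) \<in> I" using 1 by (auto simp: P_def I_def z_def r_def)
        then show ?thesis by blast
      next
        case 2
        then have "y \<in> P (J, u)" "(J, u) \<in> I" using R by (auto simp: P_def I_def z_def r_def)
        then show ?thesis by blast
      qed
    qed
    have "slice_integral (s - 1) X (span {e}) \<le> ennreal (\<Sum>i\<in>I. l i * h i powr (s - 1))"
    proof (rule slice_integral_cover[OF e(2) _ cov])
      show "finite I" by (simp add: I_def)
      fix i assume "i \<in> I"
      obtain j u where i: "i = (j, u)" by (cases i)
      show "0 \<le> l i \<and> 0 \<le> h i" using N0[of u] r0[of j] c0 by (simp add: l_def h_def i)
      fix p assume p: "p \<in> P i"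
      then obtain p' where p': "p' \<in> cball (z j) (r j)" "p = F u p'" by (auto simp: P_def i)
      show "a i \<le> p \<bullet> e \<and> p \<bullet> e \<le> a i + l i"
        using F_strip[OF e(2) p'(1), of u] by (simp add: a_def l_def i p' N_def abs_le_iff algebra_simps)
      fix q assume q: "q \<in> P i" and eq: "p \<bullet> e = q \<bullet> e"
      then obtain q' where q': "q' \<in> cball (z j) (r j)" "q = F u q'" by (auto simp: P_def i)
      have "dist p' q' \<le> 2 * r j"
        using p' q' dist_triangle2[of p' q' "z j"] by (simp add: dist_commute)
      moreover have "dist p q \<le> dist p' q' * (\<bar>d u\<bar> / (c0 * N u))"
        using F_thin[OF c0(1) _ e(2), of u p' q'] c0(2)[OF e(1), of u] e(2) eq p' q' by (simp add: d_def N_def)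
      moreover have "dist p' q' * (\<bar>d u\<bar> / (c0 * N u)) \<le> (2 * r j) * (\<bar>d u\<bar> / (c0 * N u))"
        using calculation(1) c0 N0[of u] by (intro mult_right_mono) auto
      ultimately show "dist p q \<le> h i" by (simp add: h_def i)
    qed (use s in simp)
    also have "(\<Sum>i\<in>I. l i * h i powr (s - 1)) \<le> (\<Sum>(j, u)\<in>I. k1 * r j powr s * m u)"
    proof (rule sum_mono)
      fix i assume "i \<in> I"
      obtain j u where i: "i = (j, u)" by (cases i)
      have "l i * h i powr (s - 1) = 2 powr s * c0 powr (1 - s) * r j powr s * phi s (mat_word A u)"
        using phi_split[of 2 c0 "N u" "r j" "d u" s] c0 N0 r0 by (simp add: l_def h_def i phi_def N_def d_def)
      also have "\<dots> \<le> 2 powr s * c0 powr (1 - s) * r j powr s * (b * m u)"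
        by (intro mult_left_mono m_lower) auto
      finally show "l i * h i powr (s - 1) \<le> (case i of (j, u) \<Rightarrow> k1 * r j powr s * m u)"
        by (simp add: i k1_def mult_ac)
    qed
    also have "(\<Sum>(j, u)\<in>I. k1 * r j powr s * m u) = (\<Sum>j\<le>J. \<Sum>u\<in>avoiding D n j. k1 * r j powr s * m u)"
      unfolding I_def by (rule sum.Sigma[symmetric]) auto
    also have "\<dots> = k1 * \<rho> powr s * (\<Sum>j<J. \<Sum>u\<in>avoiding D n j. m u) + k1 * R powr s * (\<Sum>u\<in>avoiding D n J. m u)"
      by (simp add: lessThan_Suc_atMost[symmetric] r_def sum_distrib_left)
    also have "\<dots> \<le> k * \<rho> powr s * (\<Sum>j<J. \<Sum>u\<in>avoiding D n j. m u) + k * (\<Sum>u\<in>avoiding D n J. m u)"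
      using k m_pos by (intro add_mono mult_right_mono sum_nonneg) (auto simp: less_imp_le)
    finally show "slice_integral (s - 1) X (span {e}) \<le>
      ennreal (k * \<rho> powr s * (\<Sum>j<J. \<Sum>u\<in>avoiding D n j. m u) + k * (\<Sum>u\<in>avoiding D n J. m u))"
      by (simp add: ennreal_leI)
  qed
qed

text \<open>As J grows the remainder vanishes, so the value of the slice integral is at most k
  \<rho>^s / (c m(D)). Solving for m(D) gives the bound.\<close>

lemma slice_positive_imp_mass_bound:
  assumes V: "V \<in> C" "slice_integral (s - 1) X V > 0"
  obtains K where "0 < K" "\<And>D n x \<rho>. (\<And>w. w \<in> D \<Longrightarrow> length w = n) \<Longrightarrow>
    (\<And>w. w \<in> D \<Longrightarrow> F w ` X \<subseteq> cball x \<rho>) \<Longrightarrow> 0 < \<rho> \<Longrightarrow> (\<Sum>w\<in>D. m w) \<le> K * \<rho> powr s"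
proof -
  obtain e where e: "norm e = 1" "V = span {e}" using RP1_unit V(1) C_RP1(1) by blast
  have ec: "e \<in> dir_cone C" using V e by (auto simp: dir_cone_def)
  obtain k where k: "0 < k" "\<And>e D n x \<rho> J. e \<in> dir_cone C \<Longrightarrow> norm e = 1 \<Longrightarrow>
    (\<And>w. w \<in> D \<Longrightarrow> length w = n) \<Longrightarrow> (\<And>w. w \<in> D \<Longrightarrow> F w ` X \<subseteq> cball x \<rho>) \<Longrightarrow> 0 < \<rho> \<Longrightarrow>
    slice_integral (s - 1) X (span {e}) \<le>
      ennreal (k * \<rho> powr s * (\<Sum>j<J. \<Sum>u\<in>avoiding D n j. m u) + k * (\<Sum>u\<in>avoiding D n J. m u))"
    by (rule slice_integral_hit) blast
  obtain c where c: "0 < c" "\<And>u w. c * m u * m w \<le> m (u @ w)" by (rule m_quasi_mult) metis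
  define \<sigma> where "\<sigma> = enn2real (slice_integral (s - 1) X V)"
  \<comment> \<open>Empty D and J = 0 leave a single disc containing X, so the integral is finite
    and can be treated as a real number.\<close>
  have "slice_integral (s - 1) X V < top"
    using k(2)[OF ec e(1), of "{}" 0 0 1 0] e(2) by (auto simp: less_top[symmetric] top_unique)
  then have \<sigma>: "ennreal \<sigma> = slice_integral (s - 1) X V" by (simp add: \<sigma>_def)
  then have \<sigma>0: "0 < \<sigma>" using V(2) by (metis ennreal_less_zero_iff)
  show thesis
  proof (rule that[of "k / (c * \<sigma>)"])
    show "0 < k / (c * \<sigma>)" using k c \<sigma>0 by simp
    fix D n x and \<rho> :: real
    assume D: "\<And>w. w \<in> D \<Longrightarrow> length w = n" and Dx: "\<And>w. w \<in> D \<Longrightarrow> F w ` X \<subseteq> cball x \<rho>" and \<rho>: "0 < \<rho>"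
    show "(\<Sum>w\<in>D. m w) \<le> k / (c * \<sigma>) * \<rho> powr s"
    proof (cases "D = {}")
      case True
      then show ?thesis using k c \<sigma>0 by simp
    next
      case False
      define p where "p = c * (\<Sum>w\<in>D. m w)"
      have p: "0 < p" unfolding p_def using False finite_D[OF D] m_pos c by (intro mult_pos_pos sum_pos) auto
      have "\<sigma> \<le> k * \<rho> powr s / p + k * (\<Sum>u\<in>avoiding D n J. m u)" for J
      proof -
        let ?S = "\<Sum>j<J. \<Sum>u\<in>avoiding D n j. m u"
        have "?S \<le> 1 / p"
          using avoiding_sum_le[OF D c, where J = J] p by (simp add: p_def field_simps)
        then have "k * \<rho> powr s * ?S \<le> k * \<rho> powr s * (1 / p)"
          using k by (intro mult_left_mono) auto
        moreover have "\<sigma> \<le> k * \<rho> powr s * ?S + k * (\<Sum>u\<in>avoiding D n J. m u)"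
        proof -
          have "ennreal \<sigma> \<le> ennreal (k * \<rho> powr s * ?S + k * (\<Sum>u\<in>avoiding D n J. m u))"
            using k(2)[OF ec e(1) D Dx \<rho>, where J = J] e(2) \<sigma> by simp
          moreover have "0 \<le> k * \<rho> powr s * ?S + k * (\<Sum>u\<in>avoiding D n J. m u)"
            using k m_pos by (intro add_nonneg_nonneg mult_nonneg_nonneg sum_nonneg) (auto simp: less_imp_le)
          ultimately show ?thesis by (simp add: ennreal_le_iff)
        qed
        ultimately show ?thesis by simp
      qed
      moreover have "(\<lambda>J. k * \<rho> powr s / p + k * (\<Sum>u\<in>avoiding D n J. m u)) \<longlonglongrightarrow> k * \<rho> powr s / p + k * 0"
        by (intro tendsto_intros avoiding_null[OF D False])
      ultimately have "\<sigma> \<le> k * \<rho> powr s / p + k * 0"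
        by (intro tendsto_lowerbound[OF _ always_eventually]) auto
      then have "\<sigma> * p \<le> k * \<rho> powr s" using p by (simp add: field_simps)
      then show ?thesis using c \<sigma>0 by (simp add: p_def field_simps)
    qed
  qed
qed

text \<open>Once the pieces have diameter below r, those that meet the ball lie in the ball of twice
  the radius, whence the factor \<open>2 powr s\<close>.\<close>

lemma slice_positive_imp_ball_bound:
  assumes \<mu>: "sets \<mu> = sets word_borel" "emeasure \<mu> UNIV = 1" "\<And>w. m w = measure \<mu> (cylinder w)"
    and V: "V \<in> C" "slice_integral (s - 1) X V > 0"
  shows "\<exists>K>0. \<forall>x\<in>X. \<forall>r>0. measure (distr \<mu> borel \<pi>) (cball x r) \<le> K * r powr s"
proof -
  obtain K where K: "0 < K" "\<And>D n x \<rho>. (\<And>w. w \<in> D \<Longrightarrow> length w = n) \<Longrightarrow>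
    (\<And>w. w \<in> D \<Longrightarrow> F w ` X \<subseteq> cball x \<rho>) \<Longrightarrow> 0 < \<rho> \<Longrightarrow> (\<Sum>w\<in>D. m w) \<le> K * \<rho> powr s"
    by (rule slice_positive_imp_mass_bound[OF V]) metis
  have sp: "space \<mu> = UNIV" using sets_eq_imp_space_eq[OF \<mu>(1)] space_word_borel by simp
  interpret finite_measure \<mu> by standard (simp add: sp \<mu>(2))
  have "measure (distr \<mu> borel \<pi>) (cball x r) \<le> (K * 2 powr s) * r powr s" if r: "0 < r" for x r
  proof -
    obtain n where n: "\<And>(w :: 'a list) x y. n \<le> length w \<Longrightarrow> x \<in> X \<Longrightarrow> y \<in> X \<Longrightarrow> dist (F w x) (F w y) < r"
      using F_dist_null[OF r compact_imp_bounded[OF compact_X]] by metis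
    define D where "D = {w. length w = n \<and> F w ` X \<inter> cball x r \<noteq> {}}"
    have finD: "finite D" by (rule finite_subset[OF _ finite_words[of n]]) (auto simp: D_def)
    have "F w ` X \<subseteq> cball x (2 * r)" if "w \<in> D" for w
    proof -
      have "F w ` X \<inter> cball x r \<noteq> {}" and w: "length w = n" using that by (simp_all add: D_def)
      then obtain z where z: "z \<in> X" "dist x (F w z) \<le> r" by auto
      have "dist x (F w y) \<le> 2 * r" if "y \<in> X" for y
        using n[of w z y] w z that dist_triangle[of x "F w y" "F w z"] by simp
      then show ?thesis by auto
    qed
    then have sum: "(\<Sum>w\<in>D. m w) \<le> K * (2 * r) powr s"
      using r by (intro K(2)[of D n]) (auto simp: D_def)
    have "measure (distr \<mu> borel \<pi>) (cball x r) = measure \<mu> (\<pi> -` cball x r)"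
      by (subst measure_distr[OF natural_proj_measurable[OF \<mu>(1)]]) (simp_all add: sp)
    also have "\<dots> \<le> measure \<mu> (\<Union>w\<in>D. cylinder w)"
    proof (rule finite_measure_mono)
      show "\<pi> -` cball x r \<subseteq> (\<Union>w\<in>D. cylinder w)"
      proof
        fix \<omega> assume "\<omega> \<in> \<pi> -` cball x r"
        then have "prefix_word \<omega> n \<in> D" using natural_proj(2)[of \<omega> n] by (auto simp: D_def)
        moreover have "\<omega> \<in> cylinder (prefix_word \<omega> n)" by (simp add: cylinder_def)
        ultimately show "\<omega> \<in> (\<Union>w\<in>D. cylinder w)" by blast
      qed
      show "(\<Union>w\<in>D. cylinder w) \<in> sets \<mu>" using finD cylinder_sets \<mu>(1) by (metis (no_types, lifting) sets.finite_UN)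
    qed
    also have "\<dots> \<le> (\<Sum>w\<in>D. measure \<mu> (cylinder w))"
      using finD cylinder_sets \<mu>(1) by (intro finite_measure_subadditive_finite) auto
    also have "\<dots> \<le> K * (2 * r) powr s" using sum \<mu>(3) by simp
    finally show ?thesis using r by (simp add: powr_mult mult.assoc)
  qed
  then show ?thesis using K(1) by (intro exI[of _ "K * 2 powr s"]) auto
qed

end

section \<open>Mass distribution principle\<close>

context self_affine begin

lemma ball_bound_imp_hausdorff_pos:
  assumes \<mu>: "sets \<mu> = sets word_borel" "emeasure \<mu> UNIV = 1"
    and K: "K > 0" "\<And>x r. x \<in> X \<Longrightarrow> 0 < r \<Longrightarrow> measure (distr \<mu> borel \<pi>) (cball x r) \<le> K * r powr s"
  shows "hausdorff_measure s X > 0"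
proof -
  define \<nu> where "\<nu> = distr \<mu> borel \<pi>"
  have sp: "space \<mu> = UNIV" using sets_eq_imp_space_eq[OF \<mu>(1)] space_word_borel by simp
  interpret finite_measure \<mu> by standard (simp add: sp \<mu>(2))
  have m: "\<pi> \<in> \<mu> \<rightarrow>\<^sub>M borel" by (rule natural_proj_measurable[OF \<mu>(1)])
  interpret N: finite_measure \<nu> unfolding \<nu>_def by (rule finite_measure_distr[OF m])
  have "\<pi> \<omega> \<in> X" for \<omega> using natural_proj(2)[of \<omega> 0] by (simp add: prefix_word_def)
  then have "\<pi> -` X = UNIV" by auto
  then have one: "emeasure \<nu> X = 1"
    unfolding \<nu>_def using compact_X
    by (subst emeasure_distr[OF m]) (auto simp: sp \<mu>(2) intro: borel_compact)
  have ball: "emeasure \<nu> (cball x d) \<le> ennreal (K * d powr s)" if x: "x \<in> X" and d: "0 \<le> d" for x d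
  proof (cases "d = 0")
    case False
    then show ?thesis using K(2)[OF x, of d] d by (simp add: N.emeasure_eq_measure \<nu>_def[symmetric] ennreal_leI)
  next
    \<comment> \<open>A covering set may be a single point and lead to radius 0, which the
      hypothesis does not reach. Letting r tend to 0 shows that such a ball has no mass.\<close>
    case True
    have "measure \<nu> (cball x 0) \<le> K * r powr s" if r: "0 < r" for r
    proof -
      have "measure \<nu> (cball x 0) \<le> measure \<nu> (cball x r)"
        using r by (intro N.finite_measure_mono) (auto simp: \<nu>_def)
      then show ?thesis using K(2)[OF x r] by (simp add: \<nu>_def)
    qed
    then have "\<forall>\<^sub>F r in at_right 0. measure \<nu> (cball x 0) \<le> K * r powr s"
      by (auto simp: eventually_at_right_field intro!: exI[of _ 1])
    moreover have "((\<lambda>r. K * r powr s) \<longlongrightarrow> K * 0 powr s) (at_right 0)"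
      using s by (intro tendsto_intros tendsto_powr') (auto intro!: eventually_at_rightI[of 0 1])
    ultimately have "measure \<nu> (cball x 0) \<le> K * 0 powr s"
      by (intro tendsto_lowerbound) auto
    then have "measure \<nu> (cball x 0) \<le> K * d powr s" using True by simp
    then show ?thesis unfolding N.emeasure_eq_measure True by (rule ennreal_leI)
  qed
  have "ennreal (1 / K) \<le> hausdorff_pre s 1 X"
    unfolding hausdorff_pre_def
  proof (rule INF_greatest)
    fix U :: "nat \<Rightarrow> (real^2) set"
    assume "U \<in> {U. X \<subseteq> (\<Union>i. U i) \<and> (\<forall>i. bounded (U i) \<and> diameter (U i) < 1)}"
    then have U: "X \<subseteq> (\<Union>i. U i)" "\<And>i. bounded (U i)" by auto
    \<comment> \<open>A covering set may fail to be measurable; it is replaced by a ball that is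
      centred in X and contains its part in X.\<close>
    define B where "B i = (if U i \<inter> X = {} then {} else cball (SOME x. x \<in> U i \<inter> X) (diameter (U i)))" for i
    have B: "U i \<inter> X \<subseteq> B i" "emeasure \<nu> (B i) \<le> ennreal (K * diameter (U i) powr s)" "B i \<in> sets borel" for i
    proof -
      consider "U i \<inter> X = {}" | x where "x \<in> U i \<inter> X" "B i = cball x (diameter (U i))"
      proof (cases "U i \<inter> X = {}")
        case False
        then have "B i = cball (SOME x. x \<in> U i \<inter> X) (diameter (U i))" unfolding B_def by (rule if_not_P)
        moreover have "(SOME x. x \<in> U i \<inter> X) \<in> U i \<inter> X" using False some_in_eq by metis
        ultimately show ?thesis using that(2) by blast
      qed (rule that(1))
      then have "U i \<inter> X \<subseteq> B i \<and> emeasure \<nu> (B i) \<le> ennreal (K * diameter (U i) powr s) \<and> B i \<in> sets borel"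
      proof cases
        case 2
        then show ?thesis using ball[of x "diameter (U i)"] diameter_ge_0[OF U(2)[of i]] diameter_bounded_bound[OF U(2)[of i]]
          by auto
      qed (simp add: B_def)
      then show "U i \<inter> X \<subseteq> B i" "emeasure \<nu> (B i) \<le> ennreal (K * diameter (U i) powr s)" "B i \<in> sets borel" by auto
    qed
    have "1 \<le> emeasure \<nu> (\<Union>i. B i)"
      unfolding one[symmetric]
    proof (rule emeasure_mono)
      show "X \<subseteq> (\<Union>i. B i)" using U(1) B(1) by blast
      show "(\<Union>i. B i) \<in> sets \<nu>" using B(3) by (auto simp: \<nu>_def)
    qed
    also have "\<dots> \<le> (\<Sum>i. emeasure \<nu> (B i))"
      using B(3) by (intro emeasure_subadditive_countably) (auto simp: \<nu>_def)
    also have "\<dots> \<le> (\<Sum>i. ennreal (K * diameter (U i) powr s))"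
      using B(2) by (intro suminf_le) auto
    also have "\<dots> = ennreal K * (\<Sum>i. ennreal (diameter (U i) powr s))"
      using K(1) by (simp add: ennreal_mult)
    finally have "ennreal (1 / K) * 1 \<le> ennreal (1 / K) * (ennreal K * (\<Sum>i. ennreal (diameter (U i) powr s)))"
      by (rule mult_left_mono) simp
    then show "ennreal (1 / K) \<le> (\<Sum>i. ennreal (diameter (U i) powr s))"
      using K(1) by (simp add: mult.assoc[symmetric] ennreal_mult[symmetric])
  qed
  also have "\<dots> \<le> hausdorff_measure s X"
    unfolding hausdorff_measure_eq_SUP by (intro SUP_upper) simp
  finally show ?thesis using K(1) by (metis ennreal_less_zero_iff less_le_trans zero_less_divide_1_iff)
qed

end


section \<open>Rectangles from slices\<close>

lemma hausdorff_content_image_le: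
  fixes f :: "'b::metric_space \<Rightarrow> 'c::metric_space"
  assumes f: "\<And>x y. dist (f x) (f y) \<le> dist x y" and u: "0 \<le> u"
  shows "hausdorff_content u (f ` S) \<le> hausdorff_content u S"
  unfolding hausdorff_content_def[of u S]
proof (rule INF_greatest)
  fix U :: "nat \<Rightarrow> 'b set"
  assume "U \<in> {U. S \<subseteq> (\<Union>i. U i) \<and> (\<forall>i. bounded (U i))}"
  then have U: "S \<subseteq> (\<Union>i. U i)" "\<And>i. bounded (U i)" by auto
  have V: "bounded (f ` U i)" "diameter (f ` U i) \<le> diameter (U i)" for i
  proof -
    have "dist x y \<le> diameter (U i)" if "x \<in> f ` U i" "y \<in> f ` U i" for x y
      using that diameter_bounded_bound[OF U(2)[of i]] by (auto intro!: order_trans[OF f])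
    then show "bounded (f ` U i)" "diameter (f ` U i) \<le> diameter (U i)"
      using diameter_le_bound[of "f ` U i"] diameter_ge_0[OF U(2)[of i]] by auto
  qed
  have "f ` S \<subseteq> (\<Union>i. f ` U i)" using U(1) by blast
  then have "hausdorff_content u (f ` S) \<le> (\<Sum>i. ennreal (diameter (f ` U i) powr u))"
    unfolding hausdorff_content_def using V by (intro INF_lower) simp
  also have "\<dots> \<le> (\<Sum>i. ennreal (diameter (U i) powr u))"
    using V u by (intro suminf_le ennreal_leI powr_mono2 diameter_ge_0) auto
  finally show "hausdorff_content u (f ` S) \<le> (\<Sum>i. ennreal (diameter (U i) powr u))" .
qed

text \<open>The intervals must be open for later compactness arguments. The powers of their lengths
  exceed those of the diameters by positive amounts with total \<eta>, half of the available gap, so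
  even single points get an interval of positive length.\<close>

lemma content_open_intervals:
  fixes P :: "real set"
  assumes u: "0 < u" and less: "hausdorff_content u P < ennreal \<kappa>"
  obtains c h :: "nat \<Rightarrow> real" where "\<And>i. 0 < h i" "P \<subseteq> (\<Union>i. {c i<..<c i + h i})"
    "(\<Sum>i. ennreal (h i powr u)) < ennreal \<kappa>"
proof -
  obtain U where U: "P \<subseteq> (\<Union>i. U i)" "\<And>i. bounded (U i)" and sU: "(\<Sum>i. ennreal (diameter (U i) powr u)) < ennreal \<kappa>"
    using less unfolding hausdorff_content_def by (auto simp: INF_less_iff)
  define \<sigma> where "\<sigma> = enn2real (\<Sum>i. ennreal (diameter (U i) powr u))"
  have \<sigma>: "ennreal \<sigma> = (\<Sum>i. ennreal (diameter (U i) powr u))"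
    using less_trans[OF sU ennreal_less_top] by (simp add: \<sigma>_def)
  have "0 \<le> \<sigma>" by (simp add: \<sigma>_def)
  then have lt: "\<sigma> < \<kappa>" using sU unfolding \<sigma>[symmetric] by (simp add: ennreal_less_iff)
  define \<eta> where "\<eta> = (\<kappa> - \<sigma>) / 2"
  have \<eta>: "0 < \<eta>" "\<sigma> + \<eta> < \<kappa>" using lt by (simp_all add: \<eta>_def field_simps)
  define d where "d i = diameter (U i)" for i
  have d0: "0 \<le> d i" for i using diameter_ge_0[OF U(2)] by (simp add: d_def)
  define h where "h i = (d i powr u + \<eta> * (1/2) ^ Suc i) powr (1 / u)" for i
  have pos: "0 < \<eta> * (1/2) ^ Suc i" for i using \<eta> by simp
  have hu: "h i powr u = d i powr u + \<eta> * (1/2) ^ Suc i" for i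
    using u pos[of i] by (simp add: h_def powr_powr add_nonneg_nonneg less_imp_le)
  have hd: "d i < h i" for i
  proof -
    have "(d i powr u) powr (1 / u) < h i"
      unfolding h_def using pos[of i] u by (intro powr_less_mono2) auto
    then show ?thesis using u d0[of i] by (simp add: powr_powr)
  qed
  \<comment> \<open>Leaves a margin of half the excess length on either side of [Inf, Inf + d],
    which contains the covering set.\<close>
  define c where "c i = Inf (U i) - (h i - d i) / 2" for i
  show thesis
  proof (rule that)
    show "0 < h i" for i using hd[of i] d0[of i] by simp
    show "P \<subseteq> (\<Union>i. {c i<..<c i + h i})"
    proof
      fix x assume "x \<in> P"
      then obtain i where i: "x \<in> U i" using U(1) by blast
      have "Inf (U i) \<le> x" using i U(2)[of i] by (intro cInf_lower bounded_imp_bdd_below)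
      moreover have "x - d i \<le> Inf (U i)"
      proof (rule cInf_greatest)
        fix y assume "y \<in> U i"
        then show "x - d i \<le> y" using diameter_bounded_bound[OF U(2)[of i] i, of y] by (simp add: d_def dist_real_def)
      qed (use i in auto)
      ultimately have "x \<in> {c i<..<c i + h i}" using hd[of i] by (auto simp: c_def field_simps)
      then show "x \<in> (\<Union>i. {c i<..<c i + h i})" by blast
    qed
    have "(\<Sum>i. ennreal (h i powr u)) = (\<Sum>i. ennreal (d i powr u) + ennreal (\<eta> * (1/2) ^ Suc i))"
      unfolding hu using pos by (intro suminf_cong ennreal_plus) (auto simp: less_imp_le)
    also have "\<dots> = (\<Sum>i. ennreal (d i powr u)) + (\<Sum>i. ennreal (\<eta> * (1/2) ^ Suc i))"
      by (rule suminf_add[symmetric]) auto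
    also have "(\<Sum>i. ennreal (\<eta> * (1/2) ^ Suc i)) = ennreal \<eta>"
      using sums_mult[OF power_half_series, of \<eta>] pos by (intro suminf_ennreal_eq) (auto simp: less_imp_le)
    also have "(\<Sum>i. ennreal (d i powr u)) + ennreal \<eta> = ennreal (\<sigma> + \<eta>)"
      using \<open>0 \<le> \<sigma>\<close> \<eta> by (simp add: \<sigma> d_def)
    also have "\<dots> < ennreal \<kappa>"
      using \<eta> \<open>0 \<le> \<sigma>\<close> by (intro ennreal_lessI) auto
    finally show "(\<Sum>i. ennreal (h i powr u)) < ennreal \<kappa>" .
  qed
qed

lemma hausdorff_content_interval_cover:
  fixes P :: "real set"
  assumes "P \<subseteq> (\<Union>i. {c i<..<c i + h i})" "\<And>i. 0 < h i"
  shows "hausdorff_content u P \<le> (\<Sum>i. ennreal (h i powr u))"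
proof -
  have b: "bounded {c i<..<c i + h i}" "diameter {c i<..<c i + h i} = h i" for i
    using assms(2)[of i] by (simp_all)
  have "hausdorff_content u P \<le> (\<Sum>i. ennreal (diameter {c i<..<c i + h i} powr u))"
    unfolding hausdorff_content_def using assms(1) b(1) by (intro INF_lower) simp
  then show ?thesis unfolding b(2) .
qed

text \<open>The shadow, on the axis \<open>rot e\<close>, of the part of X in a dyadic strip of
  width 2^-n around slices. On the real line covers can be taken by intervals.\<close>

definition strip_part :: "(real^2) set \<Rightarrow> real^2 \<Rightarrow> nat \<Rightarrow> int \<Rightarrow> real set" where
  "strip_part X e n k = (\<lambda>x. x \<bullet> rot e) ` {x \<in> X. \<lfloor>2 ^ n * (x \<bullet> e)\<rfloor> = k}"

text \<open>Dyadic strips are nested, so their contents decrease in n as monotone convergence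
  requires.\<close>

lemma strip_part_Suc: "strip_part X e (Suc n) \<lfloor>2 ^ Suc n * t\<rfloor> \<subseteq> strip_part X e n \<lfloor>2 ^ n * t\<rfloor>"
  for t :: real
proof -
  have *: "\<lfloor>2 ^ n * a\<rfloor> = \<lfloor>2 ^ Suc n * a\<rfloor> div 2" for a :: real
    using floor_divide_real_eq_div[of 2 "2 ^ Suc n * a"] by simp
  then show ?thesis unfolding strip_part_def by (auto simp del: power_Suc)
qed

lemma hausdorff_content_mono: "S \<subseteq> T \<Longrightarrow> hausdorff_content u S \<le> hausdorff_content u T"
  unfolding hausdorff_content_def by (intro INF_superset_mono) auto

text \<open>Cover the shadow of the slice by open intervals. The points of X within 2^-n of the
  slice whose shadow misses these intervals form decreasing compact sets with empty intersection, so
  one of them is empty and the intervals cover the shadow of a whole strip.\<close>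

lemma strip_limit_le_slice:
  fixes e :: "real^2"
  assumes X: "compact X" and e: "norm e = 1" and u: "0 < u"
  shows "(INF n. hausdorff_content u (strip_part X e n \<lfloor>2 ^ n * t\<rfloor>)) \<le> hausdorff_content u (X \<inter> {y. y \<bullet> e = t})"
proof (rule ccontr)
  let ?S = "X \<inter> {y. y \<bullet> e = t}"
  assume "\<not> ?thesis"
  then obtain z where z: "hausdorff_content u ?S < z"
      "z < (INF n. hausdorff_content u (strip_part X e n \<lfloor>2 ^ n * t\<rfloor>))"
    by (meson dense not_le)
  then obtain \<kappa> where \<kappa>: "z = ennreal \<kappa>"
    by (metis ennreal_cases less_top_ennreal top_greatest leD)
  have "dist (x \<bullet> rot e) (y \<bullet> rot e) \<le> dist x y" for x y :: "real^2"
    using Cauchy_Schwarz_ineq2[of "x - y" "rot e"] e by (simp add: dist_real_def dist_norm inner_diff_left)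
  then have "hausdorff_content u ((\<lambda>x. x \<bullet> rot e) ` ?S) < ennreal \<kappa>"
    using hausdorff_content_image_le[of "\<lambda>x. x \<bullet> rot e" u ?S] u z(1) \<kappa> by (auto intro: le_less_trans)
  then obtain c h where ch: "\<And>i::nat. 0 < h i" "(\<lambda>x. x \<bullet> rot e) ` ?S \<subseteq> (\<Union>i. {c i<..<c i + h i})"
    "(\<Sum>i. ennreal (h i powr u)) < ennreal \<kappa>"
    by (rule content_open_intervals[OF u]) blast
  define W where "W = (\<Union>i. {c i<..<c i + h i})"
  have oW: "open W" by (auto simp: W_def)
  define K where "K n = X \<inter> {x. \<bar>x \<bullet> e - t\<bar> \<le> (1/2) ^ n} \<inter> {x. x \<bullet> rot e \<notin> W}" for n :: nat
  have cK: "compact (K n)" for n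
  proof -
    have "closed {x. \<bar>x \<bullet> e - t\<bar> \<le> (1/2) ^ n}" by (intro closed_Collect_le continuous_intros)
    moreover have "closed ((\<lambda>x. x \<bullet> rot e) -` (- W))"
      using oW by (intro closed_vimage continuous_intros) auto
    moreover have "(\<lambda>x. x \<bullet> rot e) -` (- W) = {x. x \<bullet> rot e \<notin> W}" by auto
    ultimately show ?thesis unfolding K_def using X by (auto intro!: compact_Int_closed)
  qed
  have anti: "K n \<subseteq> K m" if "m \<le> n" for m n
    using power_decreasing[OF that, of "1/2::real"] by (auto simp: K_def intro: order_trans)
  have "\<exists>n. K n = {}"
  proof (rule ccontr)
    assume "\<nexists>n. K n = {}"
    then have "\<Inter> (range K) \<noteq> {}" using cK anti by (intro compact_nest) auto
    then obtain x where x: "\<And>n. x \<in> K n" by blast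
    have "\<bar>x \<bullet> e - t\<bar> \<le> (1/2) ^ n" for n using x[of n] by (simp add: K_def)
    moreover have "(\<lambda>n. (1/2) ^ n :: real) \<longlonglongrightarrow> 0" by (intro LIMSEQ_power_zero) simp
    ultimately have "\<bar>x \<bullet> e - t\<bar> \<le> 0" by (intro tendsto_lowerbound[OF _ always_eventually]) auto
    then have "x \<in> ?S" using x[of 0] by (simp add: K_def)
    then have "x \<bullet> rot e \<in> W" using ch(2) unfolding W_def by blast
    then show False using x[of 0] by (simp add: K_def)
  qed
  then obtain n where n: "K n = {}" by blast
  have "strip_part X e n \<lfloor>2 ^ n * t\<rfloor> \<subseteq> W"
  proof
    fix y assume "y \<in> strip_part X e n \<lfloor>2 ^ n * t\<rfloor>"
    then obtain x where x: "x \<in> X" "\<lfloor>2 ^ n * (x \<bullet> e)\<rfloor> = \<lfloor>2 ^ n * t\<rfloor>" "y = x \<bullet> rot e"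
      by (auto simp: strip_part_def)
    have "\<bar>2 ^ n * (x \<bullet> e) - 2 ^ n * t\<bar> \<le> 1" using x(2) by linarith
    then have "2 ^ n * \<bar>x \<bullet> e - t\<bar> \<le> 1" by (simp add: right_diff_distrib[symmetric] abs_mult)
    then have "\<bar>x \<bullet> e - t\<bar> \<le> (1/2) ^ n" by (simp add: field_simps power_divide)
    then show "y \<in> W" using n x by (auto simp: K_def)
  qed
  then have "hausdorff_content u (strip_part X e n \<lfloor>2 ^ n * t\<rfloor>) \<le> (\<Sum>i. ennreal (h i powr u))"
    unfolding W_def using ch(1) u by (intro hausdorff_content_interval_cover) auto
  also have "\<dots> < z" using ch(3) \<kappa> by simp
  also have "\<dots> < hausdorff_content u (strip_part X e n \<lfloor>2 ^ n * t\<rfloor>)"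
    using z(2) by (rule less_le_trans) (rule INF_lower, simp)
  finally show False .
qed

text \<open>(a, l) is start and length along e, and (c, h) along \<open>rot e\<close>. Openness
  gives finite subcovers and stability under rotation.\<close>

definition rect :: "real^2 \<Rightarrow> real \<times> real \<times> real \<times> real \<Rightarrow> (real^2) set" where
  "rect e = (\<lambda>(a, l, c, h). {x. a < x \<bullet> e \<and> x \<bullet> e < a + l \<and> c < x \<bullet> rot e \<and> x \<bullet> rot e < c + h})"

lemma open_rect: "open (rect e q)"
proof -
  obtain a l c h where q: "q = (a, l, c, h)" by (cases q) auto
  show ?thesis unfolding q rect_def
    by (simp, intro open_Collect_conj open_Collect_less continuous_intros)
qed

text \<open>Strip contents are step functions of t, hence measurable, and their limit lies below the
  slice contents. Monotone convergence yields a level n at which their integral, bounded below by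
  the finite sum over Z, is less than \<epsilon>.\<close>

lemma slice_small_imp_strips:
  fixes e :: "real^2"
  assumes X: "compact X" and e: "norm e = 1" and u: "0 < u"
    and less: "slice_integral u X (span {e}) < ennreal \<epsilon>"
  obtains n Z c where "finite Z" "\<And>x. x \<in> X \<Longrightarrow> \<lfloor>2 ^ n * (x \<bullet> e)\<rfloor> \<in> Z"
    "\<And>k. 0 \<le> c k" "\<And>k. hausdorff_content u (strip_part X e n k) = ennreal (c k)"
    "(\<Sum>k\<in>Z. c k * (1/2) ^ n) < \<epsilon>"
proof -
  define G where "G n t = hausdorff_content u (strip_part X e n \<lfloor>2 ^ n * t\<rfloor>)" for n and t :: real
  have Gm: "G n \<in> borel_measurable lborel" for n
  proof -
    have "(\<lambda>t::real. \<lfloor>2 ^ n * t\<rfloor>) \<in> borel \<rightarrow>\<^sub>M count_space UNIV" by measurable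
    then have "(\<lambda>t::real. hausdorff_content u (strip_part X e n \<lfloor>2 ^ n * t\<rfloor>)) \<in> borel_measurable borel"
      by (rule measurable_compose) simp
    then show ?thesis by (simp add: G_def[abs_def])
  qed
  have dec: "decseq G"
    by (intro decseq_SucI le_funI) (unfold G_def, intro hausdorff_content_mono strip_part_Suc)
  obtain R where R: "0 < R" "X \<subseteq> cball 0 R"
    using compact_imp_bounded[OF X] by (auto simp: bounded_pos subset_iff)
  have xR: "\<bar>x \<bullet> e\<bar> \<le> R" "\<bar>x \<bullet> rot e\<bar> \<le> R" if "x \<in> X" for x
    using R that Cauchy_Schwarz_ineq2[of x e] Cauchy_Schwarz_ineq2[of x "rot e"] e by (auto intro: order_trans)
  define B where "B = (2 * R) powr u"
  have cB: "hausdorff_content u (strip_part X e n k) \<le> ennreal B" for n k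
  proof -
    have "bounded (strip_part X e n k)" "diameter (strip_part X e n k) \<le> 2 * R"
    proof -
      have "dist x y \<le> 2 * R" if xy: "x \<in> strip_part X e n k" "y \<in> strip_part X e n k" for x y
      proof -
        obtain p q where "p \<in> X" "x = p \<bullet> rot e" "q \<in> X" "y = q \<bullet> rot e"
          using xy by (auto simp: strip_part_def)
        then show ?thesis using xR(2)[of p] xR(2)[of q] by (simp add: dist_real_def abs_le_iff)
      qed
      then show "bounded (strip_part X e n k)" "diameter (strip_part X e n k) \<le> 2 * R"
        using diameter_le_bound[of "strip_part X e n k" "2 * R"] R by auto
    qed
    then have "hausdorff_content u (strip_part X e n k) \<le> (\<Sum>i\<in>{()}. ennreal (diameter (strip_part X e n k) powr u))"
      by (intro hausdorff_content_finite_cover) auto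
    also have "\<dots> \<le> ennreal B"
      using \<open>diameter _ \<le> _\<close> \<open>bounded _\<close> u by (auto simp: B_def intro!: ennreal_leI powr_mono2 diameter_ge_0)
    finally show ?thesis .
  qed
  \<comment> \<open>Decreasing convergence needs a finite integral to start from; level 0 is bounded
    and vanishes off a bounded interval.\<close>
  have Gfin: "(\<integral>\<^sup>+t. G 0 t \<partial>lborel) < \<infinity>"
  proof -
    have "G 0 t \<le> ennreal B * indicator {- R - 1..R + 1} t" for t
    proof (cases "t \<in> {- R - 1..R + 1}")
      case False
      have "strip_part X e 0 \<lfloor>t\<rfloor> = {}"
      proof (rule ccontr)
        assume "strip_part X e 0 \<lfloor>t\<rfloor> \<noteq> {}"
        then obtain x where x: "x \<in> X" "\<lfloor>x \<bullet> e\<rfloor> = \<lfloor>t\<rfloor>" by (auto simp: strip_part_def)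
        have "\<bar>x \<bullet> e - t\<bar> < 1" using x(2) by linarith
        then show False using xR(1)[OF x(1)] False by (auto simp: abs_le_iff abs_less_iff)
      qed
      moreover have "hausdorff_content u ({} :: real set) = 0"
        using hausdorff_content_finite_cover[of "{} :: unit set" "{} :: real set" "\<lambda>_. {}" u] by simp
      ultimately show ?thesis by (simp add: G_def)
    qed (use cB in \<open>simp add: G_def\<close>)
    then have "(\<integral>\<^sup>+t. G 0 t \<partial>lborel) \<le> (\<integral>\<^sup>+t. ennreal B * indicator {- R - 1..R + 1} t \<partial>lborel)"
      by (intro nn_integral_mono) auto
    also have "\<dots> = ennreal B * ennreal (R + 1 - (- R - 1))"
      using R by (subst nn_integral_cmult_indicator) auto
    also have "\<dots> < \<infinity>" by (simp add: ennreal_mult_less_top)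
    finally show ?thesis .
  qed
  have "(INF n. \<integral>\<^sup>+t. G n t \<partial>lborel) = (\<integral>\<^sup>+t. (INF n. G n t) \<partial>lborel)"
    by (rule nn_integral_monotone_convergence_INF_decseq[symmetric, OF dec Gm Gfin])
  also have "\<dots> = (\<integral>\<^sup>+v. (INF n. G n (v \<bullet> e)) \<partial>line_lebesgue (span {e}))"
    using Gm by (intro nn_integral_line_lebesgue[OF e, symmetric]) simp
  also have "\<dots> \<le> slice_integral u X (span {e})"
    unfolding slice_integral_def
  proof (rule nn_integral_mono)
    fix v assume "v \<in> space (line_lebesgue (span {e}))"
    then have "v \<in> span {e}" by (simp add: space_line_lebesgue[OF e])
    show "(INF n. G n (v \<bullet> e)) \<le> hausdorff_content u (X \<inter> orth_proj (span {e}) -` {v})"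
      unfolding G_def slice_eq[OF e \<open>v \<in> span {e}\<close>] by (rule strip_limit_le_slice[OF X e u])
  qed
  also note less
  finally obtain n where n: "(\<integral>\<^sup>+t. G n t \<partial>lborel) < ennreal \<epsilon>" by (auto simp: INF_less_iff)
  define c where "c k = enn2real (hausdorff_content u (strip_part X e n k))" for k
  have c0: "0 \<le> c k" for k by (simp add: c_def)
  have c: "hausdorff_content u (strip_part X e n k) = ennreal (c k)" for k
    using le_less_trans[OF cB ennreal_less_top, of n k] by (simp add: c_def)
  define Z where "Z = {\<lfloor>2 ^ n * (- R)\<rfloor>..\<lfloor>2 ^ n * R\<rfloor>}"
  have Z: "\<lfloor>2 ^ n * (x \<bullet> e)\<rfloor> \<in> Z" if "x \<in> X" for x
  proof -
    have "- R \<le> x \<bullet> e" "x \<bullet> e \<le> R" using xR(1)[OF that] by (auto simp: abs_le_iff)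
    then have "2 ^ n * (- R) \<le> 2 ^ n * (x \<bullet> e)" "2 ^ n * (x \<bullet> e) \<le> 2 ^ n * R"
      by (intro mult_left_mono; simp)+
    then show ?thesis unfolding Z_def by (auto intro!: floor_mono)
  qed
  define J where "J k = {t::real. \<lfloor>2 ^ n * t\<rfloor> = k}" for k
  have J: "J k = {real_of_int k * (1/2) ^ n..<(real_of_int k + 1) * (1/2) ^ n}" for k
    by (auto simp: J_def floor_eq_iff field_simps power_divide)
  have "ennreal (\<Sum>k\<in>Z. c k * (1/2) ^ n) = (\<Sum>k\<in>Z. ennreal (c k) * ennreal ((1/2) ^ n))"
    using c0 by (subst sum_ennreal[symmetric]) (auto simp: ennreal_mult)
  also have "\<dots> = (\<Sum>k\<in>Z. \<integral>\<^sup>+t. ennreal (c k) * indicator (J k) t \<partial>lborel)"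
    unfolding J by (intro sum.cong refl, subst nn_integral_cmult_indicator) (auto simp: algebra_simps)
  also have "\<dots> = (\<integral>\<^sup>+t. (\<Sum>k\<in>Z. ennreal (c k) * indicator (J k) t) \<partial>lborel)"
    unfolding J by (intro nn_integral_sum[symmetric]) auto
  also have "\<dots> \<le> (\<integral>\<^sup>+t. G n t \<partial>lborel)"
  proof (rule nn_integral_mono)
    fix t :: real
    let ?k = "\<lfloor>2 ^ n * t\<rfloor>"
    have "(\<Sum>k\<in>Z. ennreal (c k) * indicator (J k) t) = (\<Sum>k\<in>Z. if k = ?k then ennreal (c ?k) else 0)"
      by (intro sum.cong) (auto simp: J_def indicator_def)
    also have "\<dots> \<le> ennreal (c ?k)" by (simp add: Z_def)
    finally show "(\<Sum>k\<in>Z. ennreal (c k) * indicator (J k) t) \<le> G n t" by (simp add: G_def c)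
  qed
  also note n
  finally have "(\<Sum>k\<in>Z. c k * (1/2) ^ n) < \<epsilon>"
    using c0 by (subst (asm) ennreal_less_iff) (auto intro!: sum_nonneg)
  then show thesis using that[of Z n c] Z c c0 by (simp add: Z_def)
qed

lemma slice_small_imp_rectangles:
  fixes e :: "real^2"
  assumes X: "compact X" and e: "norm e = 1" and u: "0 < u"
    and less: "slice_integral u X (span {e}) < ennreal \<epsilon>"
  obtains Q where "finite Q" "\<And>a l c h. (a, l, c, h) \<in> Q \<Longrightarrow> 0 < l \<and> 0 < h"
    "X \<subseteq> (\<Union>q\<in>Q. rect e q)" "(\<Sum>(a, l, c, h)\<in>Q. l * h powr u) \<le> 2 * \<epsilon>"
proof -
  obtain n Z c where Z: "finite Z" "\<And>x. x \<in> X \<Longrightarrow> \<lfloor>2 ^ n * (x \<bullet> e)\<rfloor> \<in> Z"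
    and c: "\<And>k. 0 \<le> c k" "\<And>k. hausdorff_content u (strip_part X e n k) = ennreal (c k)"
    and sum: "(\<Sum>k\<in>Z. c k * (1/2) ^ n) < \<epsilon>"
    by (rule slice_small_imp_strips[OF X e u less]) blast
  define \<delta> where "\<delta> = (1/2::real) ^ n"
  have \<delta>: "0 < \<delta>" by (simp add: \<delta>_def)
  \<comment> \<open>The slack of all strips together stays within the gap up to \<epsilon>; the
    added 1 keeps the divisor positive when Z is empty.\<close>
  define \<eta> where "\<eta> = (\<epsilon> - (\<Sum>k\<in>Z. c k * \<delta>)) / (\<delta> * (real (card Z) + 1))"
  have \<eta>: "0 < \<eta>" using sum \<delta> by (simp add: \<eta>_def \<delta>_def[symmetric] add_nonneg_pos)
  have tot: "(\<Sum>k\<in>Z. (c k + \<eta>) * \<delta>) \<le> \<epsilon>"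
  proof -
    have "(\<Sum>k\<in>Z. (c k + \<eta>) * \<delta>) = (\<Sum>k\<in>Z. c k * \<delta>) + real (card Z) * (\<eta> * \<delta>)"
      by (simp add: distrib_right sum.distrib)
    also have "\<dots> \<le> (\<Sum>k\<in>Z. c k * \<delta>) + (real (card Z) + 1) * (\<eta> * \<delta>)"
      using \<eta> \<delta> by simp
    also have "(real (card Z) + 1) * (\<eta> * \<delta>) = \<epsilon> - (\<Sum>k\<in>Z. c k * \<delta>)"
      using \<delta> by (simp add: \<eta>_def add_nonneg_pos[THEN less_imp_neq, symmetric])
    finally show ?thesis by simp
  qed
  have "\<exists>d h. (\<forall>i::nat. 0 < h i) \<and> strip_part X e n k \<subseteq> (\<Union>i. {d i<..<d i + h i}) \<and>
      (\<Sum>i. ennreal (h i powr u)) < ennreal (c k + \<eta>)" for k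
  proof -
    have "hausdorff_content u (strip_part X e n k) < ennreal (c k + \<eta>)"
      unfolding c(2) using c(1) \<eta> by (intro ennreal_lessI) (auto simp: add_nonneg_pos)
    then show ?thesis by (rule content_open_intervals[OF u]) blast
  qed
  then obtain d h where h: "\<And>k (i::nat). 0 < h k i" and dh: "\<And>k. strip_part X e n k \<subseteq> (\<Union>i. {d k i<..<d k i + h k i})"
    and hsum: "\<And>k. (\<Sum>i. ennreal (h k i powr u)) < ennreal (c k + \<eta>)"
    by metis
  \<comment> \<open>Strips are half-open, so they are widened by half their width on either side.
    The doubled width is the factor 2 in the bound on the total cost.\<close>
  define g where "g = (\<lambda>(k, i). ((real_of_int k - 1/2) * \<delta>, 2 * \<delta>, d k i, h k i))"
  have "X \<subseteq> (\<Union>p\<in>Z \<times> UNIV. rect e (g p))"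
  proof
    fix x assume x: "x \<in> X"
    define k where "k = \<lfloor>2 ^ n * (x \<bullet> e)\<rfloor>"
    have "x \<bullet> rot e \<in> strip_part X e n k" using x by (auto simp: strip_part_def k_def)
    then obtain i where i: "d k i < x \<bullet> rot e" "x \<bullet> rot e < d k i + h k i" using dh by fastforce
    have "real_of_int k \<le> 2 ^ n * (x \<bullet> e)" "2 ^ n * (x \<bullet> e) < real_of_int k + 1" by (simp_all add: k_def)
    then have "(real_of_int k - 1/2) * \<delta> < (2 ^ n * (x \<bullet> e)) * \<delta>" "(2 ^ n * (x \<bullet> e)) * \<delta> < (real_of_int k - 1/2 + 2) * \<delta>"
      using \<delta> by (intro mult_strict_right_mono; simp)+
    moreover have eq: "(2 ^ n * (x \<bullet> e)) * \<delta> = x \<bullet> e" by (simp add: \<delta>_def power_divide)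
    ultimately have "(real_of_int k - 1/2) * \<delta> < x \<bullet> e" "x \<bullet> e < (real_of_int k - 1/2 + 2) * \<delta>"
      unfolding eq by auto
    then have "x \<in> rect e (g (k, i))" using i by (simp add: rect_def g_def algebra_simps)
    moreover have "(k, i) \<in> Z \<times> UNIV" using Z(2)[OF x] by (simp add: k_def)
    ultimately show "x \<in> (\<Union>p\<in>Z \<times> UNIV. rect e (g p))" by blast
  qed
  then obtain I where I: "I \<subseteq> Z \<times> UNIV" "finite I" "X \<subseteq> (\<Union>p\<in>I. rect e (g p))"
    using compactE_image[OF X, of "Z \<times> UNIV" "\<lambda>p. rect e (g p)"] open_rect by metis
  show thesis
  proof (rule that[of "g ` I"])
    show "finite (g ` I)" using I by simp
    show "0 < l \<and> 0 < h'" if "(a, l, c', h') \<in> g ` I" for a l c' h'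
      using that h \<delta> by (auto simp: g_def)
    show "X \<subseteq> (\<Union>q\<in>g ` I. rect e q)" using I by simp
    obtain M where M: "I \<subseteq> Z \<times> {..<M}"
    proof -
      obtain M where "snd ` I \<subseteq> {..<M}" using I(2) finite_nat_iff_bounded[of "snd ` I"] by auto
      then have "I \<subseteq> Z \<times> {..<M}" using I(1) by fastforce
      then show thesis by (rule that)
    qed
    have "(\<Sum>(a, l, c, h)\<in>g ` I. l * h powr u) \<le> (\<Sum>p\<in>I. (\<lambda>(a, l, c, h). l * h powr u) (g p))"
      using I(2) \<delta> sum_image_le[of I "\<lambda>(a, l, c, h). l * h powr u" g] by (auto simp: o_def g_def)
    also have "\<dots> = (\<Sum>(k, i)\<in>I. 2 * \<delta> * h k i powr u)"
      by (intro sum.cong) (auto simp: g_def)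
    also have "\<dots> \<le> (\<Sum>(k, i)\<in>Z \<times> {..<M}. 2 * \<delta> * h k i powr u)"
      using M Z(1) \<delta> by (intro sum_mono2) auto
    also have "\<dots> = (\<Sum>k\<in>Z. 2 * \<delta> * (\<Sum>i<M. h k i powr u))"
      by (subst sum.cartesian_product[symmetric]) (simp add: sum_distrib_left)
    also have "\<dots> \<le> (\<Sum>k\<in>Z. 2 * \<delta> * (c k + \<eta>))"
    proof (intro sum_mono mult_left_mono)
      fix k
      have "ennreal (\<Sum>i<M. h k i powr u) = (\<Sum>i<M. ennreal (h k i powr u))" by (subst sum_ennreal) auto
      also have "\<dots> \<le> (\<Sum>i. ennreal (h k i powr u))" by (intro sum_le_suminf) auto
      also have "\<dots> \<le> ennreal (c k + \<eta>)" using hsum[of k] by simp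
      finally show "(\<Sum>i<M. h k i powr u) \<le> c k + \<eta>"
        using c(1)[of k] \<eta> by (subst (asm) ennreal_le_iff) auto
    qed (use \<delta> in simp)
    also have "\<dots> = 2 * (\<Sum>k\<in>Z. (c k + \<eta>) * \<delta>)" by (simp add: sum_distrib_left mult_ac)
    also have "\<dots> \<le> 2 * \<epsilon>" using tot by simp
    finally show "(\<Sum>(a, l, c, h)\<in>g ` I. l * h powr u) \<le> 2 * \<epsilon>" .
  qed
qed

text \<open>A Lebesgue number r absorbs the rotation: the point y whose coordinates in the frame of
  e are those of x in the frame of f is at distance at most 2 R |f - e| from x.\<close>

lemma rectangles_rotate:
  fixes e :: "real^2"
  assumes X: "compact X" and cov: "X \<subseteq> (\<Union>q\<in>Q. rect e q)" and e: "norm e = 1"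
  obtains \<eta> where "0 < \<eta>" "\<And>f. norm f = 1 \<Longrightarrow> norm (f - e) < \<eta> \<Longrightarrow> X \<subseteq> (\<Union>q\<in>Q. rect f q)"
proof -
  obtain r where r: "0 < r" "\<And>x. x \<in> X \<Longrightarrow> \<exists>G\<in>rect e ` Q. ball x r \<subseteq> G"
    using Heine_Borel_lemma[OF X cov] open_rect by blast
  obtain R where R: "0 < R" "X \<subseteq> cball 0 R"
    using compact_imp_bounded[OF X] by (auto simp: bounded_pos subset_iff)
  show thesis
  proof (rule that[of "r / (2 * R)"])
    show "0 < r / (2 * R)" using r R by simp
    fix f :: "real^2" assume f: "norm f = 1" "norm (f - e) < r / (2 * R)"
    show "X \<subseteq> (\<Union>q\<in>Q. rect f q)"
    proof
      fix x assume x: "x \<in> X"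
      define y where "y = (x \<bullet> f) *\<^sub>R e + (x \<bullet> rot f) *\<^sub>R rot e"
      have ee: "e \<bullet> e = 1" using e by (simp add: norm_eq_1)
      have y: "y \<bullet> e = x \<bullet> f" "y \<bullet> rot e = x \<bullet> rot f" by (simp_all add: y_def inner_add_left ee)
      have nx: "norm x \<le> R" using x R by auto
      have "norm (y - x) \<le> \<bar>(y - x) \<bullet> e\<bar> + \<bar>(y - x) \<bullet> rot e\<bar>" by (rule frame_norm_le[OF e])
      also have "\<dots> = \<bar>x \<bullet> (f - e)\<bar> + \<bar>x \<bullet> rot (f - e)\<bar>"
        by (simp add: inner_diff_left inner_diff_right y)
      also have "\<dots> \<le> norm x * norm (f - e) + norm x * norm (rot (f - e))"
        by (intro add_mono Cauchy_Schwarz_ineq2)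
      also have "\<dots> = 2 * norm x * norm (f - e)" using norm_rot[of "f - e"] by simp
      also have "\<dots> \<le> 2 * R * norm (f - e)" using nx by (intro mult_right_mono) auto
      also have "\<dots> < r" using f(2) R by (simp add: field_simps)
      finally have "y \<in> ball x r" by (simp add: dist_norm norm_minus_commute)
      then obtain q where q: "q \<in> Q" "y \<in> rect e q" using r(2)[OF x] by blast
      then have "x \<in> rect f q" using y by (auto simp: rect_def split: prod.splits)
      then show "x \<in> (\<Union>q\<in>Q. rect f q)" using q by blast
    qed
  qed
qed


section \<open>Covers by thin parallelograms\<close>

text \<open>Finite families with a real cost, which is at most added under unions. The family is a
  set, so coinciding pieces are charged once.\<close>

definition cheap_cover :: "real \<Rightarrow> real \<Rightarrow> 'b::metric_space set \<Rightarrow> real \<Rightarrow> bool" where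
  "cheap_cover s \<delta> S c \<longleftrightarrow> (\<exists>\<U>. finite \<U> \<and> S \<subseteq> \<Union>\<U> \<and>
     (\<forall>U\<in>\<U>. bounded U \<and> diameter U < \<delta>) \<and> (\<Sum>U\<in>\<U>. diameter U powr s) \<le> c)"

lemma cheap_cover_pre:
  assumes "cheap_cover s \<delta> S c" "0 < \<delta>"
  shows "hausdorff_pre s \<delta> S \<le> ennreal c"
proof -
  obtain \<U> where U: "finite \<U>" "S \<subseteq> \<Union>\<U>" "\<And>U. U \<in> \<U> \<Longrightarrow> bounded U \<and> diameter U < \<delta>"
    "(\<Sum>U\<in>\<U>. diameter U powr s) \<le> c" using assms(1) by (auto simp: cheap_cover_def)
  have "hausdorff_pre s \<delta> S \<le> (\<Sum>U\<in>\<U>. ennreal (diameter U powr s))"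
    using U assms(2) by (intro hausdorff_pre_finite_cover) auto
  also have "\<dots> = ennreal (\<Sum>U\<in>\<U>. diameter U powr s)" by (simp add: sum_ennreal)
  also have "\<dots> \<le> ennreal c" using U(4) by (rule ennreal_leI)
  finally show ?thesis .
qed

lemma cheap_cover_mono:
  assumes "cheap_cover s \<delta> T c" "S \<subseteq> T" "c \<le> d"
  shows "cheap_cover s \<delta> S d"
  using assms unfolding cheap_cover_def by (meson order_trans)

lemma cheap_cover_indexed:
  assumes "finite I" "S \<subseteq> (\<Union>i\<in>I. U i)" "\<And>i. i \<in> I \<Longrightarrow> bounded (U i) \<and> diameter (U i) < \<delta>"
  shows "cheap_cover s \<delta> S (\<Sum>i\<in>I. diameter (U i) powr s)"
  unfolding cheap_cover_def
  using assms sum_image_le[of I "\<lambda>V. diameter V powr s" U]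
  by (intro exI[of _ "U ` I"]) (auto simp: o_def)

lemma cheap_cover_Un:
  assumes "cheap_cover s \<delta> S c" "cheap_cover s \<delta> T d"
  shows "cheap_cover s \<delta> (S \<union> T) (c + d)"
proof -
  obtain \<U> where U: "finite \<U>" "S \<subseteq> \<Union>\<U>" "\<forall>U\<in>\<U>. bounded U \<and> diameter U < \<delta>"
    "(\<Sum>U\<in>\<U>. diameter U powr s) \<le> c" using assms(1) by (auto simp: cheap_cover_def)
  obtain \<V> where V: "finite \<V>" "T \<subseteq> \<Union>\<V>" "\<forall>U\<in>\<V>. bounded U \<and> diameter U < \<delta>"
    "(\<Sum>U\<in>\<V>. diameter U powr s) \<le> d" using assms(2) by (auto simp: cheap_cover_def)
  have "(\<Sum>U\<in>\<U> \<union> \<V>. diameter U powr s) + (\<Sum>U\<in>\<U> \<inter> \<V>. diameter U powr s)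
      = (\<Sum>U\<in>\<U>. diameter U powr s) + (\<Sum>U\<in>\<V>. diameter U powr s)"
    by (rule sum.union_inter[OF U(1) V(1)])
  moreover have "0 \<le> (\<Sum>U\<in>\<U> \<inter> \<V>. diameter U powr s)" by (intro sum_nonneg) auto
  ultimately have "(\<Sum>U\<in>\<U> \<union> \<V>. diameter U powr s) \<le> c + d" using U(4) V(4) by linarith
  then show ?thesis
    unfolding cheap_cover_def using U V by (intro exI[of _ "\<U> \<union> \<V>"]) auto
qed

lemma cheap_cover_UN:
  assumes "finite I" "\<And>i. i \<in> I \<Longrightarrow> cheap_cover s \<delta> (S i) (c i)"
  shows "cheap_cover s \<delta> (\<Union>i\<in>I. S i) (\<Sum>i\<in>I. c i)"
  using assms
proof (induction I)
  case empty
  show ?case unfolding cheap_cover_def by (rule exI[of _ "{}"]) simp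
next
  case (insert i I)
  then have "cheap_cover s \<delta> (S i \<union> (\<Union>i\<in>I. S i)) (c i + (\<Sum>i\<in>I. c i))"
    by (intro cheap_cover_Un) auto
  then show ?case using insert by simp
qed

context self_affine begin

text \<open>The image of a rectangle is a parallelogram whose width is about
  \<open>\<bar>det M\<bar> / norm M\<close> times the length of the side orthogonal to \<open>f\<close>; it is cut into pieces of
  that diameter.\<close>

lemma F_rect_cover:
  assumes c0: "c0 > 0" "c0 * norm (mat_word A u) * norm y \<le> norm (transpose (mat_word A u) *v y)"
    and y: "y \<noteq> 0" and f: "norm f = 1" "f = k *\<^sub>R (transpose (mat_word A u) *v y)"
    and lh: "0 < l" "0 < h" and \<beta>: "\<beta> = \<bar>det (mat_word A u)\<bar> / (c0 * norm (mat_word A u))"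
    and flat: "\<beta> * h \<le> norm (mat_word A u) * l" and small: "2 * \<beta> * h < \<delta>"
  shows "cheap_cover s \<delta> (F u ` rect f (a, l, c, h))
    (2 powr (s + 1) * c0 powr (1 - s) * phi s (mat_word A u) * (l * h powr (s - 1)))"
proof -
  define M where "M = mat_word A u"
  define N where "N = norm M"
  have N: "0 < N" using norm_pos_of_det det_mat_word by (simp add: N_def M_def)
  have dM: "det M \<noteq> 0" by (simp add: M_def det_mat_word)
  have \<beta>0: "0 < \<beta>" using dM N c0 by (simp add: \<beta> M_def[symmetric] N_def[symmetric])
  \<comment> \<open>By \<open>matvec_rot_transpose\<close> the image of \<open>rot f\<close> is a
    multiple of \<open>rot y\<close>, and the lower bound on the image of y limits k.\<close>
  have Mrot: "norm (M *v rot f) \<le> \<beta>"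
  proof -
    have "M *v rot f = (k * det M) *\<^sub>R rot y"
      by (simp add: f(2) M_def matrix_vector_mult_scaleR matvec_rot_transpose)
    then have "norm (M *v rot f) = \<bar>k\<bar> * norm y * \<bar>det M\<bar>" by (simp add: abs_mult)
    moreover have "\<bar>k\<bar> * norm y \<le> 1 / (c0 * N)"
    proof -
      have "\<bar>k\<bar> * (c0 * N * norm y) \<le> \<bar>k\<bar> * norm (transpose M *v y)"
        using c0(2) by (intro mult_left_mono) (auto simp: N_def M_def)
      also have "\<dots> = 1" using f by (metis M_def norm_scaleR)
      finally show ?thesis using c0 N by (simp add: field_simps)
    qed
    ultimately have "norm (M *v rot f) \<le> 1 / (c0 * N) * \<bar>det M\<bar>"
      by (metis mult_right_mono abs_ge_zero)
    then show ?thesis by (simp add: \<beta> N_def M_def)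
  qed
  \<comment> \<open>The long side, of image length at most N l, is cut into parts of image length at
    most \<beta> h. Flatness makes the ratio at least 1, so rounding up at most doubles it.\<close>
  define n where "n = nat \<lceil>N * l / (\<beta> * h)\<rceil>"
  define q where "q = N * l / (\<beta> * h)"
  have q1: "1 \<le> q" using flat \<beta>0 lh by (simp add: q_def N_def M_def)
  have n: "q \<le> real n" "real n \<le> 2 * q" "0 < n"
    using q1 unfolding n_def q_def[symmetric] by linarith+
  define U where "U i = F u ` {x. a + real i * (l / n) \<le> x \<bullet> f \<and> x \<bullet> f \<le> a + (real i + 1) * (l / n)
    \<and> c < x \<bullet> rot f \<and> x \<bullet> rot f < c + h}" for i
  have cov: "F u ` rect f (a, l, c, h) \<subseteq> (\<Union>i\<in>{..<n}. U i)"
  proof -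
    have "\<exists>i<n. F u x \<in> U i" if x: "x \<in> rect f (a, l, c, h)" for x
    proof -
      define z where "z = (x \<bullet> f - a) * (n / l)"
      have xf: "0 \<le> x \<bullet> f - a" "x \<bullet> f - a < l" using x by (simp_all add: rect_def)
      have "(x \<bullet> f - a) * (n / l) < l * (n / l)" using xf lh n by (intro mult_strict_right_mono) auto
      then have z: "0 \<le> z" "z < n" using xf lh by (simp_all add: z_def)
      define i where "i = nat \<lfloor>z\<rfloor>"
      have i: "real i \<le> z" "z < real i + 1" "i < n" using z unfolding i_def by linarith+
      have "x \<bullet> f = a + z * (l / n)" using lh n by (simp add: z_def)
      moreover have "real i * (l / n) \<le> z * (l / n)" "z * (l / n) \<le> (real i + 1) * (l / n)"
        using i lh n by (intro mult_right_mono; simp)+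
      ultimately have "F u x \<in> U i" using x by (auto simp: U_def rect_def)
      then show ?thesis using i by blast
    qed
    then show ?thesis by blast
  qed
  have diam: "bounded (U i)" "diameter (U i) \<le> 2 * \<beta> * h" for i
  proof -
    have "dist v w \<le> 2 * \<beta> * h" if vw: "v \<in> U i" "w \<in> U i" for v w
    proof -
      obtain x where x: "v = F u x" "a + real i * (l / n) \<le> x \<bullet> f" "x \<bullet> f \<le> a + (real i + 1) * (l / n)"
        "c < x \<bullet> rot f" "x \<bullet> rot f < c + h" using vw(1) by (auto simp: U_def)
      obtain y where y: "w = F u y" "a + real i * (l / n) \<le> y \<bullet> f" "y \<bullet> f \<le> a + (real i + 1) * (l / n)"
        "c < y \<bullet> rot f" "y \<bullet> rot f < c + h" using vw(2) by (auto simp: U_def)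
      define z where "z = x - y"
      have "(real i + 1) * (l / n) = real i * (l / n) + l / n" by (simp only: distrib_right mult_1)
      then have z: "\<bar>z \<bullet> f\<bar> \<le> l / n" "\<bar>z \<bullet> rot f\<bar> \<le> h"
        using x y unfolding z_def inner_diff_left abs_le_iff by linarith+
      have "dist v w = norm (M *v z)" by (simp add: x y dist_norm F_diff M_def z_def)
      also have "M *v z = (z \<bullet> f) *\<^sub>R (M *v f) + (z \<bullet> rot f) *\<^sub>R (M *v rot f)"
        by (subst frame_decomp[OF f(1), of z]) (simp add: matrix_vector_right_distrib matrix_vector_mult_scaleR)
      also have "norm \<dots> \<le> \<bar>z \<bullet> f\<bar> * norm (M *v f) + \<bar>z \<bullet> rot f\<bar> * norm (M *v rot f)"
        by (rule order_trans[OF norm_triangle_ineq]) simp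
      also have "\<dots> \<le> (l / n) * N + h * \<beta>"
        using z Mrot norm_matvec2_le[of M f] f(1) lh by (intro add_mono mult_mono) (auto simp: N_def)
      also have "(l / n) * N \<le> h * \<beta>"
        using n(1,3) \<beta>0 lh by (simp add: q_def field_simps)
      finally show ?thesis by (simp add: mult_ac)
    qed
    then show "bounded (U i)" "diameter (U i) \<le> 2 * \<beta> * h"
      using diameter_le_bound[of "U i" "2 * \<beta> * h"] \<beta>0 lh by auto
  qed
  have "cheap_cover s \<delta> (F u ` rect f (a, l, c, h)) (\<Sum>i\<in>{..<n}. diameter (U i) powr s)"
    using cov diam(1) le_less_trans[OF diam(2) small] by (intro cheap_cover_indexed) auto
  moreover have "(\<Sum>i\<in>{..<n}. diameter (U i) powr s) \<le>
      2 powr (s + 1) * c0 powr (1 - s) * phi s M * (l * h powr (s - 1))"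
  proof -
    have "(\<Sum>i\<in>{..<n}. diameter (U i) powr s) \<le> (\<Sum>i\<in>{..<n}. (2 * \<beta> * h) powr s)"
      using diam s by (intro sum_mono powr_mono2 diameter_ge_0) auto
    also have "\<dots> \<le> (2 * q) * (2 * \<beta> * h) powr s"
      using n by (simp add: mult_right_mono)
    also have "\<dots> = 2 * 2 powr s * (N * \<beta> powr (s - 1)) * (l * h powr (s - 1))"
    proof -
      have "\<beta> powr s = \<beta> * \<beta> powr (s - 1)" "h powr s = h * h powr (s - 1)"
        using powr_add[of \<beta> 1 "s - 1"] powr_add[of h 1 "s - 1"] \<beta>0 lh by simp_all
      then show ?thesis using \<beta>0 lh by (simp add: q_def powr_mult field_simps)
    qed
    also have "N * \<beta> powr (s - 1) = c0 powr (1 - s) * phi s M"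
      using phi_split[of 1 c0 N 1 "det M" s] c0 N by (simp add: \<beta> phi_def N_def M_def)
    also have "2 * 2 powr s = 2 powr (s + 1)" by (simp add: powr_add)
    finally show ?thesis by (simp add: mult_ac)
  qed
  ultimately show ?thesis unfolding M_def by (rule cheap_cover_mono[OF _ order_refl])
qed

text \<open>Domination in the form used for shapes and directions: |det| / norm^2 is comparable to
  \<alpha>2 / \<alpha>1.\<close>

lemma det_ratio_null: 
  assumes "\<epsilon> > 0"
  obtains n0 where "\<And>u. n0 \<le> length u \<Longrightarrow> \<bar>det (mat_word A u)\<bar> \<le> \<epsilon> * (norm (mat_word A u))\<^sup>2"
proof -
  obtain K \<tau> where d: "K > 0" "0 < \<tau>" "\<tau> < 1"
    "\<And>w. sv2 (mat_word A w) \<le> K * \<tau> ^ length w * sv1 (mat_word A w)"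
    using dom by (auto simp: dominated_def)
  obtain n0 where n0: "\<tau> ^ n0 < \<epsilon> / K" using real_arch_pow_inv[of "\<epsilon> / K" \<tau>] assms d by auto
  show thesis
  proof (rule that[of n0])
    fix u :: "'a list" assume u: "n0 \<le> length u"
    have "\<tau> ^ length u \<le> \<tau> ^ n0" using d u by (intro power_decreasing) auto
    then have "\<tau> ^ length u \<le> \<epsilon> / K" using n0 by linarith
    then have K: "K * \<tau> ^ length u \<le> \<epsilon>" using d(1) by (simp add: field_simps)
    have "\<bar>det (mat_word A u)\<bar> \<le> (K * \<tau> ^ length u) * (norm (mat_word A u))\<^sup>2"
      using d by (intro sv_dominated_det) auto
    also have "\<dots> \<le> \<epsilon> * (norm (mat_word A u))\<^sup>2" using K by (intro mult_right_mono) auto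
    finally show "\<bar>det (mat_word A u)\<bar> \<le> \<epsilon> * (norm (mat_word A u))\<^sup>2" .
  qed
qed

lemma norm_mat_word_le: "norm (mat_word A u) \<le> 2"
proof -
  obtain \<rho> where \<rho>: "0 \<le> \<rho>" "\<rho> < 1" "\<And>w v. norm (mat_word A w *v v) \<le> \<rho> ^ length w * norm v"
    by (rule contraction) metis
  obtain e :: "real^2" where e: "norm e = 1" by (rule cone_unit)
  have "norm (mat_word A u *v v) \<le> 1" if "norm v = 1" for v
    using \<rho>(3)[of u v] power_le_one[of \<rho> "length u"] \<rho> that by simp
  then have "(norm (mat_word A u *v e))\<^sup>2 \<le> 1\<^sup>2" "(norm (mat_word A u *v rot e))\<^sup>2 \<le> 1\<^sup>2"
    using e by (intro power_mono; simp)+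
  then have "(norm (mat_word A u))\<^sup>2 \<le> 2\<^sup>2" unfolding mat2_frame_norm[OF e] by simp
  then show ?thesis by (rule power2_le_imp_le) simp
qed

text \<open>The cross product of two images is scaled by the determinant, whereas both images have a
  length comparable to the norm of the matrix.\<close>

lemma cone_images_close:
  assumes c0: "c0 > 0" "\<And>w v. v \<in> dir_cone C \<Longrightarrow>
      c0 * norm (mat_word A w) * norm v \<le> norm (transpose (mat_word A w) *v v)"
    and ratio: "\<bar>det (mat_word A w)\<bar> \<le> \<epsilon> * (norm (mat_word A w))\<^sup>2"
    and y: "y \<in> dir_cone C" and v: "v \<in> dir_cone C"
    and e: "norm e = 1" "span {e} = span {transpose (mat_word A w) *v v}"
  obtains k where "norm (k *\<^sub>R (transpose (mat_word A w) *v y)) = 1"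
    "norm (k *\<^sub>R (transpose (mat_word A w) *v y) - e) \<le> 2 * \<epsilon> / c0\<^sup>2"
proof -
  define M where "M = transpose (mat_word A w)"
  define N where "N = norm (mat_word A w)"
  have N: "0 < N" using norm_pos_of_det det_mat_word by (simp add: N_def)
  have yv: "y \<noteq> 0" "v \<noteq> 0" using y v by (auto simp: dir_cone_def)
  have low: "c0 * N * norm y \<le> norm (M *v y)" "c0 * N * norm v \<le> norm (M *v v)"
    using c0(2) y v by (auto simp: M_def N_def)
  have pos: "0 < c0 * N * norm y" "0 < c0 * N * norm v" using c0 N yv by simp_all
  define g where "g = (1 / norm (M *v v)) *\<^sub>R (M *v v)"
  have nv: "0 < norm (M *v v)" "0 < norm (M *v y)" using low pos by linarith+
  then have "norm g = 1" by (simp add: g_def)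
  moreover have "span {g} = span {M *v v}" unfolding g_def using nv by (intro span_scaleR_eq) simp
  ultimately have eg: "e = g \<or> e = - g" using e span_eq_unit[of e g] by (simp add: M_def)
  define f where "f = (1 / norm (M *v y)) *\<^sub>R (M *v y)"
  have f: "norm f = 1" using nv by (simp add: f_def)
  have "\<bar>f \<bullet> rot e\<bar> = \<bar>f \<bullet> rot g\<bar>" using eg by auto
  also have "\<dots> = \<bar>det M * (y \<bullet> rot v)\<bar> / (norm (M *v y) * norm (M *v v))"
    by (simp add: f_def g_def matvec_cross abs_mult)
  also have "\<dots> \<le> (\<epsilon> * N\<^sup>2 * (norm y * norm v)) / ((c0 * N * norm y) * (c0 * N * norm v))"
  proof (rule frac_le)
    show "(c0 * N * norm y) * (c0 * N * norm v) \<le> norm (M *v y) * norm (M *v v)"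
      using low pos by (intro mult_mono) auto
    have "\<bar>y \<bullet> rot v\<bar> \<le> norm y * norm v" using Cauchy_Schwarz_ineq2[of y "rot v"] by simp
    then show "\<bar>det M * (y \<bullet> rot v)\<bar> \<le> \<epsilon> * N\<^sup>2 * (norm y * norm v)"
      unfolding abs_mult using ratio by (intro mult_mono) (auto simp: M_def N_def)
    show "0 \<le> \<epsilon> * N\<^sup>2 * (norm y * norm v)" using ratio by (auto simp: N_def intro: order_trans[OF abs_ge_zero])
    show "0 < (c0 * N * norm y) * (c0 * N * norm v)" using pos by simp
  qed
  also have "\<dots> = \<epsilon> / c0\<^sup>2" using N yv c0 by (simp add: power2_eq_square field_simps)
  finally have cross: "\<bar>f \<bullet> rot e\<bar> \<le> \<epsilon> / c0\<^sup>2" .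
  \<comment> \<open>The line determines its unit vector up to sign; this sign makes the angle with e
    at most a right angle. Then 1 - cos is at most |sin|, and the cross product controls the
    distance.\<close>
  define \<sigma> :: real where "\<sigma> = (if 0 \<le> f \<bullet> e then 1 else -1)"
  define f' where "f' = \<sigma> *\<^sub>R f"
  have f': "norm f' = 1" "0 \<le> f' \<bullet> e" "\<bar>f' \<bullet> rot e\<bar> = \<bar>f \<bullet> rot e\<bar>" using f by (auto simp: f'_def \<sigma>_def)
  have ee: "e \<bullet> e = 1" using e by (simp add: norm_eq_1)
  have sq: "1 = (f' \<bullet> e)\<^sup>2 + (f' \<bullet> rot e)\<^sup>2" using frame_norm_sq[OF e(1), of f'] f' by simp
  have le1: "f' \<bullet> e \<le> 1" using Cauchy_Schwarz_ineq2[of f' e] f' e by simp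
  have "(f' \<bullet> e)\<^sup>2 \<le> f' \<bullet> e" using f' le1 by (simp add: power2_eq_square mult_left_le)
  then have "(1 - f' \<bullet> e) \<le> (f' \<bullet> rot e)\<^sup>2" using sq by linarith
  moreover have "1 - f' \<bullet> e \<le> 1" using f' by simp
  ultimately have "(1 - f' \<bullet> e)\<^sup>2 \<le> (f' \<bullet> rot e)\<^sup>2"
    using le1 by (smt (verit) mult_left_le power2_eq_square)
  then have "\<bar>1 - f' \<bullet> e\<bar> \<le> \<bar>f' \<bullet> rot e\<bar>" by (simp add: abs_le_square_iff)
  then have "norm (f' - e) \<le> 2 * \<bar>f' \<bullet> rot e\<bar>"
    using frame_norm_le[OF e(1), of "f' - e"] ee by (simp add: inner_diff_left)
  also have "\<dots> \<le> 2 * \<epsilon> / c0\<^sup>2" using cross f'(3) by simp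
  finally have "norm (f' - e) \<le> 2 * \<epsilon> / c0\<^sup>2" .
  then show thesis using that[of "\<sigma> / norm (M *v y)"] f'(1) by (simp add: f'_def f_def M_def)
qed

end

context gibbs begin

text \<open>The suffix w fixes the frame: the transpose of A_uw sends \<open>e0\<close> to the image
  under A_w^T of some cone vector, and A_w^T brings the whole cone close to V. So one family of
  rectangles serves every u at cost 2 k \<epsilon> m(uw), and these masses add up to at most
  1.\<close>

lemma small_slice_imp_small_pre:
  obtains K where "0 < K" "\<And>V \<epsilon> \<delta>. V \<in> furstenberg_directions A C \<Longrightarrow>
    slice_integral (s - 1) X V < ennreal \<epsilon> \<Longrightarrow> 0 < \<epsilon> \<Longrightarrow> 0 < \<delta> \<Longrightarrow> hausdorff_pre s \<delta> X \<le> ennreal (K * \<epsilon>)"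
proof -
  obtain c0 where c0: "c0 > 0" "\<And>w v. v \<in> dir_cone C \<Longrightarrow>
    c0 * norm (mat_word A w) * norm v \<le> norm (transpose (mat_word A w) *v v)"
    by (rule cone_norm_lower) metis
  obtain e0 where e0: "e0 \<in> dir_cone C" "norm e0 = 1" by (rule cone_unit)
  have e00: "e0 \<noteq> 0" using e0 by (simp add: dir_cone_def)
  obtain R where R: "0 < R" "X \<subseteq> ball 0 R"
    using compact_imp_bounded[OF compact_X] bounded_subset_ballD[of X 0] by metis
  define k where "k = 2 powr (s + 1) * c0 powr (1 - s) * b"
  have k: "0 < k" using c0 b by (simp add: k_def)
  define L where "L = 2 * R * (2 * R) powr (s - 1)"
  have L: "0 < L" using R by (simp add: L_def)
  show thesis
  \<comment> \<open>\<open>2 * k\<close> pays for the pieces ending in w, and 1 for the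
    remainder.\<close>
  proof (rule that[of "2 * k + 1"])
    show "0 < 2 * k + 1" using k by simp
    fix V and \<epsilon> \<delta> :: real
    assume V: "V \<in> furstenberg_directions A C" and less: "slice_integral (s - 1) X V < ennreal \<epsilon>"
      and \<epsilon>: "0 < \<epsilon>" and \<delta>: "0 < \<delta>"
    have VR: "V \<in> RP1" using V furstenberg_subset C_RP1 by blast
    then obtain e where e: "norm e = 1" "V = span {e}" using RP1_unit by blast
    obtain Q where Q: "finite Q" "\<And>a l c h. (a, l, c, h) \<in> Q \<Longrightarrow> 0 < l \<and> 0 < h"
      "X \<subseteq> (\<Union>q\<in>Q. rect e q)" and Qsum: "(\<Sum>(a, l, c, h)\<in>Q. l * h powr (s - 1)) \<le> 2 * \<epsilon>"
      using slice_small_imp_rectangles[OF compact_X e(1), of "s - 1" \<epsilon>] less e(2) s by auto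
    obtain \<eta> where \<eta>: "0 < \<eta>" "\<And>f. norm f = 1 \<Longrightarrow> norm (f - e) < \<eta> \<Longrightarrow> X \<subseteq> (\<Union>q\<in>Q. rect f q)"
      by (rule rectangles_rotate[OF compact_X Q(3) e(1)]) metis
    \<comment> \<open>A square that contains X in every orthonormal frame. It covers the remainder,
      where u alone dictates the frame.\<close>
    define big where "big = (- R, 2 * R, - R, 2 * R)"
    have bigX: "X \<subseteq> rect f big" if "norm f = 1" for f
    proof
      fix x assume "x \<in> X"
      then have "norm x < R" using R by auto
      then have "\<bar>x \<bullet> f\<bar> < R" "\<bar>x \<bullet> rot f\<bar> < R"
        using Cauchy_Schwarz_ineq2[of x f] Cauchy_Schwarz_ineq2[of x "rot f"] that by simp_all
      then show "x \<in> rect f big" by (simp add: rect_def big_def abs_less_iff)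
    qed
    define Q' where "Q' = insert big Q"
    have Q': "0 < l \<and> 0 < h" if "(a, l, c, h) \<in> Q'" for a l c h
      using that Q(2) R by (auto simp: Q'_def big_def)
    have fQ': "finite Q'" using Q(1) by (simp add: Q'_def)
    text \<open>\<open>\<xi>\<close> makes the image of each rectangle flat and thin enough for \<open>F_rect_cover\<close>.\<close>
    define \<xi> where "\<xi> = Min (insert (\<eta> * c0\<^sup>2 / 4) ((\<lambda>(a, l, c, h). min (c0 * l / h) (c0 * \<delta> / (8 * h))) ` Q'))"
    have \<xi>: "0 < \<xi>" unfolding \<xi>_def using fQ' \<eta> c0 \<delta> Q' by (subst Min_gr_iff) auto
    \<comment> \<open>Together with \<open>cone_images_close\<close> this keeps the frames within
      \<eta> / 2 of e, inside the admissible rotation.\<close>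
    have \<xi>1: "\<xi> \<le> \<eta> * c0\<^sup>2 / 4" unfolding \<xi>_def using fQ' by (intro Min_le) auto
    have \<xi>2: "\<xi> \<le> c0 * l / h" "\<xi> \<le> c0 * \<delta> / (8 * h)" if q: "(a, l, c, h) \<in> Q'" for a l c h
    proof -
      have "\<xi> \<le> min (c0 * l / h) (c0 * \<delta> / (8 * h))"
        unfolding \<xi>_def using fQ' q by (intro Min_le) (auto intro!: rev_image_eqI)
      then show "\<xi> \<le> c0 * l / h" "\<xi> \<le> c0 * \<delta> / (8 * h)" by auto
    qed
    obtain n where n: "\<And>u. n \<le> length u \<Longrightarrow> \<bar>det (mat_word A u)\<bar> \<le> \<xi> * (norm (mat_word A u))\<^sup>2"
      by (rule det_ratio_null[OF \<xi>]) metis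
    have piece: "cheap_cover s \<delta> (F u ` rect f (a, l, c, h)) (k * m u * (l * h powr (s - 1)))"
      if u: "n \<le> length u" and q: "(a, l, c, h) \<in> Q'" and f: "norm f = 1" "f = \<kappa> *\<^sub>R (transpose (mat_word A u) *v e0)"
      for u f a l c h \<kappa>
    proof -
      let ?N = "norm (mat_word A u)"
      define \<beta> where "\<beta> = \<bar>det (mat_word A u)\<bar> / (c0 * ?N)"
      have N: "0 < ?N" using norm_pos_of_det det_mat_word by blast
      have lh: "0 < l" "0 < h" using Q'[OF q] by auto
      have \<beta>: "\<beta> \<le> \<xi> / c0 * ?N"
        using n[OF u] N c0 by (simp add: \<beta>_def power2_eq_square field_simps)
      have "cheap_cover s \<delta> (F u ` rect f (a, l, c, h))
        (2 powr (s + 1) * c0 powr (1 - s) * phi s (mat_word A u) * (l * h powr (s - 1)))"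
      proof (rule F_rect_cover[OF c0(1) c0(2)[OF e0(1)] e00 f lh \<beta>_def])
        have "\<xi> / c0 * h \<le> l" using \<xi>2(1)[OF q] lh c0 by (simp add: field_simps)
        then have "\<xi> / c0 * h * ?N \<le> l * ?N" using N by (intro mult_right_mono) auto
        moreover have "\<beta> * h \<le> \<xi> / c0 * ?N * h" using \<beta> lh by (intro mult_right_mono) auto
        ultimately show "\<beta> * h \<le> ?N * l" by (simp add: mult_ac)
        have "\<xi> / c0 * ?N \<le> \<xi> / c0 * 2" using norm_mat_word_le \<xi> c0 by (intro mult_left_mono) auto
        then have "2 * \<beta> * h \<le> 2 * (\<xi> / c0 * 2) * h" using \<beta> lh by (intro mult_right_mono mult_left_mono) auto
        also have "\<dots> \<le> \<delta> / 2" using \<xi>2(2)[OF q] lh c0 by (simp add: field_simps)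
        finally show "2 * \<beta> * h < \<delta>" using \<delta> by simp
      qed
      moreover have "2 powr (s + 1) * c0 powr (1 - s) * phi s (mat_word A u) * (l * h powr (s - 1))
          \<le> 2 powr (s + 1) * c0 powr (1 - s) * (b * m u) * (l * h powr (s - 1))"
        using m_lower lh by (intro mult_right_mono mult_left_mono) auto
      ultimately show ?thesis
        by (elim cheap_cover_mono) (auto simp: k_def mult_ac)
    qed
    obtain w v where w: "length w = n" and v: "v \<in> dir_cone C" and Vw: "V = span {transpose (mat_word A w) *v v}"
      by (rule furstenberg_directionsE[OF V])
    have good: "cheap_cover s \<delta> (F (u @ w) ` X) (2 * k * \<epsilon> * m (u @ w))" for u
    proof -
      define y where "y = transpose (mat_word A u) *v e0"
      have y: "y \<in> dir_cone C" unfolding y_def by (rule cone_invariant_word[OF e0(1)])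
      have eq: "transpose (mat_word A w) *v y = transpose (mat_word A (u @ w)) *v e0"
        by (simp add: y_def mat_word_append matrix_transpose_mul matrix_vector_mul_assoc)
      obtain \<kappa> where \<kappa>: "norm (\<kappa> *\<^sub>R (transpose (mat_word A w) *v y)) = 1"
        "norm (\<kappa> *\<^sub>R (transpose (mat_word A w) *v y) - e) \<le> 2 * \<xi> / c0\<^sup>2"
        using cone_images_close[OF c0 n[of w] y v e(1)] w Vw e(2) by auto
      define f where "f = \<kappa> *\<^sub>R (transpose (mat_word A w) *v y)"
      have "2 * \<xi> / c0\<^sup>2 \<le> \<eta> / 2" using \<xi>1 c0 by (simp add: field_simps)
      then have f: "norm f = 1" "norm (f - e) < \<eta>" using \<kappa> \<eta>(1) by (simp_all add: f_def)
      have "cheap_cover s \<delta> (\<Union>q\<in>Q. F (u @ w) ` rect f q) (\<Sum>q\<in>Q. k * m (u @ w) * (case q of (a, l, c, h) \<Rightarrow> l * h powr (s - 1)))"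
      proof (rule cheap_cover_UN[OF Q(1)])
        fix q assume "q \<in> Q"
        moreover obtain a l c h where "q = (a, l, c, h)" by (cases q) auto
        ultimately show "cheap_cover s \<delta> (F (u @ w) ` rect f q) (k * m (u @ w) * (case q of (a, l, c, h) \<Rightarrow> l * h powr (s - 1)))"
          using piece[of "u @ w" a l c h f \<kappa>] w f(1) by (simp add: Q'_def f_def eq)
      qed
      then show ?thesis
      proof (rule cheap_cover_mono)
        show "F (u @ w) ` X \<subseteq> (\<Union>q\<in>Q. F (u @ w) ` rect f q)" using \<eta>(2)[OF f] by blast
        have "(\<Sum>q\<in>Q. k * m (u @ w) * (case q of (a, l, c, h) \<Rightarrow> l * h powr (s - 1)))
          = k * m (u @ w) * (\<Sum>(a, l, c, h)\<in>Q. l * h powr (s - 1))" by (simp add: sum_distrib_left)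
        also have "\<dots> \<le> k * m (u @ w) * (2 * \<epsilon>)"
          using Qsum k m_pos[of "u @ w"] by (intro mult_left_mono) auto
        finally show "(\<Sum>q\<in>Q. k * m (u @ w) * (case q of (a, l, c, h) \<Rightarrow> l * h powr (s - 1))) \<le> 2 * k * \<epsilon> * m (u @ w)"
          by (simp add: mult_ac)
      qed
    qed
    have rest: "cheap_cover s \<delta> (F u ` X) (k * L * m u)" if u: "n \<le> length u" for u
    proof -
      let ?y = "transpose (mat_word A u) *v e0"
      have "?y \<noteq> 0" using cone_invariant_word[OF e0(1), of u] by (simp add: dir_cone_def)
      then have f: "norm ((1 / norm ?y) *\<^sub>R ?y) = 1" by simp
      have "cheap_cover s \<delta> (F u ` rect ((1 / norm ?y) *\<^sub>R ?y) big) (k * m u * L)"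
        using piece[OF u _ f refl, of "- R" "2 * R" "- R" "2 * R"] by (simp add: big_def Q'_def L_def)
      then show ?thesis using bigX[OF f] by (elim cheap_cover_mono) (auto simp: mult_ac)
    qed
    have D: "length w' = n" if "w' \<in> {w}" for w' using that w by simp
    have "(\<lambda>J. \<Sum>u\<in>avoiding {w} n J. m u) \<longlonglongrightarrow> 0" by (rule avoiding_null[OF D]) auto
    then have "\<forall>\<^sub>F J in sequentially. (\<Sum>u\<in>avoiding {w} n J. m u) < \<epsilon> / (k * L)"
      using \<epsilon> k L by (intro order_tendstoD) auto
    \<comment> \<open>A positive J gives the remaining words length at least n, as needed for
      \<open>rest\<close>.\<close>
    then have "\<forall>\<^sub>F J in sequentially. 0 < J \<and> (\<Sum>u\<in>avoiding {w} n J. m u) < \<epsilon> / (k * L)"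
      using eventually_gt_at_top[of 0] by eventually_elim auto
    then obtain J where J: "0 < J" "(\<Sum>u\<in>avoiding {w} n J. m u) < \<epsilon> / (k * L)"
      by (auto simp: eventually_sequentially)
    define S1 where "S1 = (\<Union>j\<in>{..<J}. \<Union>u\<in>avoiding {w} n j. F (u @ w) ` X)"
    define S2 where "S2 = (\<Union>u\<in>avoiding {w} n J. F u ` X)"
    have "cheap_cover s \<delta> S1 (\<Sum>j\<in>{..<J}. \<Sum>u\<in>avoiding {w} n j. 2 * k * \<epsilon> * m (u @ w))"
      unfolding S1_def by (intro cheap_cover_UN finite_avoiding finite_lessThan good)
    moreover have "n \<le> length u" if "u \<in> avoiding {w} n J" for u
      using avoiding_length[OF that] J(1) by simp
    then have "cheap_cover s \<delta> S2 (\<Sum>u\<in>avoiding {w} n J. k * L * m u)"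
      unfolding S2_def by (intro cheap_cover_UN finite_avoiding rest)
    ultimately have "cheap_cover s \<delta> (S1 \<union> S2) ((\<Sum>j\<in>{..<J}. \<Sum>u\<in>avoiding {w} n j. 2 * k * \<epsilon> * m (u @ w))
        + (\<Sum>u\<in>avoiding {w} n J. k * L * m u))"
      by (rule cheap_cover_Un)
    then have "cheap_cover s \<delta> X ((2 * k + 1) * \<epsilon>)"
    proof (rule cheap_cover_mono)
      show "X \<subseteq> S1 \<union> S2" unfolding S1_def S2_def using avoiding_cover[where D = "{w}" and J = J, OF D] by simp
      have "(\<Sum>j<J. \<Sum>u\<in>avoiding {w} n j. 2 * k * \<epsilon> * m (u @ w)) = 2 * k * \<epsilon> * (\<Sum>j<J. \<Sum>u\<in>avoiding {w} n j. \<Sum>w'\<in>{w}. m (u @ w'))"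
        by (simp add: sum_distrib_left)
      also have "\<dots> \<le> 2 * k * \<epsilon> * 1"
        using k \<epsilon> avoiding_hit_le[where D = "{w}" and J = J, OF D] by (intro mult_left_mono) auto
      finally have "(\<Sum>j<J. \<Sum>u\<in>avoiding {w} n j. 2 * k * \<epsilon> * m (u @ w)) \<le> 2 * k * \<epsilon>" by simp
      moreover have "(\<Sum>u\<in>avoiding {w} n J. k * L * m u) \<le> \<epsilon>"
        using J(2) k L by (simp add: sum_distrib_left[symmetric] field_simps)
      ultimately show "(\<Sum>j\<in>{..<J}. \<Sum>u\<in>avoiding {w} n j. 2 * k * \<epsilon> * m (u @ w))
        + (\<Sum>u\<in>avoiding {w} n J. k * L * m u) \<le> (2 * k + 1) * \<epsilon>"
        by (simp add: distrib_right)
    qed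
    then show "hausdorff_pre s \<delta> X \<le> ennreal ((2 * k + 1) * \<epsilon>)" using \<delta> by (rule cheap_cover_pre)
  qed
qed

text \<open>K is uniform in V, \<epsilon> and \<delta>, so directions whose slice integrals tend to
  0 already force \<open>hausdorff_pre\<close> to vanish; the infimum may be approached without
  being attained.\<close>

lemma hausdorff_pos_imp_slices_pos:
  assumes "hausdorff_measure s X > 0"
  shows "(INF V\<in>furstenberg_directions A C. slice_integral (s - 1) X V) > 0"
proof (rule ccontr)
  assume "\<not> ?thesis"
  then have INF0: "(INF V\<in>furstenberg_directions A C. slice_integral (s - 1) X V) = 0" by simp
  obtain K where K: "0 < K" "\<And>V \<epsilon> \<delta>. V \<in> furstenberg_directions A C \<Longrightarrow>
    slice_integral (s - 1) X V < ennreal \<epsilon> \<Longrightarrow> 0 < \<epsilon> \<Longrightarrow> 0 < \<delta> \<Longrightarrow> hausdorff_pre s \<delta> X \<le> ennreal (K * \<epsilon>)"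
    by (rule small_slice_imp_small_pre) metis
  obtain \<delta> where \<delta>: "0 < \<delta>" "0 < hausdorff_pre s \<delta> X"
    using assms unfolding hausdorff_measure_eq_SUP less_SUP_iff by auto
  have le: "hausdorff_pre s \<delta> X \<le> ennreal \<epsilon>" if \<epsilon>: "0 < \<epsilon>" for \<epsilon>
  proof -
    have "(INF V\<in>furstenberg_directions A C. slice_integral (s - 1) X V) < ennreal (\<epsilon> / K)"
      using INF0 \<epsilon> K(1) by simp
    then obtain V where "V \<in> furstenberg_directions A C" "slice_integral (s - 1) X V < ennreal (\<epsilon> / K)"
      by (auto simp: INF_less_iff)
    then show ?thesis using K(2)[of V "\<epsilon> / K" \<delta>] \<epsilon> K(1) \<delta>(1) by simp
  qed
  have "hausdorff_pre s \<delta> X \<le> 0"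
  proof (rule ennreal_le_epsilon)
    show "hausdorff_pre s \<delta> X \<le> 0 + ennreal \<epsilon>" if "0 < \<epsilon>" for \<epsilon>
      unfolding add_0_left using that by (rule le)
  qed
  then show False using \<delta> by simp
qed

end

section \<open>Cylinder masses and the equivalences\<close>

lemma cylinder_split: "cylinder w = (\<Union>i. cylinder (w @ [i]))"
  by (auto simp: in_cylinder_iff nth_append less_Suc_eq)

lemma cylinder_disjoint: "i \<noteq> j \<Longrightarrow> cylinder (w @ [i]) \<inter> cylinder (w @ [j]) = {}"
  by (force simp: in_cylinder_iff nth_append)

theorem theorem1p1:
  fixes A :: "'a::finite \<Rightarrow> real^2^2" and t :: "'a \<Rightarrow> real^2"
    and X :: "(real^2) set" and C :: "(real^2) set set"
    and \<mu> :: "(nat \<Rightarrow> 'a) measure" and s\<^sub>0 :: real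
  assumes contr: "\<And>i. onorm ((*v) (A i)) < 1"
    and inv: "\<And>i. det (A i) \<noteq> 0"
    and dom: "dominated A"
    and s0: "s\<^sub>0 = affinity_dim A" "1 < s\<^sub>0" "s\<^sub>0 \<le> 2"
    and X: "is_attractor (affine_ifs A t) X"
    and C: "strongly_invariant_multicone A C"
    and mu: "kaenmaki_measure A \<mu>"
  shows
    "(hausdorff_measure s\<^sub>0 X > 0
        \<longleftrightarrow> (\<exists>V\<in>furstenberg_directions A C. slice_integral (s\<^sub>0 - 1) X V > 0))
     \<and>
     ((\<exists>V\<in>furstenberg_directions A C. slice_integral (s\<^sub>0 - 1) X V > 0)
        \<longleftrightarrow> (INF V\<in>furstenberg_directions A C. slice_integral (s\<^sub>0 - 1) X V) > 0)
     \<and>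
     ((INF V\<in>furstenberg_directions A C. slice_integral (s\<^sub>0 - 1) X V) > 0
        \<longleftrightarrow> (\<exists>K>0. \<forall>x\<in>X. \<forall>r>0.
              measure (distr \<mu> borel (natural_proj (affine_ifs A t))) (cball x r) \<le> K * r powr s\<^sub>0))"
proof -
  define m where "m w = measure \<mu> (cylinder w)" for w
  from mu obtain c where \<mu>: "sets \<mu> = sets word_borel" "emeasure \<mu> UNIV = 1" and c: "c > 0"
    and mc: "\<And>w. inverse c * sv_function s\<^sub>0 (mat_word A w) \<le> m w" "\<And>w. m w \<le> c * sv_function s\<^sub>0 (mat_word A w)"
    unfolding kaenmaki_measure_def s0(1)[symmetric] m_def by blast
  have sp: "space \<mu> = UNIV" using sets_eq_imp_space_eq[OF \<mu>(1)] space_word_borel by simp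
  interpret finite_measure \<mu> by standard (simp add: sp \<mu>(2))
  interpret self_affine A C t X s\<^sub>0
    by standard (use contr inv dom s0 X C in auto)
  \<comment> \<open>The factor 2 is the loss between \<open>sv_function\<close> and
    \<open>phi\<close>.\<close>
  interpret gibbs A C t X s\<^sub>0 m "2 * c"
  proof
    have "cylinder ([] :: 'a list) = UNIV" by (auto simp: in_cylinder_iff)
    then show "m [] = 1" by (simp add: m_def measure_def \<mu>(2))
    show "m w = (\<Sum>i\<in>UNIV. m (w @ [i]))" for w
      unfolding m_def
      by (subst cylinder_split, rule finite_measure_finite_Union)
         (auto simp: disjoint_family_on_def cylinder_disjoint cylinder_sets \<mu>(1))
    show "0 < 2 * c" using c by simp
    fix w
    have d: "det (mat_word A w) \<noteq> 0" by (rule det_mat_word)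
    show "phi s\<^sub>0 (mat_word A w) \<le> 2 * c * m w"
      using sv_function_phi(2)[OF s0(2,3) d] mc(1)[of w] c by (simp add: field_simps)
    have "c * sv_function s\<^sub>0 (mat_word A w) \<le> c * phi s\<^sub>0 (mat_word A w)"
      using sv_function_phi(1)[OF s0(2,3) d] c by (intro mult_left_mono) auto
    moreover have "0 \<le> c * phi s\<^sub>0 (mat_word A w)" using phi_pos[OF d, of s\<^sub>0] c by simp
    ultimately show "m w \<le> 2 * c * phi s\<^sub>0 (mat_word A w)" using mc(2)[of w] by simp
  qed
  let ?a = "hausdorff_measure s\<^sub>0 X > 0"
  let ?b = "\<exists>V\<in>furstenberg_directions A C. slice_integral (s\<^sub>0 - 1) X V > 0"
  let ?c = "(INF V\<in>furstenberg_directions A C. slice_integral (s\<^sub>0 - 1) X V) > 0"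
  let ?d = "\<exists>K>0. \<forall>x\<in>X. \<forall>r>0. measure (distr \<mu> borel (natural_proj (affine_ifs A t))) (cball x r) \<le> K * r powr s\<^sub>0"
  \<comment> \<open>The equivalences follow from the cycle (a), (c), (b), (d), (a).\<close>
  have "?a \<Longrightarrow> ?c" by (rule hausdorff_pos_imp_slices_pos)
  moreover have "?b" if ?c
  proof -
    obtain V where V: "V \<in> furstenberg_directions A C" using furstenberg_nonempty by blast
    then have "(INF V\<in>furstenberg_directions A C. slice_integral (s\<^sub>0 - 1) X V) \<le> slice_integral (s\<^sub>0 - 1) X V"
      by (rule INF_lower)
    then show ?b using V that by (intro bexI[of _ V]) (auto intro: less_le_trans)
  qed
  moreover have "?d" if ?b
  proof -
    obtain V where V: "V \<in> furstenberg_directions A C" "slice_integral (s\<^sub>0 - 1) X V > 0" using \<open>?b\<close> by blast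
    show ?d by (rule slice_positive_imp_ball_bound[OF \<mu> m_def subsetD[OF furstenberg_subset V(1)] V(2)])
  qed
  moreover have "?a" if ?d
    using \<open>?d\<close> ball_bound_imp_hausdorff_pos[OF \<mu>] by blast
  ultimately show ?thesis by blast
qed

end
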